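(* Let $\mathbb{Q}$ be a probability measure on $S_0$ of the product form $\mathbb{Q}_\phi\otimes\mathbb{Q}_L$ (direction and length independent), where the directional distribution $\mathbb{Q}_\phi$ is uniform and the length distribution $\mathbb{Q}_L$ has support in $(0,2R]$ for some $R>0$. For each $n\in\mathbb{N}$ let $\xi^{(n)}$ be a stationary Gibbs planar segment process with reference particle distribution $\mathbb{Q}$ (the same for all $n$) and conditional intensity $$\lambda_n^*(K,\mathbf{x})=\tau_n\exp\Big\{-\beta_n\sum_{L\in\mathbf{x}}\mathbf{1}\{K\cap L\neq\emptyset\}\Big\},\qquad K\in S,\ \mathbf{x}\in\mathbf{N}^2,$$ where $\tau_n>0$ and $\beta_n\ge 0$. Suppose that $\beta_n\to 0$ as $n\to\infty$ and that there are constants $c_1,c_2$ with $0<c_1<\tau_n<c_2<\infty$ for all $n\in\mathbb{N}$. Let $\{W_n,\ n\in\mathbb{N}\}$ be a convex averaging sequence in $\mathbb{R}^2$ such that $Leb(W_n)=O(\beta_n^{-1})$, i.e. there is a constant $C<\infty$ with $\beta_n\,Leb(W_n)\le C$ for all $n$. For $n\in\mathbb{N}$ and $K\in S$ define $$\varphi_n(K)=\frac{1}{\sqrt{\tau_n\,Leb(W_n)}}\,\mathbf{1}\{K\cap W_n\neq\emptyset\},\qquad \psi_n(K)=\frac{l(K)}{\sqrt{\mathbb{E}_L l^2}}\,\varphi_n(K),$$ where $l(K)$ is the length of the segment $K$ and $\mathbb{E}_L l^2=\int r^2\,\mathbb{Q}_L(dr)$. Let $Z$ be a standard Gaussian random variable.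 Then, as $n\to\infty$, $$d_W(I_{\xi^{(n)}}(\varphi_n),Z)\to 0\qquad\text{and}\qquad d_W(I_{\xi^{(n)}}(\psi_n),Z)\to 0 .$$
   Context: $\mathcal{C}^2$ is the space of compact subsets of $\mathbb{R}^2$ with the Hausdorff metric and its Borel $\sigma$-algebra, $\mathcal{C}^{(2)}=\mathcal{C}^2\setminus\{\emptyset\}$. $S\subset\mathcal{C}^{(2)}$ is the space of all segments in $\mathbb{R}^2$ and $S_0\subset S$ the segments whose centre (midpoint) is the origin; a segment in $S_0$ is identified with its direction (an axial angle) and its length. Uniform directional distribution means that the direction angle is uniform (e.g. on $[0,\pi)$). $Leb$ is Lebesgue measure on $\mathbb{R}^2$. $c(K)$ denotes the centre of the circumscribed ball of $K\in\mathcal{C}^{(2)}$ (the midpoint if $K$ is a segment). $\mathbf{N}^2$ is the space of locally finite subsets $\mathbf{x}$ of $\mathcal{C}^{(2)}$, i.e. $\mathrm{card}\{L\in\mathbf{x}:L\cap K\neq\emptyset\}<\infty$ for all $K\in\mathcal{C}^{(2)}$, with the $\sigma$-algebra generated by the maps $\mathbf{x}\mapsto\mathrm{card}(\mathbf{x}\cap B)$, $B\subset\mathcal{C}^{2}$ bounded Borel. A particle process is a random element of $\mathbf{N}^2$; it is stationary if its distribution is invariant under $\mathbf{x}\mapsto\{K+x:K\in\mathbf{x}\}$ for every $x\in\mathbb{R}^2$. The reference measure is $$\lambda(B)=\int_{S_0}\int_{\mathbb{R}^2}\mathbf{1}\{K+x\in B\}\,dx\,\mathbb{Q}(dK),$$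 which is concentrated on $S$. A stationary Gibbs planar segment process $\xi$ with activity $\tau>0$, inverse temperature $\beta\ge0$ and reference particle distribution $\mathbb{Q}$, i.e. with conditional intensity $\lambda^*(K,\mathbf{x})=\tau\exp\{-\beta\sum_{L\in\mathbf{x}}\mathbf{1}\{K\cap L\neq\emptyset\}\}$, is a stationary particle process whose distribution $P$ satisfies the DLR equations: for every bounded $\Delta\subset\mathbb{R}^2$ with positive Lebesgue measure, the conditional law of $\mathbf{x}_\Delta=\{K\in\mathbf{x}:c(K)\in\Delta\}$ given $\mathbf{x}_{\Delta^c}=\{K\in\mathbf{x}:c(K)\notin\Delta\}$ has, for $P$-almost all $\mathbf{x}_{\Delta^c}$, density proportional to $\tau^{\mathrm{card}(\mathbf{x}_\Delta)}\exp(-\beta H_\Delta(\mathbf{x}))$ with respect to the Poisson process on $\{K:c(K)\in\Delta\}$ with intensity measure $\lambda$ restricted to that set, where $H_\Delta(\mathbf{x})$ is the number of unordered pairs of distinct $K,L\in\mathbf{x}$ with $K\cap L\ne\emptyset$ and at least one centre in $\Delta$. Equivalently, the GNZ equations hold: for every measurable $f:\mathcal{C}^{(2)}\times\mathbf{N}^2\to[0,\infty)$, $$\mathbb{E}\sum_{K\in\xi}f(K,\xi\setminus\{K\})=\mathbb{E}\int_{\mathcal{C}^{(2)}}f(K,\xi)\lambda^*(K,\xi)\,\lambda(dK).$$ The innovation of $\xi$ (with conditional intensity $\lambda^*$) for a measurable function $\varphi$ on segments is $$I_\xi(\varphi)=\sum_{K\in\xi}\varphi(K)-\int_{S}\varphi(K)\lambda^*(K,\xi)\,\lambda(dK);$$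 for $\xi=\xi^{(n)}$ the conditional intensity used is $\lambda_n^*$. The Wasserstein distance is $d_W(X,Z)=\sup_h|\mathbb{E}h(X)-\mathbb{E}h(Z)|$, the supremum over all $h:\mathbb{R}\to\mathbb{R}$ with Lipschitz constant at most $1$. A convex averaging sequence in $\mathbb{R}^2$ is a monotone increasing sequence of convex bounded Borel sets converging to $\mathbb{R}^2$ (i.e. with union $\mathbb{R}^2$). In particular $Leb(W_n)>0$ for all large $n$, and $\varphi_n,\psi_n$ are considered for such $n$. *)

theory Defs
  imports "HOL-Probability.Probability"
begin

section \<open>Particles and the Hausdorff metric\<close>

text \<open>The type \<open>particle\<close> is the space of nonempty compact subsets of the plane. The empty set,
  an isolated point of the space of all compact sets, never belongs to a configuration and is left
  out.\<close>

typedef particle = "{K :: (real^2) set. compact K \<and> K \<noteq> {}}"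
  morphisms pts Particle
  by (rule exI[of _ "{0}"]) auto

setup_lifting type_definition_particle

lemma compact_pts: "compact (pts K)" and pts_nonempty: "pts K \<noteq> {}"
  using pts[of K] by auto

definition hausdorff_excess :: "(real^2) set \<Rightarrow> (real^2) set \<Rightarrow> real" where
  "hausdorff_excess A B = (SUP x\<in>A. infdist x B)"

lemma bdd_above_infdist_pts: "bdd_above ((\<lambda>x. infdist x B) ` pts K)"
  by (intro bounded_imp_bdd_above compact_imp_bounded compact_continuous_image
        continuous_on_infdist continuous_on_id compact_pts)

lemma infdist_le_hausdorff_excess: "x \<in> pts K \<Longrightarrow> infdist x B \<le> hausdorff_excess (pts K) B"
  unfolding hausdorff_excess_def by (rule cSUP_upper[OF _ bdd_above_infdist_pts])

lemma hausdorff_excess_le_iff: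
  "hausdorff_excess (pts K) B \<le> e \<longleftrightarrow> (\<forall>x\<in>pts K. infdist x B \<le> e)"
  unfolding hausdorff_excess_def
  by (rule cSUP_le_iff[OF pts_nonempty bdd_above_infdist_pts])

lemma hausdorff_excess_nonneg: "0 \<le> hausdorff_excess (pts K) B"
proof -
  obtain x where "x \<in> pts K" using pts_nonempty by blast
  from infdist_le_hausdorff_excess[OF this] infdist_nonneg show ?thesis by (rule order_trans[rotated])
qed

lemma hausdorff_excess_triangle:
  "hausdorff_excess (pts K) (pts M)
    \<le> hausdorff_excess (pts K) (pts L) + hausdorff_excess (pts L) (pts M)"
  unfolding hausdorff_excess_le_iff
proof
  fix x assume x: "x \<in> pts K"
  obtain y where y: "y \<in> pts L" "infdist x (pts L) = dist x y"
    using infdist_attains_inf[OF compact_imp_closed[OF compact_pts] pts_nonempty] by blast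
  have "infdist x (pts M) \<le> infdist y (pts M) + dist x y"
    by (rule infdist_triangle)
  also have "infdist y (pts M) \<le> hausdorff_excess (pts L) (pts M)"
    by (rule infdist_le_hausdorff_excess[OF y(1)])
  also have "dist x y \<le> hausdorff_excess (pts K) (pts L)"
    using infdist_le_hausdorff_excess[OF x, of "pts L"] y(2) by simp
  finally show "infdist x (pts M)
      \<le> hausdorff_excess (pts K) (pts L) + hausdorff_excess (pts L) (pts M)"
    by simp
qed

lemma hausdorff_excess_le_0_iff: "hausdorff_excess (pts K) (pts L) \<le> 0 \<longleftrightarrow> pts K \<subseteq> pts L"
proof -
  have "infdist x (pts L) \<le> 0 \<longleftrightarrow> x \<in> pts L" for x
    using in_closed_iff_infdist_zero[OF compact_imp_closed[OF compact_pts] pts_nonempty, of x L]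
      infdist_nonneg[of x "pts L"] by linarith
  then show ?thesis unfolding hausdorff_excess_le_iff by auto
qed

instantiation particle :: metric_space
begin

definition dist_particle :: "particle \<Rightarrow> particle \<Rightarrow> real" where
  "dist_particle K L = max (hausdorff_excess (pts K) (pts L)) (hausdorff_excess (pts L) (pts K))"

definition uniformity_particle :: "(particle \<times> particle) filter" where
  "uniformity_particle = (INF e\<in>{0<..}. principal {(x, y). dist x y < e})"

definition open_particle :: "particle set \<Rightarrow> bool" where
  "open_particle U = (\<forall>x\<in>U. eventually (\<lambda>(x', y). x' = x \<longrightarrow> y \<in> U) uniformity)"

instance
proof
  fix K L M :: particle
  show "dist K L = 0 \<longleftrightarrow> K = L"
  proof -
    have "dist K L = 0 \<longleftrightarrow> hausdorff_excess (pts K) (pts L) \<le> 0 \<and> hausdorff_excess (pts L) (pts K) \<le> 0"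
      unfolding dist_particle_def
      using hausdorff_excess_nonneg[of K "pts L"] hausdorff_excess_nonneg[of L "pts K"] by linarith
    then show ?thesis by (auto simp: hausdorff_excess_le_0_iff pts_inject[symmetric])
  qed
  show "dist K L \<le> dist K M + dist L M"
    unfolding dist_particle_def
    using hausdorff_excess_triangle[of K L M] hausdorff_excess_triangle[of L K M] by linarith
qed (simp_all only: uniformity_particle_def open_particle_def)

end

lift_definition translate :: "real^2 \<Rightarrow> particle \<Rightarrow> particle" is "\<lambda>v K. (+) v ` K"
  by (auto intro: compact_translation)

definition hit :: "particle \<Rightarrow> particle \<Rightarrow> bool" where
  "hit K L \<longleftrightarrow> pts K \<inter> pts L \<noteq> {}"

text \<open>The centre of the smallest closed ball containing a particle.\<close>

definition circumcentre :: "particle \<Rightarrow> real^2" where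
  "circumcentre K =
     (THE z. \<exists>r. pts K \<subseteq> cball z r \<and> (\<forall>w s. pts K \<subseteq> cball w s \<longrightarrow> r \<le> s))"

section \<open>Segments\<close>

lift_definition segment :: "real^2 \<Rightarrow> real^2 \<Rightarrow> particle" is "\<lambda>a b. closed_segment a b"
  by simp

definition segments :: "particle set" where
  "segments = {segment a b | a b. a \<noteq> b}"

text \<open>For a segment, the length is the diameter.\<close>

definition seg_length :: "particle \<Rightarrow> real" where
  "seg_length K = diameter (pts K)"

lemma seg_length_segment: "seg_length (segment a b) = dist a b"
proof -
  have le: "dist x y \<le> dist a b" if "x \<in> closed_segment a b" "y \<in> closed_segment a b" for x y
    using dist_in_closed_segment that
    by (smt (verit) dist_decreases_closed_segment dist_commute)
  have "diameter (closed_segment a b) \<le> dist a b"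
    by (rule diameter_le) (auto simp: dist_norm[symmetric] le)
  moreover have "dist a b \<le> diameter (closed_segment a b)"
    by (rule diameter_bounded_bound) (auto intro: compact_imp_bounded)
  ultimately show ?thesis by (simp add: seg_length_def segment.rep_eq)
qed

lemma circumcentre_segment: "circumcentre (segment a b) = midpoint a b"
  unfolding circumcentre_def segment.rep_eq
proof (rule the_equality)
  have minimal: "dist a b / 2 \<le> s" if "closed_segment a b \<subseteq> cball w s" for w s
  proof -
    have "dist w a \<le> s" "dist w b \<le> s" using that by auto
    then show ?thesis using dist_triangle2[of a b w] by (simp add: dist_commute)
  qed
  have sub: "closed_segment a b \<subseteq> cball (midpoint a b) (dist a b / 2)"
    by (rule closed_segment_subset) (auto simp: dist_midpoint)
  show "\<exists>r. closed_segment a b \<subseteq> cball (midpoint a b) r \<and>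
      (\<forall>w s. closed_segment a b \<subseteq> cball w s \<longrightarrow> r \<le> s)"
    using minimal sub by blast
  fix z assume "\<exists>r. closed_segment a b \<subseteq> cball z r \<and>
      (\<forall>w s. closed_segment a b \<subseteq> cball w s \<longrightarrow> r \<le> s)"
  then obtain r where r: "closed_segment a b \<subseteq> cball z r" "r \<le> dist a b / 2"
    using sub by blast
  then have za: "dist z a \<le> dist a b / 2" and zb: "dist z b \<le> dist a b / 2"
    by auto
  then have n: "norm (z - a) \<le> norm (a - b) / 2" "norm (z - b) \<le> norm (a - b) / 2"
    by (simp_all add: dist_norm)
  have "(norm ((z - a) + (z - b)))\<^sup>2
      = 2 * (norm (z - a))\<^sup>2 + 2 * (norm (z - b))\<^sup>2 - (norm (a - b))\<^sup>2"
  proof -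
    have "(norm (p + q))\<^sup>2 = 2 * (norm p)\<^sup>2 + 2 * (norm q)\<^sup>2 - (norm (q - p))\<^sup>2"
      for p q :: "real^2"
      by (simp add: power2_norm_eq_inner inner_diff inner_add inner_commute)
    from this[of "z - a" "z - b"] show ?thesis by simp
  qed
  also have "\<dots> \<le> 2 * (norm (a - b) / 2)\<^sup>2 + 2 * (norm (a - b) / 2)\<^sup>2 - (norm (a - b))\<^sup>2"
    by (intro diff_right_mono add_mono mult_left_mono power_mono n) auto
  also have "\<dots> = 0" by (simp add: power_divide)
  finally have "(z - a) + (z - b) = 0" by simp
  then have "2 *\<^sub>R z = a + b" by (simp add: scaleR_2 algebra_simps)
  then have "(1 / 2) *\<^sub>R (2 *\<^sub>R z) = (1 / 2) *\<^sub>R (a + b)" by simp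
  then show "z = midpoint a b" by (simp add: midpoint_def)
qed

text \<open>A segment centred at the origin, given by its direction angle and its length.\<close>

definition centred_segment :: "real \<Rightarrow> real \<Rightarrow> particle" where
  "centred_segment \<theta> r =
     segment (- ((r / 2) *\<^sub>R vector [cos \<theta>, sin \<theta>])) ((r / 2) *\<^sub>R vector [cos \<theta>, sin \<theta>])"

text \<open>The reference particle distribution with independent direction and length, the direction being
  uniform on $[0,\pi)$ and the length having law \<open>QL\<close>.\<close>

definition isotropic_segment_law :: "real measure \<Rightarrow> particle measure" where
  "isotropic_segment_law QL =
     distr (uniform_measure lborel {0..<pi} \<Otimes>\<^sub>M QL) borel (\<lambda>(\<theta>, r). centred_segment \<theta> r)"

definition reference_measure :: "particle measure \<Rightarrow> particle measure" where
  "reference_measure Q = distr (Q \<Otimes>\<^sub>M lborel) borel (\<lambda>(K, v). translate v K)"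

section \<open>Configurations and particle processes\<close>

definition locally_finite :: "particle set \<Rightarrow> bool" where
  "locally_finite \<x> \<longleftrightarrow> (\<forall>K. finite {L \<in> \<x>. hit L K})"

text \<open>All counts below are genuine: a bounded set of particles contains only finitely many
  members of a locally finite configuration.\<close>

definition config_space :: "particle set measure" where
  "config_space = sigma {\<x>. locally_finite \<x>}
     {{\<x>. locally_finite \<x> \<and> card (\<x> \<inter> B) = k} | B k. B \<in> sets borel \<and> bounded B}"

definition stationary :: "'w measure \<Rightarrow> ('w \<Rightarrow> particle set) \<Rightarrow> bool" where
  "stationary M \<xi> \<longleftrightarrow>
     (\<forall>v. distr M config_space (\<lambda>\<omega>. translate v ` \<xi> \<omega>) = distr M config_space \<xi>)"

text \<open>The law of a Poisson process with locally finite intensity measure \<open>\<mu>\<close>.\<close>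

definition poisson_law :: "particle measure \<Rightarrow> particle set measure \<Rightarrow> bool" where
  "poisson_law \<mu> \<pi> \<longleftrightarrow>
     sets \<pi> = sets config_space \<and> prob_space \<pi> \<and>
     (\<forall>B\<in>sets borel. bounded B \<longrightarrow> emeasure \<mu> B < \<infinity> \<and>
        (\<forall>k. measure \<pi> {\<x> \<in> space \<pi>. card (\<x> \<inter> B) = k} =
             measure \<mu> B ^ k / fact k * exp (- measure \<mu> B))) \<and>
     (\<forall>\<B>. finite \<B> \<and> disjoint \<B> \<and> (\<forall>B\<in>\<B>. B \<in> sets borel \<and> bounded B) \<longrightarrow>
        prob_space.indep_vars \<pi> (\<lambda>_. count_space UNIV) (\<lambda>B \<x>. card (\<x> \<inter> B)) \<B>)"

section \<open>Gibbs processes\<close>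

definition centred_in :: "(real^2) set \<Rightarrow> particle set" where
  "centred_in \<Delta> = {K. circumcentre K \<in> \<Delta>}"

definition energy :: "(real^2) set \<Rightarrow> particle set \<Rightarrow> nat" where
  "energy \<Delta> \<x> = card {{K, L} | K L. K \<in> \<x> \<and> L \<in> \<x> \<and> K \<noteq> L \<and> hit K L \<and>
     (circumcentre K \<in> \<Delta> \<or> circumcentre L \<in> \<Delta>)}"

text \<open>The weight of the configuration \<open>\<y>\<close> inside \<open>\<Delta>\<close>, given \<open>\<z>\<close> outside \<open>\<Delta>\<close>.\<close>

definition gibbs_weight ::
  "real \<Rightarrow> real \<Rightarrow> (real^2) set \<Rightarrow> particle set \<Rightarrow> particle set \<Rightarrow> ennreal" where
  "gibbs_weight \<tau> \<beta> \<Delta> \<z> \<y> = ennreal (\<tau> ^ card \<y> * exp (- \<beta> * real (energy \<Delta> (\<y> \<union> \<z>))))"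

definition gibbs_kernel ::
  "real \<Rightarrow> real \<Rightarrow> (real^2) set \<Rightarrow> particle set measure \<Rightarrow> particle set \<Rightarrow> particle set measure" where
  "gibbs_kernel \<tau> \<beta> \<Delta> \<pi> \<z> =
     density \<pi> (\<lambda>\<y>. gibbs_weight \<tau> \<beta> \<Delta> \<z> \<y> / (\<integral>\<^sup>+ \<y>'. gibbs_weight \<tau> \<beta> \<Delta> \<z> \<y>' \<partial>\<pi>))"

text \<open>The DLR equations for a law \<open>P\<close>. The conditional law given the configuration outside \<open>\<Delta>\<close> is
  expressed by conditional expectations of indicators with respect to the $\sigma$-algebra generated
  by that configuration. The Poisson law in the definition exists and is uniquely determined.\<close>

definition DLR :: "real \<Rightarrow> real \<Rightarrow> particle measure \<Rightarrow> particle set measure \<Rightarrow> bool" where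
  "DLR \<tau> \<beta> Q P \<longleftrightarrow>
     (\<forall>\<Delta>\<in>sets borel. bounded \<Delta> \<and> emeasure lborel \<Delta> > 0 \<longrightarrow>
       (\<exists>\<pi>. poisson_law (density (reference_measure Q) (indicator (centred_in \<Delta>))) \<pi> \<and>
         (\<forall>A\<in>sets config_space. AE \<x> in P.
            nn_cond_exp P
              (vimage_algebra (space P) (\<lambda>\<x>. \<x> \<inter> centred_in (- \<Delta>)) config_space)
              (indicator {\<x>. \<x> \<inter> centred_in \<Delta> \<in> A}) \<x>
            = emeasure (gibbs_kernel \<tau> \<beta> \<Delta> \<pi> (\<x> \<inter> centred_in (- \<Delta>))) A)))"

definition stationary_gibbs ::
  "real \<Rightarrow> real \<Rightarrow> particle measure \<Rightarrow> 'w measure \<Rightarrow> ('w \<Rightarrow> particle set) \<Rightarrow> bool" where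
  "stationary_gibbs \<tau> \<beta> Q M \<xi> \<longleftrightarrow>
     prob_space M \<and> \<xi> \<in> measurable M config_space \<and> stationary M \<xi> \<and>
     DLR \<tau> \<beta> Q (distr M config_space \<xi>)"

definition cond_intensity :: "real \<Rightarrow> real \<Rightarrow> particle \<Rightarrow> particle set \<Rightarrow> real" where
  "cond_intensity \<tau> \<beta> K \<x> = \<tau> * exp (- \<beta> * real (card {L \<in> \<x>. hit K L}))"

text \<open>The integrand is a function on segments only, so the sum is restricted to segments as well; the
  reference measure is concentrated on \<open>segments\<close>, hence almost surely so is a Gibbs process.
  The restriction matters: for a Borel set \<open>W\<close>, \<open>{K. pts K \<inter> W \<noteq> {}}\<close> need not be Borel.\<close>

definition innovation ::
  "real \<Rightarrow> real \<Rightarrow> particle measure \<Rightarrow> (particle \<Rightarrow> real) \<Rightarrow> particle set \<Rightarrow> real" where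
  "innovation \<tau> \<beta> Q \<phi> \<x> =
     (\<Sum>\<^sub>\<infinity>K\<in>\<x> \<inter> segments. \<phi> K) -
     (LINT K:segments|reference_measure Q. \<phi> K * cond_intensity \<tau> \<beta> K \<x>)"

section \<open>Wasserstein distance and averaging sequences\<close>

text \<open>If \<open>X\<close> is not integrable and \<open>Z\<close> is, the supremum is infinite, because of the functions
  \<open>\<lambda>x. x + c\<close>, so the convention for Bochner integrals of non-integrable functions is harmless.\<close>

definition wasserstein_dist ::
  "'a measure \<Rightarrow> ('a \<Rightarrow> real) \<Rightarrow> 'b measure \<Rightarrow> ('b \<Rightarrow> real) \<Rightarrow> ennreal" where
  "wasserstein_dist M X N Z =
     (SUP h\<in>{h :: real \<Rightarrow> real. 1-lipschitz_on UNIV h}.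
        ennreal \<bar>(\<integral>\<omega>. h (X \<omega>) \<partial>M) - (\<integral>\<omega>. h (Z \<omega>) \<partial>N)\<bar>)"

definition convex_averaging :: "(nat \<Rightarrow> (real^2) set) \<Rightarrow> bool" where
  "convex_averaging W \<longleftrightarrow>
     incseq W \<and> (\<forall>n. convex (W n) \<and> bounded (W n) \<and> W n \<in> sets borel) \<and> (\<Union>n. W n) = UNIV"

definition hit_functional :: "real \<Rightarrow> (real^2) set \<Rightarrow> particle \<Rightarrow> real" where
  "hit_functional \<tau> W K = of_bool (pts K \<inter> W \<noteq> {}) / sqrt (\<tau> * measure lborel W)"

definition length_functional :: "real measure \<Rightarrow> real \<Rightarrow> (real^2) set \<Rightarrow> particle \<Rightarrow> real" where
  "length_functional QL \<tau> W K =
     seg_length K / sqrt (\<integral>r. r\<^sup>2 \<partial>QL) * hit_functional \<tau> W K"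

end

theory Submission
  imports Defs
begin

text \<open>
  Disintegrating the DLR equations over a large disc \<open>\<Delta>\<close> shows that the restriction of the Gibbs law to
  \<open>\<Delta>\<close> has a density \<open>q\<close> with respect to the Poisson law, and \<open>q (insert K y) = q y * \<lambda>\<^sup>*(K, y)\<close> when
  \<open>K\<close> is too far inside \<open>\<Delta>\<close> to be hit from outside. The Mecke equation then gives the GNZ equation.
  Applied to \<open>F g(F)\<close> for the innovation \<open>F\<close> of \<open>\<phi>\<close>, it yields
  \<open>E[F g(F)] = E \<integral> \<phi>(K) \<lambda>\<^sup>*(K, \<xi>) (g(F(\<xi> \<union> {K})) - g(F(\<xi>))) \<lambda>(dK)\<close>, where adding \<open>K\<close> changes \<open>F\<close> by
  \<open>\<phi>(K) + O(\<beta> sup \<phi>)\<close>. With \<open>g\<close> a sine or a cosine this is the differential equation \<open>f' = - u f\<close> for the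
  characteristic function of \<open>F\<close>, up to an error that vanishes since \<open>\<tau> \<integral> \<phi>\<^sup>2 d\<lambda>\<close> tends to 1, \<open>\<beta>\<close> tends to 0
  and \<open>sup \<phi>\<close> tends to 0. With \<open>g\<close> a truncated identity it bounds the second moment of \<open>F\<close>, which turns
  weak convergence into convergence in the Wasserstein distance, by way of a Skorohod coupling.
\<close>

section \<open>Topology of the particle space\<close>

text \<open>Two obstacles shape the proof. First, \<open>{K. pts K \<inter> W \<noteq> {}}\<close>
  need not be Borel for a Borel set \<open>W\<close>; among segments and for convex \<open>W\<close>
  it is, because contact with the boundary happens in a single point or along one of countably many
  edges. Second, a density with respect to a Poisson law exists only in a bounded window, so all
  identities live in a disc that contains every particle able to influence the innovation; the
  finite range \<open>2 * R\<close> of the interaction makes this possible. The constants balance as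
  follows. If \<open>V\<close> is the area of \<open>W n\<close>, the bound \<open>b\<close> for
  \<open>\<phi>\<close> is of order \<open>1 / sqrt V\<close> and the integral of
  \<open>\<phi>\<close> is of order \<open>b * V\<close>, so \<open>b\<close> times that integral
  stays bounded. The linear error then scales like \<open>\<beta>\<close>, the Taylor remainder like
  \<open>b\<close>. The variance is squeezed by dilation: a short segment centred at
  \<open>v\<close> meets \<open>W\<close> if \<open>v\<close> lies in \<open>W\<close>, and only if
  \<open>v\<close> lies in \<open>W\<close> scaled by \<open>1 + R / r\<close>, where
  \<open>r\<close> is the radius of a disc about 0 inside \<open>W\<close>; the radii grow, so the
  ratio of the two areas tends to 1.\<close>

lemma dist_particle_le_iff:
  "dist (K::particle) L \<le> e \<longleftrightarrow>
     (\<forall>x\<in>pts K. \<exists>y\<in>pts L. dist x y \<le> e) \<and> (\<forall>y\<in>pts L. \<exists>x\<in>pts K. dist y x \<le> e)"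
proof -
  have "infdist x (pts M) \<le> e \<longleftrightarrow> (\<exists>y\<in>pts M. dist x y \<le> e)" for x M
  proof
    assume "infdist x (pts M) \<le> e"
    then show "\<exists>y\<in>pts M. dist x y \<le> e"
      using infdist_attains_inf[OF compact_imp_closed[OF compact_pts] pts_nonempty] by metis
  qed (use infdist_le2 in blast)
  then show ?thesis
    unfolding dist_particle_def by (simp add: hausdorff_excess_le_iff)
qed

lemma dist_particleE1:
  assumes "x \<in> pts K" obtains y where "y \<in> pts L" "dist x y \<le> dist K L"
  using assms dist_particle_le_iff[of K L "dist K L"] by blast

lemma pts_Particle: "compact K \<Longrightarrow> K \<noteq> {} \<Longrightarrow> pts (Particle K) = K"
  by (simp add: Particle_inverse)

lemma finite_particles_dense:
  assumes dense: "\<And>X::(real^2) set. open X \<Longrightarrow> X \<noteq> {} \<Longrightarrow> \<exists>d\<in>D. d \<in> X" and e: "e > 0"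
  shows "\<exists>F. finite F \<and> F \<noteq> {} \<and> F \<subseteq> D \<and> dist (Particle F) K < e"
proof -
  have "pts K \<subseteq> (\<Union>q\<in>D. ball q (e/2))"
  proof
    fix x assume "x \<in> pts K"
    obtain q where "q \<in> D" "q \<in> ball x (e/2)" using dense[of "ball x (e/2)"] e by auto
    then show "x \<in> (\<Union>q\<in>D. ball q (e/2))" by (auto simp: dist_commute)
  qed
  then obtain F0 where F0: "F0 \<subseteq> D" "finite F0" "pts K \<subseteq> (\<Union>q\<in>F0. ball q (e/2))"
    using compactE_image[OF compact_pts, of D "\<lambda>q. ball q (e/2)" K] by (metis open_ball)
  \<comment> \<open>Balls of the subcover that miss \<open>K\<close> are dropped: their centres may
    be far from \<open>K\<close>, which would spoil one half of the Hausdorff bound.\<close>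
  define F where "F = {q\<in>F0. ball q (e/2) \<inter> pts K \<noteq> {}}"
  have cov: "\<exists>q\<in>F. dist x q \<le> e/2" if "x \<in> pts K" for x
  proof -
    from that F0(3) obtain q where q: "q \<in> F0" "x \<in> ball q (e/2)" by blast
    then have "q \<in> F" using that by (auto simp: F_def)
    with q(2) show ?thesis by (auto simp: dist_commute intro!: bexI[of _ q])
  qed
  have fin: "finite F" "F \<subseteq> D" using F0 by (auto simp: F_def)
  have ne: "F \<noteq> {}" using cov pts_nonempty[of K] by blast
  have "dist (Particle F) K \<le> e/2"
    unfolding dist_particle_le_iff pts_Particle[OF finite_imp_compact[OF fin(1)] ne]
  proof (intro conjI ballI)
    fix q assume "q \<in> F"
    then obtain x where "x \<in> pts K" "dist q x < e/2" unfolding F_def by auto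
    then show "\<exists>x\<in>pts K. dist q x \<le> e/2" by (intro bexI[of _ x]) auto
  qed (rule cov)
  then show ?thesis using fin ne e by (intro exI[of _ F]) auto
qed

text \<open>Finite subsets of a countable dense set of the plane are dense among the particles, and
  balls with radii \<open>1 / Suc n\<close> around them form a basis. Second countability is what
  makes \<open>borel \<Otimes>\<^sub>M borel\<close> the Borel algebra of the product, so that
  jointly continuous or closed relations become measurable.\<close>

instance particle :: second_countable_topology
proof
  obtain D :: "(real^2) set" where D: "countable D"
    "\<And>X. open X \<Longrightarrow> X \<noteq> {} \<Longrightarrow> \<exists>d\<in>D. d \<in> X"
    by (rule countable_dense_setE) auto
  define DD where "DD = Particle ` {F. F \<subseteq> D \<and> finite F}"
  have cD: "countable DD" unfolding DD_def
    using countable_Collect_finite_subset[OF D(1)] by (simp add: conj_commute)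
  have dense: "\<exists>d\<in>DD. dist d K < e" if "e > 0" for K e
    using finite_particles_dense[OF D(2) that, of K] by (auto simp: DD_def)
  define B where "B = (\<lambda>(d, n). ball d (1 / Suc n)) ` (DD \<times> (UNIV :: nat set))"
  have "topological_basis B"
  proof (rule topological_basisI)
    fix U :: "particle set" and K assume U: "open U" "K \<in> U"
    then obtain e where e: "e > 0" "ball K e \<subseteq> U" by (auto simp: open_contains_ball)
    obtain n where n: "1 / Suc n < e / 2" using nat_approx_posE[of "e/2"] e by auto
    obtain d where d: "d \<in> DD" "dist d K < 1 / Suc n" using dense[of "1 / Suc n"] by auto
    have "ball d (1 / Suc n) \<subseteq> ball K e"
    proof
      fix L assume "L \<in> ball d (1 / Suc n)"
      then have "dist K L < 1 / Suc n + 1 / Suc n"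
        using d(2) dist_triangle[of K L d] by (simp add: dist_commute)
      then show "L \<in> ball K e" using n by simp
    qed
    moreover have "ball d (1 / Suc n) \<in> B" using d(1) by (auto simp: B_def)
    ultimately show "\<exists>V\<in>B. K \<in> V \<and> V \<subseteq> U" using d(2) e(2) by (intro bexI) auto
  qed (auto simp: B_def)
  then show "\<exists>B::particle set set. countable B \<and> open = generate_topology B"
    using cD by (intro exI[of _ B]) (auto simp: B_def intro: topological_basis_imp_subbasis)
qed

lemma dist_translate_le: "dist (translate v K) (translate w L) \<le> dist K L + dist v w"
proof -
  have *: "\<exists>y\<in>pts (translate w L). dist x y \<le> dist K L + dist v w"
    if "x \<in> pts (translate v K)" for x v w K L
  proof -
    from that obtain k where k: "k \<in> pts K" "x = v + k" by (auto simp: translate.rep_eq)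
    obtain l where l: "l \<in> pts L" "dist k l \<le> dist K L" using dist_particleE1[OF k(1)] .
    have "dist (v + k) (w + l) \<le> dist k l + dist v w"
      using dist_triangle_add[of v k w l] by simp
    with l k show ?thesis by (intro bexI[of _ "w + l"]) (auto simp: translate.rep_eq)
  qed
  show ?thesis unfolding dist_particle_le_iff
    using *[of _ v K w L] *[of _ w L v K] by (simp add: dist_commute)
qed

lemma continuous_translate: "continuous_on UNIV (\<lambda>(K, v). translate v K)"
  unfolding continuous_on_iff
proof (safe, goal_cases)
  case (1 K v e)
  show ?case
  proof (intro exI[of _ "e/2"] conjI ballI impI, goal_cases)
    case (2 p)
    obtain L w where p: "p = (L, w)" by (cases p)
    have "dist L K < e/2" "dist w v < e/2"
      using 2 p dist_fst_le[of p "(K, v)"] dist_snd_le[of p "(K, v)"] by auto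
    then show ?case using dist_translate_le[of w L v K] p by auto
  qed (use 1 in auto)
qed

lemma measurable_translate [measurable]:
  "(\<lambda>(K, v). translate v K) \<in> borel_measurable (borel \<Otimes>\<^sub>M borel)"
  unfolding borel_prod by (rule borel_measurable_continuous_onI[OF continuous_translate])

lemma dist_segment_le: "dist (segment a b) (segment c d) \<le> max (dist a c) (dist b d)"
proof -
  have *: "\<exists>y\<in>closed_segment c d. dist x y \<le> max (dist a c) (dist b d)"
    if "x \<in> closed_segment a b" for x and a b c d :: "real^2"
  proof -
    from that obtain u where u: "x = (1 - u) *\<^sub>R a + u *\<^sub>R b" "0 \<le> u" "u \<le> 1"
      by (auto simp: closed_segment_def)
    let ?y = "(1 - u) *\<^sub>R c + u *\<^sub>R d"
    have "dist x ?y \<le> dist ((1 - u) *\<^sub>R a) ((1 - u) *\<^sub>R c) + dist (u *\<^sub>R b) (u *\<^sub>R d)"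
      unfolding u(1) by (rule dist_triangle_add)
    also have "\<dots> = (1 - u) * dist a c + u * dist b d"
      using u(2,3) by (simp add: dist_norm flip: scaleR_diff_right)
    also have "\<dots> \<le> max (dist a c) (dist b d)"
      using u by (intro convex_bound_le) auto
    finally show ?thesis using u by (intro bexI[of _ ?y]) (auto simp: closed_segment_def)
  qed
  show ?thesis unfolding dist_particle_le_iff segment.rep_eq
    using *[of _ a b c d] *[of _ c d a b] by (simp add: dist_commute)
qed

lemma continuous_segment: "continuous_on UNIV (\<lambda>(a, b). segment a b)"
  unfolding continuous_on_iff
proof (safe, goal_cases)
  case (1 a b e)
  show ?case
  proof (intro exI[of _ e] conjI ballI impI, goal_cases)
    case (2 p)
    obtain c d where p: "p = (c, d)" by (cases p)
    have "dist c a < e" "dist d b < e"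
      using 2 p dist_fst_le[of p "(a, b)"] dist_snd_le[of p "(a, b)"] by auto
    then show ?case using dist_segment_le[of c d a b] p by auto
  qed (use 1 in auto)
qed

text \<open>The condition \<open>a \<noteq> b\<close> is open, so it is exhausted by the closed
  conditions \<open>1 / Suc n \<le> dist a b\<close> on bounded discs; the continuous image of each
  such compact set of end points is compact.\<close>

lemma segments_borel [measurable]: "segments \<in> sets borel"
proof -
  define A where "A n = {(a, b :: real^2). a \<in> cball 0 (real n) \<and> b \<in> cball 0 (real n) \<and>
      1 / Suc n \<le> dist a b}" for n
  have "compact (A n)" for n
  proof -
    have "A n = (cball 0 (real n) \<times> cball 0 (real n)) \<inter> {p. 1 / Suc n \<le> dist (fst p) (snd p)}"
      by (auto simp: A_def)
    moreover have "closed {p :: (real^2) \<times> (real^2). 1 / Suc n \<le> dist (fst p) (snd p)}"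
      by (intro closed_Collect_le continuous_intros)
    ultimately show ?thesis by (auto intro!: compact_Int_closed compact_Times)
  qed
  then have "compact ((\<lambda>(a, b). segment a b) ` A n)" for n
    by (intro compact_continuous_image continuous_on_subset[OF continuous_segment]) auto
  then have *: "(\<Union>n. (\<lambda>(a, b). segment a b) ` A n) \<in> sets borel"
    by (intro sets.countable_UN'' countableI_type borel_closed compact_imp_closed)
  have "segments = (\<Union>n. (\<lambda>(a, b). segment a b) ` A n)"
  proof (intro equalityI subsetI)
    fix K assume "K \<in> segments"
    then obtain a b where K: "K = segment a b" "a \<noteq> b" by (auto simp: segments_def)
    obtain m where m: "1 / Suc m < dist a b" using K nat_approx_posE[of "dist a b"] by auto
    obtain k where k: "max (norm a) (norm b) \<le> real k" using real_arch_simple by blast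
    have "1 / Suc (max m k) \<le> 1 / Suc m" by (intro divide_left_mono) auto
    then have "(a, b) \<in> A (max m k)" using m k by (auto simp: A_def)
    then show "K \<in> (\<Union>n. (\<lambda>(a, b). segment a b) ` A n)" using K by blast
  next
    fix K assume "K \<in> (\<Union>n. (\<lambda>(a, b). segment a b) ` A n)"
    then obtain n a b where n: "(a, b) \<in> A n" "K = segment a b" by auto
    have "0 < 1 / real (Suc n)" by simp
    with n(1) have "a \<noteq> b" by (auto simp: A_def)
    then show "K \<in> segments" using n(2) by (auto simp: segments_def)
  qed
  with * show ?thesis by simp
qed

lemma closed_meets:
  assumes C: "closed C" shows "closed {K. pts K \<inter> C \<noteq> {}}"
  unfolding closed_def open_dist
proof
  fix K assume "K \<in> - {K. pts K \<inter> C \<noteq> {}}"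
  then have "pts K \<inter> C = {}" by simp
  then obtain d where d: "d > 0" "\<And>x y. x \<in> pts K \<Longrightarrow> y \<in> C \<Longrightarrow> d \<le> dist x y"
    using separate_compact_closed[OF compact_pts C, of K] by metis
  have "L \<in> - {K. pts K \<inter> C \<noteq> {}}" if "dist L K < d" for L
  proof
    assume "L \<in> {K. pts K \<inter> C \<noteq> {}}"
    then obtain y where "y \<in> pts L" "y \<in> C" by blast
    then obtain x where "x \<in> pts K" "dist y x \<le> dist L K" "y \<in> C" using dist_particleE1 by blast
    with that d(2)[of x y] show False by (simp add: dist_commute)
  qed
  with d(1) show "\<exists>e>0. \<forall>L. dist L K < e \<longrightarrow> L \<in> - {K. pts K \<inter> C \<noteq> {}}" by blast
qed

lemma open_meets: "open U \<Longrightarrow> open {K. pts K \<inter> U \<noteq> {}}"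
  unfolding open_dist
proof (intro ballI, goal_cases)
  case (1 K)
  then obtain x where "x \<in> pts K" "x \<in> U" by blast
  note 1 = 1(1) this
  then obtain e where e: "e > 0" "\<And>y. dist y x < e \<Longrightarrow> y \<in> U" by blast
  show ?case
  proof (intro exI[of _ e] conjI allI impI, goal_cases)
    case (2 L)
    obtain y where y: "y \<in> pts L" "dist x y \<le> dist K L" using dist_particleE1[OF 1(2)] .
    then have "y \<in> U" using 2 e(2)[of y] by (simp add: dist_commute)
    then show ?case using y 2 by blast
  qed (use e in auto)
qed

lemma measurable_meets_open: "open U \<Longrightarrow> {K. pts K \<inter> U \<noteq> {}} \<in> sets borel"
  by (intro borel_open open_meets)

lemma measurable_meets_closed: "closed C \<Longrightarrow> {K. pts K \<inter> C \<noteq> {}} \<in> sets borel"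
  by (intro borel_closed closed_meets)

lemma hit_commute: "hit K L \<longleftrightarrow> hit L K"
  by (auto simp: hit_def)

text \<open>Disjoint compact sets have a positive distance \<open>d\<close>, and moving each of them
  by less than \<open>d/2\<close> in the Hausdorff metric cannot make them meet.\<close>

lemma closed_hit: "closed {p. hit (fst p) (snd p)}"
  unfolding closed_def open_dist
proof
  fix KL assume "KL \<in> - {p. hit (fst p) (snd p)}"
  moreover obtain K L where KL: "KL = (K, L)" by (cases KL)
  ultimately have "pts K \<inter> pts L = {}" by (simp add: hit_def)
  then obtain d where d: "d > 0" "\<And>x y. x \<in> pts K \<Longrightarrow> y \<in> pts L \<Longrightarrow> d \<le> dist x y"
    using separate_compact_closed[OF compact_pts compact_imp_closed[OF compact_pts], of K L] by metis
  have "p \<in> - {p. hit (fst p) (snd p)}" if "dist p (K, L) < d/2" for p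
  proof
    assume "p \<in> {p. hit (fst p) (snd p)}"
    then obtain z where z: "z \<in> pts (fst p)" "z \<in> pts (snd p)" by (auto simp: hit_def)
    obtain x where x: "x \<in> pts K" "dist z x \<le> dist (fst p) K" using z dist_particleE1 by blast
    obtain y where y: "y \<in> pts L" "dist z y \<le> dist (snd p) L" using z dist_particleE1 by blast
    have "dist (fst p) K < d/2" "dist (snd p) L < d/2"
      using that dist_fst_le[of p "(K, L)"] dist_snd_le[of p "(K, L)"] by auto
    moreover have "dist x y \<le> dist z x + dist z y" using dist_triangle3[of x y z] by simp
    ultimately show False using x y d(2)[of x y] by simp
  qed
  then show "\<exists>e>0. \<forall>p. dist p KL < e \<longrightarrow> p \<in> - {p. hit (fst p) (snd p)}"
    using d(1) unfolding KL by (intro exI[of _ "d/2"]) auto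
qed

lemma measurable_hit [measurable]:
  "Measurable.pred (borel \<Otimes>\<^sub>M borel) (\<lambda>p. hit (fst p) (snd p))"
  unfolding borel_prod using closed_hit by (auto simp: pred_def intro!: borel_closed)


section \<open>Existence, stability and continuity of the circumcentre\<close>

lemma pts_subset_cball_iff: "pts K \<subseteq> cball z r \<longleftrightarrow> hausdorff_excess (pts K) {z} \<le> r"
  unfolding hausdorff_excess_le_iff by (auto simp: dist_commute subset_eq)

text \<open>The least covering radius \<open>g z\<close> about \<open>z\<close> is 1-Lipschitz in
  \<open>z\<close>, and for any \<open>x0\<close> in \<open>K\<close> it exceeds \<open>g x0\<close>
  outside \<open>cball x0 (g x0)\<close>; so a minimum over that compact disc is global.\<close>

lemma circumscribed_ball_exists:
  obtains z r where "pts K \<subseteq> cball z r" "\<And>w s. pts K \<subseteq> cball w s \<Longrightarrow> r \<le> s"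
proof -
  define g where "g z = hausdorff_excess (pts K) {z}" for z
  have g: "pts K \<subseteq> cball z r \<longleftrightarrow> g z \<le> r" for z r
    by (simp add: pts_subset_cball_iff g_def)
  have lip: "g z \<le> g w + dist z w" for z w
  proof -
    have "pts K \<subseteq> cball w (g w)" by (simp add: g)
    also have "\<dots> \<subseteq> cball z (g w + dist z w)"
      by (simp add: cball_subset_cball_iff dist_commute)
    finally show ?thesis by (simp add: g)
  qed
  have cont: "continuous_on S g" for S
  proof (rule continuous_on_subset[of UNIV])
    have "1-lipschitz_on UNIV g"
    proof (rule lipschitz_onI)
      fix z w show "dist (g z) (g w) \<le> 1 * dist z w"
        using lip[of z w] lip[of w z] by (simp add: dist_real_def dist_commute abs_le_iff)
    qed simp
    then show "continuous_on UNIV g" by (rule lipschitz_on_continuous_on)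
  qed simp
  obtain x0 where x0: "x0 \<in> pts K" using pts_nonempty by blast
  have "0 \<le> g x0" unfolding g_def by (rule hausdorff_excess_nonneg)
  then obtain z where z: "z \<in> cball x0 (g x0)" "\<And>w. w \<in> cball x0 (g x0) \<Longrightarrow> g z \<le> g w"
    using continuous_attains_inf[OF compact_cball _ cont, of x0 "g x0"] by auto
  have "g z \<le> g w" for w
  proof (cases "w \<in> cball x0 (g x0)")
    case False
    have "dist w x0 \<le> g w" using g[of w "g w"] x0 by auto
    with False have "g x0 \<le> g w" by (simp add: dist_commute)
    moreover have "g z \<le> g x0" using z(2)[of x0] \<open>0 \<le> g x0\<close> by simp
    ultimately show ?thesis by simp
  qed (use z in auto)
  then show ?thesis using that[of z "g z"] g by (metis order_refl order_trans)
qed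

text \<open>By the parallelogram law \<open>K\<close> lies in the disc about the midpoint of
  \<open>z\<close> and \<open>w\<close> with squared radius
  \<open>s\<^sup>2 - (dist z w)\<^sup>2 / 4\<close>, and minimality of \<open>r\<close> applies to
  that disc. The case \<open>s = r\<close> gives uniqueness of the centre, the case of
  \<open>s\<close> close to \<open>r\<close> its continuity.\<close>

lemma circumscribed_ball_unique:
  assumes z: "pts K \<subseteq> cball z r" "\<And>w s. pts K \<subseteq> cball w s \<Longrightarrow> r \<le> s"
    and w: "pts K \<subseteq> cball w s"
  shows "(dist z w)\<^sup>2 \<le> 4 * (s\<^sup>2 - r\<^sup>2)"
proof -
  have rs: "r \<le> s" using z(2) w by blast
  obtain x0 where x0: "x0 \<in> pts K" using pts_nonempty by blast
  have "dist z x0 \<le> r" using x0 z(1) by auto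
  then have r0: "0 \<le> r" using zero_le_dist[of z x0] by linarith
  have mid: "(dist (midpoint z w) x)\<^sup>2 \<le> s\<^sup>2 - (dist z w)\<^sup>2 / 4" if "x \<in> pts K" for x
  proof -
    have d: "dist z x \<le> s" "dist w x \<le> s" using that z(1) w rs by force+
    have "dist (midpoint z w) x = norm ((1/2) *\<^sub>R ((z - x) + (w - x)))"
      unfolding midpoint_def dist_norm by (rule arg_cong[of _ _ norm]) (simp add: vec_eq_iff field_simps)
    then have "dist (midpoint z w) x = norm ((z - x) + (w - x)) / 2"
      by (simp only: norm_scaleR)
    then have "(dist (midpoint z w) x)\<^sup>2 = (norm ((z - x) + (w - x)))\<^sup>2 / 4"
      by (simp only: power_divide) simp
    also have "(norm ((z - x) + (w - x)))\<^sup>2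
        = 2 * (dist z x)\<^sup>2 + 2 * (dist w x)\<^sup>2 - (dist z w)\<^sup>2"
    proof -
      have "(norm (p + q))\<^sup>2 = 2 * (norm p)\<^sup>2 + 2 * (norm q)\<^sup>2 - (norm (p - q))\<^sup>2"
        for p q :: "real^2"
        by (simp add: power2_norm_eq_inner inner_diff inner_add inner_commute)
      from this[of "z - x" "w - x"] show ?thesis by (simp only: dist_norm) simp
    qed
    finally show ?thesis
      using power_mono[OF d(1) zero_le_dist, of 2] power_mono[OF d(2) zero_le_dist, of 2] by simp
  qed
  have nn: "0 \<le> s\<^sup>2 - (dist z w)\<^sup>2 / 4"
    using mid[OF x0] zero_le_power2[of "dist (midpoint z w) x0"] by linarith
  have "pts K \<subseteq> cball (midpoint z w) (sqrt (s\<^sup>2 - (dist z w)\<^sup>2 / 4))"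
    using mid by (auto simp: real_le_rsqrt)
  then have "r \<le> sqrt (s\<^sup>2 - (dist z w)\<^sup>2 / 4)" by (rule z(2))
  then have "r\<^sup>2 \<le> s\<^sup>2 - (dist z w)\<^sup>2 / 4"
    using r0 nn power_mono[of r "sqrt (s\<^sup>2 - (dist z w)\<^sup>2 / 4)" 2] by simp
  then show ?thesis by simp
qed

lemma circumcentre_eqI:
  assumes "pts K \<subseteq> cball z r" "\<And>w s. pts K \<subseteq> cball w s \<Longrightarrow> r \<le> s"
  shows "circumcentre K = z"
  unfolding circumcentre_def
proof (rule the_equality)
  fix w assume "\<exists>s. pts K \<subseteq> cball w s \<and> (\<forall>u t. pts K \<subseteq> cball u t \<longrightarrow> s \<le> t)"
  then obtain s where s: "pts K \<subseteq> cball w s" "\<And>u t. pts K \<subseteq> cball u t \<Longrightarrow> s \<le> t" by blast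
  have "r = s" using assms s by (simp add: order_antisym)
  then show "w = z" using circumscribed_ball_unique[OF assms s(1)] by simp
qed (use assms in blast)

lemma pts_subset_cball_dist:
  "pts K \<subseteq> cball z r \<Longrightarrow> pts L \<subseteq> cball z (r + dist K L)"
proof
  fix y assume K: "pts K \<subseteq> cball z r" and "y \<in> pts L"
  then obtain x where x: "x \<in> pts K" "dist y x \<le> dist L K" using dist_particleE1 by blast
  have "dist z y \<le> dist z x + dist y x" by (rule dist_triangle2)
  with x K show "y \<in> cball z (r + dist K L)" by (force simp: dist_commute)
qed

text \<open>If \<open>L\<close> has distance \<open>d\<close> from \<open>K\<close>, its minimal
  radius is at most \<open>r + d\<close>, and its minimal disc enlarged by \<open>d\<close> covers
  \<open>K\<close>. So a disc of radius \<open>r + 2 * d\<close> about the centre of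
  \<open>L\<close> covers \<open>K\<close>, and the quantitative uniqueness bounds the distance of
  the two centres.\<close>

lemma continuous_circumcentre: "continuous_on UNIV circumcentre"
proof (rule continuous_at_imp_continuous_on, rule ballI)
  fix K
  obtain z r where z: "pts K \<subseteq> cball z r" "\<And>w s. pts K \<subseteq> cball w s \<Longrightarrow> r \<le> s"
    using circumscribed_ball_exists[of K] by metis
  have bound: "dist (circumcentre L) (circumcentre K) \<le> sqrt (4 * ((r + 2 * dist L K)\<^sup>2 - r\<^sup>2))" for L
  proof -
    obtain w s where w: "pts L \<subseteq> cball w s" "\<And>u t. pts L \<subseteq> cball u t \<Longrightarrow> s \<le> t"
      using circumscribed_ball_exists[of L] by metis
    have "s \<le> r + dist L K"
      using w(2)[OF pts_subset_cball_dist[OF z(1)]] by (simp add: dist_commute)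
    then have "cball w (s + dist L K) \<subseteq> cball w (r + 2 * dist L K)" by auto
    with pts_subset_cball_dist[OF w(1), of K] have "pts K \<subseteq> cball w (r + 2 * dist L K)" by blast
    from circumscribed_ball_unique[OF z this]
    have "(dist w z)\<^sup>2 \<le> 4 * ((r + 2 * dist L K)\<^sup>2 - r\<^sup>2)" by (simp add: dist_commute)
    moreover have "circumcentre K = z" "circumcentre L = w"
      using circumcentre_eqI z w by blast+
    ultimately show ?thesis by (simp add: real_le_rsqrt)
  qed
  have "((\<lambda>L. sqrt (4 * ((r + 2 * dist L K)\<^sup>2 - r\<^sup>2))) \<longlongrightarrow> sqrt (4 * ((r + 2 * dist K K)\<^sup>2 - r\<^sup>2))) (at K)"
    by (intro tendsto_intros)
  then have lim: "((\<lambda>L. sqrt (4 * ((r + 2 * dist L K)\<^sup>2 - r\<^sup>2))) \<longlongrightarrow> 0) (at K)" by simp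
  have "((\<lambda>L. dist (circumcentre L) (circumcentre K)) \<longlongrightarrow> 0) (at K)"
    by (rule tendsto_sandwich[OF _ _ tendsto_const lim]) (use bound in auto)
  then show "isCont circumcentre K" unfolding isCont_def by (subst tendsto_dist_iff)
qed

lemma measurable_circumcentre [measurable]: "circumcentre \<in> borel_measurable borel"
  by (rule borel_measurable_continuous_onI[OF continuous_circumcentre])

lemma centred_in_borel [measurable]: "\<Delta> \<in> sets borel \<Longrightarrow> centred_in \<Delta> \<in> sets borel"
  using measurable_sets[OF measurable_circumcentre, of \<Delta>] by (simp add: centred_in_def vimage_def)

section \<open>Segments hitting a convex set\<close>

text \<open>\<open>D\<close> consists of the rationals in \<open>S\<close> and of those end points
  that belong to \<open>S\<close>. An interval, open or closed at either end, thus becomes a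
  countable union of compact intervals with end points in \<open>D\<close>.\<close>

lemma ex_dense_less_more:
  fixes S :: "real set"
  assumes "convex S"
  obtains D where "countable D" "D \<subseteq> S" "\<And>t. t \<in> S \<Longrightarrow> \<exists>u\<in>D. \<exists>v\<in>D. u \<le> t \<and> t \<le> v"
proof
  define D where "D = (S \<inter> \<rat>) \<union> {t\<in>S. \<forall>s\<in>S. s \<le> t} \<union> {t\<in>S. \<forall>s\<in>S. t \<le> s}"
  have "{t\<in>S. \<forall>s\<in>S. s \<le> t} \<subseteq> {THE t. t \<in> S \<and> (\<forall>s\<in>S. s \<le> t)}"
    by (auto intro!: the_equality[symmetric] intro: order_antisym)
  moreover have "{t\<in>S. \<forall>s\<in>S. t \<le> s} \<subseteq> {THE t. t \<in> S \<and> (\<forall>s\<in>S. t \<le> s)}"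
    by (auto intro!: the_equality[symmetric] intro: order_antisym)
  ultimately have "finite {t\<in>S. \<forall>s\<in>S. s \<le> t}" "finite {t\<in>S. \<forall>s\<in>S. t \<le> s}"
    by (meson finite.emptyI finite_insert finite_subset)+
  then show "countable D"
    unfolding D_def using countable_rat by (auto intro: countable_finite countable_Int2)
  show "D \<subseteq> S" by (auto simp: D_def)
  fix t assume t: "t \<in> S"
  have between: "s \<in> S" if "a \<in> S" "b \<in> S" "a < s" "s < b" for a b s
    using that assms mem_is_interval_1_I[of S a b s] by (simp add: is_interval_convex_1)
  have "\<exists>v\<in>D. t \<le> v"
  proof (cases "\<forall>s\<in>S. s \<le> t")
    case False
    then obtain s where s: "s \<in> S" "t < s" by (auto simp: not_le)
    then obtain q where "q \<in> \<rat>" "t < q" "q < s" using Rats_dense_in_real by blast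
    then show ?thesis using between[OF t s(1)] by (intro bexI[of _ q]) (auto simp: D_def)
  qed (use t in \<open>auto simp: D_def\<close>)
  moreover have "\<exists>u\<in>D. u \<le> t"
  proof (cases "\<forall>s\<in>S. t \<le> s")
    case False
    then obtain s where s: "s \<in> S" "s < t" by (auto simp: not_le)
    then obtain q where "q \<in> \<rat>" "s < q" "q < t" using Rats_dense_in_real by blast
    then show ?thesis using between[OF s(1) t] by (intro bexI[of _ q]) (auto simp: D_def)
  qed (use t in \<open>auto simp: D_def\<close>)
  ultimately show "\<exists>u\<in>D. \<exists>v\<in>D. u \<le> t \<and> t \<le> v" by blast
qed

text \<open>The base point is the foot of the perpendicular from \<open>c\<close> to the line, and
  \<open>a\<close> turned by a right angle spans its direction.\<close>

lemma plane_line_param: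
  fixes a z c :: "real^2"
  assumes "a \<bullet> (z - c) = 1"
  shows "\<exists>t. z = (c + (1 / (a \<bullet> a)) *\<^sub>R a) + t *\<^sub>R vector [- a$2, a$1]"
proof (intro exI)
  have "a \<noteq> 0" using assms by auto
  then have n: "(a$1)\<^sup>2 + (a$2)\<^sup>2 \<noteq> 0" by (auto simp: vec_eq_iff forall_2)
  have e: "a$1 * (z$1 - c$1) + a$2 * (z$2 - c$2) = 1" using assms by (simp add: inner_vec_def sum_2)
  let ?n = "(a$1)\<^sup>2 + (a$2)\<^sup>2" and ?t = "- a$2 * (z$1 - c$1) + a$1 * (z$2 - c$2)"
  have "?n * (z$1 - c$1) = a$1 - a$2 * ?t" "?n * (z$2 - c$2) = a$2 + a$1 * ?t"
    using e by algebra+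
  then have "z$1 - c$1 = (a$1 - a$2 * ?t) / ?n" "z$2 - c$2 = (a$2 + a$1 * ?t) / ?n"
    using n by (simp_all add: eq_divide_eq mult.commute)
  then show "z = (c + (1 / (a \<bullet> a)) *\<^sub>R a) + (?t / ?n) *\<^sub>R vector [- a$2, a$1]"
    using n by (simp add: vec_eq_iff forall_2 inner_vec_def sum_2 power2_eq_square
        diff_divide_distrib add_divide_distrib algebra_simps)
qed

text \<open>In a parametrisation of the line, its intersection with \<open>W\<close> is an interval,
  hence a countable union of compact pieces, and meeting a compact set is a closed condition. For
  \<open>a = 0\<close> the line is empty.\<close>

lemma measurable_meets_line:
  fixes a c :: "real^2"
  assumes "convex W"
  shows "{K. pts K \<inter> (W \<inter> {z. a \<bullet> (z - c) = 1}) \<noteq> {}} \<in> sets borel"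
proof (cases "a = 0")
  case False
  define f where "f t = (c + (1 / (a \<bullet> a)) *\<^sub>R a) + t *\<^sub>R (vector [- a$2, a$1] :: real^2)" for t
  have f1: "a \<bullet> (f t - c) = 1" for t
  proof -
    have "a \<bullet> vector [- a$2, a$1] = 0" by (simp add: inner_vec_def sum_2)
    then show ?thesis using False by (simp add: f_def inner_add_right)
  qed
  have conv: "f ((1 - u) * s + u * t) = (1 - u) *\<^sub>R f s + u *\<^sub>R f t" for u s t
  proof -
    have "x + ((1 - u) * s + u * t) *\<^sub>R y = (1 - u) *\<^sub>R (x + s *\<^sub>R y) + u *\<^sub>R (x + t *\<^sub>R y)"
      for x y :: "real^2" by (simp add: algebra_simps)
    then show ?thesis unfolding f_def .
  qed
  define S where "S = {t. f t \<in> W}"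
  have "convex S"
    unfolding convex_alt S_def using assms[unfolded convex_alt] by (simp add: conv)
  then obtain D where D: "countable D" "D \<subseteq> S"
    "\<And>t. t \<in> S \<Longrightarrow> \<exists>u\<in>D. \<exists>v\<in>D. u \<le> t \<and> t \<le> v" using ex_dense_less_more by blast
  have seg: "f ` {u..v} \<subseteq> W" if "u \<in> D" "v \<in> D" for u v
  proof -
    have "{u..v} \<subseteq> S" using that D(2) \<open>convex S\<close>
      by (auto intro: mem_is_interval_1_I[of S u v] simp: is_interval_convex_1)
    then show ?thesis by (auto simp: S_def)
  qed
  have eq: "W \<inter> {z. a \<bullet> (z - c) = 1} = (\<Union>(u, v)\<in>D \<times> D. f ` {u..v})"
  proof (intro equalityI subsetI)
    fix z assume z: "z \<in> W \<inter> {z. a \<bullet> (z - c) = 1}"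
    then obtain t where t: "z = f t" using plane_line_param[of a z c] by (auto simp: f_def)
    with z have "t \<in> S" by (simp add: S_def)
    from D(3)[OF this] t show "z \<in> (\<Union>(u, v)\<in>D \<times> D. f ` {u..v})" by fastforce
  qed (use seg f1 in force)
  have "closed (f ` {u..v})" for u v
    unfolding f_def by (intro compact_imp_closed compact_continuous_image continuous_intros) simp
  then have "(\<Union>(u, v)\<in>D \<times> D. {K. pts K \<inter> f ` {u..v} \<noteq> {}}) \<in> sets borel"
    using D(1) by (intro sets.countable_UN'') (auto intro: measurable_meets_closed)
  also have "(\<Union>(u, v)\<in>D \<times> D. {K. pts K \<inter> f ` {u..v} \<noteq> {}}) =
      {K. pts K \<inter> (W \<inter> {z. a \<bullet> (z - c) = 1}) \<noteq> {}}"
    unfolding eq by blast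
  finally show ?thesis .
qed simp

section \<open>Countability of the edges of a planar convex set\<close>

lemma cone_open_2:
  fixes p q :: "real^2"
  assumes "p$1 * q$2 - p$2 * q$1 \<noteq> 0"
  shows "\<exists>U. open U \<and> U \<noteq> {} \<and> (\<forall>x\<in>U. \<exists>s>0. \<exists>t>0. x = s *\<^sub>R p + t *\<^sub>R q)"
proof -
  let ?d = "p$1 * q$2 - p$2 * q$1"
  let ?s = "\<lambda>x::real^2. (x$1 * q$2 - x$2 * q$1) / ?d" and ?t = "\<lambda>x::real^2. (p$1 * x$2 - p$2 * x$1) / ?d"
  let ?U = "{x. 0 < ?s x} \<inter> {x. 0 < ?t x}"
  have "continuous_on UNIV ?s" "continuous_on UNIV ?t"
    using assms by (auto intro!: continuous_on_divide continuous_intros)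
  then have "open ?U"
    using open_Collect_less[OF continuous_on_const, of ?s 0]
      open_Collect_less[OF continuous_on_const, of ?t 0] by (simp add: open_Int)
  moreover have "p + q \<in> ?U" using assms by (simp add: algebra_simps)
  moreover have "x = ?s x *\<^sub>R p + ?t x *\<^sub>R q" for x
  proof -
    have "?d * x$1 = (x$1 * q$2 - x$2 * q$1) * p$1 + (p$1 * x$2 - p$2 * x$1) * q$1"
      "?d * x$2 = (x$1 * q$2 - x$2 * q$1) * p$2 + (p$1 * x$2 - p$2 * x$1) * q$2" by algebra+
    then have "x$1 = ((x$1 * q$2 - x$2 * q$1) * p$1 + (p$1 * x$2 - p$2 * x$1) * q$1) / ?d"
      "x$2 = ((x$1 * q$2 - x$2 * q$1) * p$2 + (p$1 * x$2 - p$2 * x$1) * q$2) / ?d"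
      using nonzero_mult_div_cancel_left[OF assms] by metis+
    then show ?thesis unfolding vec_eq_iff forall_2
      by (simp only: vector_add_component vector_scaleR_component add_divide_distrib
          real_scaleR_def times_divide_eq_left)
  qed
  ultimately show ?thesis by (intro exI[of _ ?U]) blast
qed

text \<open>A line that misses the origin contains no two distinct points that are linearly
  dependent. Here it shows that the cone over a nondegenerate edge has interior points.\<close>

lemma det_zero_eq_functional:
  fixes p q a :: "real^2"
  assumes "a \<bullet> p = 1" "a \<bullet> q = 1" "p$1 * q$2 - p$2 * q$1 = 0"
  shows "p = q"
proof -
  have e: "a$1 * p$1 + a$2 * p$2 = 1" "a$1 * q$1 + a$2 * q$2 = 1"
    using assms by (simp_all add: inner_vec_def sum_2)
  have "p$1 - q$1 = 0" "p$2 - q$2 = 0" using e assms(3) by algebra+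
  then show ?thesis by (simp add: vec_eq_iff forall_2)
qed

lemma functional_eqI_2:
  fixes p q a b :: "real^2"
  assumes "a \<bullet> p = 1" "a \<bullet> q = 1" "b \<bullet> p = 1" "b \<bullet> q = 1" "p$1 * q$2 - p$2 * q$1 \<noteq> 0"
  shows "a = b"
proof -
  have e: "a$1 * p$1 + a$2 * p$2 = 1" "a$1 * q$1 + a$2 * q$2 = 1"
    "b$1 * p$1 + b$2 * p$2 = 1" "b$1 * q$1 + b$2 * q$2 = 1"
    using assms by (simp_all add: inner_vec_def sum_2)
  have "(p$1 * q$2 - p$2 * q$1) * (a$1 - b$1) = 0" "(p$1 * q$2 - p$2 * q$1) * (a$2 - b$2) = 0"
    using e by algebra+
  then show ?thesis using assms(5) by (simp add: vec_eq_iff forall_2)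
qed

text \<open>Only countably many supporting lines touch a planar convex set in more than one point: such a
  line is determined by any direction of the open cone over the contact segment.\<close>

lemma countable_edges:
  fixes C :: "(real^2) set"
  assumes C: "convex C" "c \<in> interior C"
  obtains A :: "(real^2) set" where "countable A"
    "\<And>E p q. convex E \<Longrightarrow> E \<subseteq> C \<Longrightarrow> E \<inter> interior C = {} \<Longrightarrow> p \<in> E \<Longrightarrow> q \<in> E \<Longrightarrow> p \<noteq> q \<Longrightarrow>
       \<exists>a\<in>A. E \<subseteq> {z. a \<bullet> (z - c) = 1}"
proof -
  obtain D :: "(real^2) set" where D: "countable D"
    "\<And>X. open X \<Longrightarrow> X \<noteq> {} \<Longrightarrow> \<exists>d\<in>D. d \<in> X"
    by (rule countable_dense_setE) auto
  \<comment> \<open>\<open>P x a\<close> says that \<open>a\<close> maximises \<open>x\<close> over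
    the polar set of \<open>C - c\<close>. For \<open>x\<close> in the open cone over an edge the
    maximiser is unique and is the normal of that edge, so countably many dense choices of
    \<open>x\<close> reach every edge.\<close>
  define P where "P x a \<longleftrightarrow> (\<forall>z\<in>C. a \<bullet> (z - c) \<le> 1) \<and>
      (\<forall>b. (\<forall>z\<in>C. b \<bullet> (z - c) \<le> 1) \<longrightarrow> b \<bullet> x \<le> a \<bullet> x)" for x a :: "real^2"
  have "countable ((\<lambda>x. THE a. P x a) ` D)" using D(1) by simp
  moreover have "\<exists>a\<in>(\<lambda>x. THE a. P x a) ` D. E \<subseteq> {z. a \<bullet> (z - c) = 1}"
    if E: "convex E" "E \<subseteq> C" "E \<inter> interior C = {}" "p \<in> E" "q \<in> E" "p \<noteq> q" for E p q
  proof -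
    have ne: "E \<noteq> {}" "interior C \<noteq> {}" using E C by auto
    have "interior C \<inter> E = {}" using E(3) by auto
    then obtain a b where ab: "a \<noteq> 0" "\<And>z. z \<in> interior C \<Longrightarrow> a \<bullet> z \<le> b" "\<And>z. z \<in> E \<Longrightarrow> b \<le> a \<bullet> z"
      using separating_hyperplane_sets[OF convex_interior[OF C(1)] E(1) ne(2,1)] by metis
    have "C \<subseteq> closure (interior C)"
      using convex_closure_interior[OF C(1) ne(2)] closure_subset by metis
    also have "\<dots> \<subseteq> {z. a \<bullet> z \<le> b}"
      by (rule closure_minimal) (auto intro: ab closed_halfspace_le)
    finally have Cb: "\<And>z. z \<in> C \<Longrightarrow> a \<bullet> z \<le> b" by blast
    \<comment> \<open>Strictness comes from \<open>c\<close> being an interior point, which can be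
      moved a little in the direction \<open>a\<close>. It permits normalising the supporting line
      to \<open>a' \<bullet> (z - c) = 1\<close>.\<close>
    have cb: "a \<bullet> c < b"
    proof -
      obtain e where e: "e > 0" "cball c e \<subseteq> interior C" using C(2) open_contains_cball open_interior by blast
      have "c + (e / norm a) *\<^sub>R a \<in> cball c e" using e(1) ab(1) by (simp add: dist_norm)
      then have "a \<bullet> (c + (e / norm a) *\<^sub>R a) \<le> b" using e(2) ab(2) by blast
      moreover have "0 < a \<bullet> ((e / norm a) *\<^sub>R a)" using ab(1) e(1) by (simp add: inner_scaleR_right)
      ultimately show ?thesis by (simp add: inner_add_right)
    qed
    define a' where "a' = (1 / (b - a \<bullet> c)) *\<^sub>R a"
    have a'C: "a' \<bullet> (z - c) \<le> 1" if "z \<in> C" for z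
      using Cb[OF that] cb by (simp add: a'_def inner_diff_right flip: diff_divide_distrib)
    have a'E: "a' \<bullet> (z - c) = 1" if "z \<in> E" for z
      using Cb[of z] ab(3)[OF that] that E(2) cb by (force simp: a'_def inner_diff_right simp flip: diff_divide_distrib)
    have det: "(p - c)$1 * (q - c)$2 - (p - c)$2 * (q - c)$1 \<noteq> 0"
      using det_zero_eq_functional[OF a'E[OF E(4)] a'E[OF E(5)]] E(6) by auto
    obtain U where U: "open U" "U \<noteq> {}"
      "\<And>x. x \<in> U \<Longrightarrow> \<exists>s>0. \<exists>t>0. x = s *\<^sub>R (p - c) + t *\<^sub>R (q - c)"
      using cone_open_2[OF det] by blast
    obtain x where x: "x \<in> D" "x \<in> U" using D(2)[OF U(1,2)] by blast
    obtain s t where st: "s > 0" "t > 0" "x = s *\<^sub>R (p - c) + t *\<^sub>R (q - c)" using U(3)[OF x(2)] by blast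
    have val: "b \<bullet> x = s * (b \<bullet> (p - c)) + t * (b \<bullet> (q - c))" for b
      using st(3) by (simp add: inner_add_right)
    have pq: "p \<in> C" "q \<in> C" using E by auto
    have P: "P x a'"
      unfolding P_def
    proof (intro conjI allI impI ballI a'C)
      fix b assume "\<forall>z\<in>C. b \<bullet> (z - c) \<le> 1"
      then have "b \<bullet> (p - c) \<le> 1" "b \<bullet> (q - c) \<le> 1" using pq by auto
      then have "s * (b \<bullet> (p - c)) \<le> s * 1" "t * (b \<bullet> (q - c)) \<le> t * 1" using st by (simp_all only: mult_le_cancel_left_pos)
      then show "b \<bullet> x \<le> a' \<bullet> x" using a'E[OF E(4)] a'E[OF E(5)] by (simp add: val)
    qed
    moreover have "b = a'" if b: "P x b" for b
    proof -
      have le: "b \<bullet> (p - c) \<le> 1" "b \<bullet> (q - c) \<le> 1" using b pq by (auto simp: P_def)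
      have "a' \<bullet> x \<le> b \<bullet> x" using b a'C by (auto simp: P_def)
      \<comment> \<open>Both values of \<open>b\<close> are at most 1 and the weights
        \<open>s\<close>, \<open>t\<close> are positive, so maximality forces both values to be 1;
        two independent points determine a functional.\<close>
      then have sum: "s + t \<le> s * (b \<bullet> (p - c)) + t * (b \<bullet> (q - c))"
        using a'E[OF E(4)] a'E[OF E(5)] by (simp add: val)
      have m: "s * (b \<bullet> (p - c)) \<le> s * 1" "t * (b \<bullet> (q - c)) \<le> t * 1" using st le by (simp_all only: mult_le_cancel_left_pos)
      then have "s * (b \<bullet> (p - c)) = s * 1" "t * (b \<bullet> (q - c)) = t * 1" using sum by linarith+
      then have "b \<bullet> (p - c) = 1" "b \<bullet> (q - c) = 1" using st by auto
      then show ?thesis by (rule functional_eqI_2[OF _ _ a'E[OF E(4)] a'E[OF E(5)] det])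
    qed
    ultimately have "(THE a. P x a) = a'" by blast
    then show ?thesis using x(1) a'E by (intro bexI[of _ a']) auto
  qed
  ultimately show thesis by (rule that)
qed

text \<open>With a unique contact point, meeting the complement of \<open>X\<close> is the negation
  of meeting \<open>X\<close>. Hence the sets \<open>X\<close> for which the conclusion holds are
  closed under complements as well as countable unions, and closed sets start the induction.\<close>

lemma measurable_contact_point:
  fixes C :: "(real^2) set"
  assumes C: "closed C" and T: "T \<in> sets borel" "\<And>K. K \<in> T \<Longrightarrow> \<exists>p. pts K \<inter> C = {p}"
    and W: "W \<in> sets borel"
  shows "{K\<in>T. pts K \<inter> C \<inter> W \<noteq> {}} \<in> sets borel"
proof -
  have sing: "pts K \<inter> C \<inter> - X \<noteq> {} \<longleftrightarrow> \<not> pts K \<inter> C \<inter> X \<noteq> {}" if K: "K \<in> T" for K X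
  proof -
    obtain p where "pts K \<inter> C = {p}" using T(2)[OF K] by blast
    then show ?thesis by simp
  qed
  have "W \<in> sigma_sets UNIV (Collect closed)" using W by (simp add: borel_eq_closed)
  then show ?thesis
  proof induction
    case (Basic X)
    then have "closed (C \<inter> X)" using C by auto
    then have "T \<inter> {K. pts K \<inter> (C \<inter> X) \<noteq> {}} \<in> sets borel"
      using T(1) measurable_meets_closed by blast
    then show ?case by (simp add: Int_def conj_assoc Int_assoc cong: conj_cong)
  next
    case (Compl X)
    have "{K \<in> T. pts K \<inter> C \<inter> (UNIV - X) \<noteq> {}} = T - {K \<in> T. pts K \<inter> C \<inter> X \<noteq> {}}"
      using sing by (auto simp flip: Compl_eq_Diff_UNIV)
    then show ?case using Compl T(1) by auto
  next
    case (Union X)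
    have "{K \<in> T. pts K \<inter> C \<inter> (\<Union>i. X i) \<noteq> {}} = (\<Union>i. {K \<in> T. pts K \<inter> C \<inter> X i \<noteq> {}})" by blast
    then show ?case using Union by auto
  qed simp
qed

lemma convex_pts_segment: "K \<in> segments \<Longrightarrow> convex (pts K)"
  by (auto simp: segments_def segment.rep_eq)

text \<open>A segment that meets \<open>closure W\<close> but not \<open>interior W\<close> either has a single contact point, which
  depends measurably on the segment, or lies along one of countably many edges.\<close>

lemma measurable_segments_meet_convex:
  fixes W :: "(real^2) set"
  assumes W: "convex W" "W \<in> sets borel" "interior W \<noteq> {}"
  shows "{K\<in>segments. pts K \<inter> W \<noteq> {}} \<in> sets borel"
proof -
  let ?C = "closure W" and ?U = "interior W"
  have U: "interior ?C = ?U" using W(1) by (rule convex_interior_closure)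
  obtain c where c: "c \<in> interior ?C" using W(3) U by auto
  obtain A where A: "countable A"
    "\<And>E p q. convex E \<Longrightarrow> E \<subseteq> ?C \<Longrightarrow> E \<inter> interior ?C = {} \<Longrightarrow> p \<in> E \<Longrightarrow> q \<in> E \<Longrightarrow> p \<noteq> q \<Longrightarrow>
       \<exists>a\<in>A. E \<subseteq> {z. a \<bullet> (z - c) = 1}"
    using countable_edges[OF convex_closure[OF W(1)] c] by blast
  define T where "T = {K\<in>segments. pts K \<inter> ?U = {}}"
  have T: "T \<in> sets borel"
  proof -
    have "T = segments - {K. pts K \<inter> ?U \<noteq> {}}" by (auto simp: T_def)
    then show ?thesis using measurable_meets_open[of ?U] by auto
  qed
  define lo hi where "lo i u = ?C \<inter> {x. x $ i \<le> u}" and "hi i u = ?C \<inter> {x. u \<le> x $ i}"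
    for i :: 2 and u :: real
  have closed: "closed (lo i u)" "closed (hi i u)" for i u
    unfolding lo_def hi_def by (auto intro!: closed_Int closed_Collect_le continuous_intros)
  \<comment> \<open>Two distinct contact points differ in a coordinate and are separated there by
    rationals \<open>u < v\<close>, so having two of them is a countable union of conditions to meet
    the closed pieces \<open>lo i u\<close> and \<open>hi i v\<close>.\<close>
  define T1 where "T1 = {K\<in>T. \<exists>p\<in>pts K \<inter> ?C. \<exists>q\<in>pts K \<inter> ?C. p \<noteq> q}"
  have "T1 = (\<Union>(i, u, v)\<in>UNIV \<times> {(u, v) \<in> \<rat> \<times> \<rat>. u < v}.
      T \<inter> {K. pts K \<inter> lo i u \<noteq> {}} \<inter> {K. pts K \<inter> hi i v \<noteq> {}})" (is "_ = ?R")
  proof (intro equalityI subsetI)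
    fix K assume K: "K \<in> T1"
    then obtain p q where pq: "p \<in> pts K \<inter> ?C" "q \<in> pts K \<inter> ?C" "p \<noteq> q" by (auto simp: T1_def)
    then obtain i where "p $ i \<noteq> q $ i" by (auto simp: vec_eq_iff)
    then obtain p q where pq: "p \<in> pts K \<inter> ?C" "q \<in> pts K \<inter> ?C" "p $ i < q $ i"
      using pq by (metis linorder_neqE_linordered_idom)
    then obtain u where u: "u \<in> \<rat>" "p $ i < u" "u < q $ i" using Rats_dense_in_real by blast
    then obtain v where v: "v \<in> \<rat>" "u < v" "v < q $ i" using Rats_dense_in_real by blast
    have "p \<in> pts K \<inter> lo i u" "q \<in> pts K \<inter> hi i v" using pq u v by (auto simp: lo_def hi_def)
    moreover have "K \<in> T" using K by (simp add: T1_def)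
    ultimately show "K \<in> ?R" using u(1) v(1,2) by (intro UN_I[of "(i, u, v)"]) auto
  next
    fix K assume "K \<in> ?R"
    then obtain i u v where "u < v" "K \<in> T" "pts K \<inter> lo i u \<noteq> {}" "pts K \<inter> hi i v \<noteq> {}" by auto
    then obtain p q where "u < v" "K \<in> T" "p \<in> pts K \<inter> ?C" "q \<in> pts K \<inter> ?C" "p $ i \<le> u" "v \<le> q $ i"
      by (auto simp: lo_def hi_def)
    moreover from this have "p \<noteq> q" by auto
    ultimately show "K \<in> T1" by (auto simp: T1_def)
  qed
  moreover have "countable (UNIV \<times> {(u, v) \<in> \<rat> \<times> \<rat>. u < v} :: (2 \<times> real \<times> real) set)"
  proof (rule countable_SIGMA)
    show "countable {(u, v) \<in> \<rat> \<times> \<rat>. u < (v::real)}"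
      by (rule countable_subset[of _ "\<rat> \<times> \<rat>"]) (auto simp: countable_rat)
  qed auto
  ultimately have T1: "T1 \<in> sets borel"
    using T closed by (auto intro!: sets.countable_UN'' sets.Int measurable_meets_closed)
  define T0 where "T0 = (T - T1) \<inter> {K. pts K \<inter> ?C \<noteq> {}}"
  have T0: "T0 \<in> sets borel"
    unfolding T0_def using T T1 measurable_meets_closed[of ?C] by auto
  have "\<exists>p. pts K \<inter> ?C = {p}" if "K \<in> T0" for K
    using that unfolding T0_def T1_def by blast
  then have m0: "{K\<in>T0. pts K \<inter> ?C \<inter> W \<noteq> {}} \<in> sets borel"
    by (intro measurable_contact_point T0 W) auto
  \<comment> \<open>The whole contact set of a segment in \<open>T1\<close> is convex and lies on
    one of these lines, so whether it contains a point of \<open>W\<close> is decided on that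
    line.\<close>
  have m1: "T1 \<inter> (\<Union>a\<in>A. {K. pts K \<inter> (W \<inter> {z. a \<bullet> (z - c) = 1}) \<noteq> {}}) \<in> sets borel"
    using A(1) by (intro sets.Int T1 sets.countable_UN'' measurable_meets_line W)
  have "{K\<in>segments. pts K \<inter> W \<noteq> {}} = (segments \<inter> {K. pts K \<inter> ?U \<noteq> {}}) \<union>
      {K\<in>T0. pts K \<inter> ?C \<inter> W \<noteq> {}} \<union>
      (T1 \<inter> (\<Union>a\<in>A. {K. pts K \<inter> (W \<inter> {z. a \<bullet> (z - c) = 1}) \<noteq> {}}))" (is "_ = ?R")
  proof (intro equalityI subsetI)
    fix K assume K: "K \<in> {K\<in>segments. pts K \<inter> W \<noteq> {}}"
    then obtain w where w: "w \<in> pts K" "w \<in> W" "w \<in> ?C" using closure_subset by blast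
    consider "pts K \<inter> ?U \<noteq> {}" | "K \<in> T" "K \<notin> T1" | "K \<in> T1" using K by (auto simp: T_def)
    then show "K \<in> ?R"
    proof cases
      case 3
      then obtain p q where pq: "p \<in> pts K \<inter> ?C" "q \<in> pts K \<inter> ?C" "p \<noteq> q" by (auto simp: T1_def)
      have "convex (pts K \<inter> ?C)" using K W(1) by (auto intro: convex_Int convex_closure convex_pts_segment)
      moreover have "pts K \<inter> ?C \<inter> interior ?C = {}" using 3 U by (auto simp: T1_def T_def)
      ultimately obtain a where "a \<in> A" "pts K \<inter> ?C \<subseteq> {z. a \<bullet> (z - c) = 1}"
        using A(2)[of "pts K \<inter> ?C" p q] pq by blast
      then show ?thesis using 3 w by blast
    qed (use K w in \<open>auto simp: T0_def\<close>)
  next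
    fix K assume "K \<in> ?R"
    then show "K \<in> {K\<in>segments. pts K \<inter> W \<noteq> {}}"
      using interior_subset[of W] by (auto simp: T0_def T1_def T_def)
  qed
  then show ?thesis using m0 m1 measurable_meets_open[of ?U] by auto
qed

section \<open>Measurability on the configuration space\<close>

lemma space_config_space: "space config_space = {x. locally_finite x}"
  unfolding config_space_def by (rule space_measure_of) auto

lemma nn_integral_count_space_UNIV:
  "(\<integral>\<^sup>+x. f x \<partial>count_space X) = (\<integral>\<^sup>+x. f x * indicator X x \<partial>count_space UNIV)"
  by (simp add: nn_integral_restrict_space[symmetric] restrict_count_space)

text \<open>A set of particles bounded in the Hausdorff metric stays inside one disc; that disc is
  itself a particle, hit by all of them, and local finiteness applies to it.\<close>

lemma locally_finite_bounded:
  assumes x: "locally_finite x" and B: "bounded B"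
  shows "finite (x \<inter> B)"
proof (cases "B = {}")
  case False
  then obtain K0 where "K0 \<in> B" by blast
  obtain r where r: "\<And>L. L \<in> B \<Longrightarrow> dist K0 L \<le> r"
    using B bounded_any_center[of B K0] by metis
  obtain s where s: "pts K0 \<subseteq> cball 0 s"
    using compact_imp_bounded[OF compact_pts, of K0] unfolding bounded_iff by (auto simp: subset_eq)
  have sub: "pts L \<subseteq> cball 0 (s + r)" if "L \<in> B" for L
  proof -
    have "cball (0::real^2) (s + dist K0 L) \<subseteq> cball 0 (s + r)" using r[OF that] by (intro subset_cball) simp
    with pts_subset_cball_dist[OF s, of L] show ?thesis by (rule order_trans)
  qed
  then have ne: "cball (0::real^2) (s + r) \<noteq> {}" using \<open>K0 \<in> B\<close> pts_nonempty by blast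
  have "x \<inter> B \<subseteq> {L \<in> x. hit L (Particle (cball 0 (s + r)))}"
  proof
    fix L assume L: "L \<in> x \<inter> B"
    then have "pts L \<inter> cball 0 (s + r) = pts L" using sub[of L] by blast
    with L show "L \<in> {L \<in> x. hit L (Particle (cball 0 (s + r)))}"
      using pts_nonempty[of L] by (simp add: hit_def pts_Particle[OF compact_cball ne])
  qed
  then show ?thesis using x unfolding locally_finite_def by (meson finite_subset)
qed simp

lemma locally_finite_subset: "locally_finite x \<Longrightarrow> y \<subseteq> x \<Longrightarrow> locally_finite y"
  unfolding locally_finite_def by (auto intro: rev_finite_subset)

lemma locally_finite_Un: "locally_finite x \<Longrightarrow> locally_finite y \<Longrightarrow> locally_finite (x \<union> y)"
  unfolding locally_finite_def by (simp add: conj_disj_distribR Collect_disj_eq)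

lemma locally_finite_finite: "finite x \<Longrightarrow> locally_finite x"
  unfolding locally_finite_def by simp

lemma measurable_card_Int [measurable]:
  assumes "B \<in> sets borel" "bounded B"
  shows "(\<lambda>x. card (x \<inter> B)) \<in> measurable config_space (count_space UNIV)"
proof (subst measurable_count_space_eq2_countable, simp, safe)
  fix k
  have "(\<lambda>x. card (x \<inter> B)) -` {k} \<inter> space config_space = {x. locally_finite x \<and> card (x \<inter> B) = k}"
    by (auto simp: space_config_space)
  also have "\<dots> \<in> sets config_space"
    unfolding config_space_def using assms by (subst sets_measure_of) (auto intro!: sigma_sets.Basic)
  finally show "(\<lambda>x. card (x \<inter> B)) -` {k} \<inter> space config_space \<in> sets config_space" .
qed

lemma nn_integral_count_space_indicator_finite:
  assumes "finite (x \<inter> B)"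
  shows "(\<integral>\<^sup>+K. indicator B K \<partial>count_space x) = of_nat (card (x \<inter> B))"
  by (subst nn_integral_count_space'[of "x \<inter> B"]) (use assms in auto)

text \<open>Counts are written as integrals over \<open>count_space\<close>, which obey linearity
  and monotone convergence without finiteness side conditions; on bounded sets they are genuine
  cardinalities.\<close>

lemma measurable_configI:
  assumes lf: "\<And>p. p \<in> space P \<Longrightarrow> locally_finite (Y p)"
    and B: "\<And>B. B \<in> sets borel \<Longrightarrow> bounded B \<Longrightarrow>
      (\<lambda>p. \<integral>\<^sup>+K. indicator B K \<partial>count_space (Y p)) \<in> borel_measurable P"
  shows "Y \<in> measurable P config_space"
  unfolding config_space_def
proof (rule measurable_measure_of)
  fix A assume "A \<in> {{x. locally_finite x \<and> card (x \<inter> B) = k} | B k. B \<in> sets borel \<and> bounded B}"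
  then obtain B k where A: "A = {x. locally_finite x \<and> card (x \<inter> B) = k}" "B \<in> sets borel" "bounded B"
    by blast
  have "Y -` A \<inter> space P = {p\<in>space P. (\<integral>\<^sup>+K. indicator B K \<partial>count_space (Y p)) = of_nat k}"
    using lf by (auto simp: A nn_integral_count_space_indicator_finite locally_finite_bounded)
  also have "\<dots> \<in> sets P" using B[OF A(2,3)] by measurable
  finally show "Y -` A \<inter> space P \<in> sets P" .
qed (use lf in auto)

lemma nn_integral_count_space_SUP_cball:
  fixes K0 :: "'a::metric_space"
  shows "(\<integral>\<^sup>+K. g K \<partial>count_space x) =
    (SUP n::nat. \<integral>\<^sup>+K. g K * indicator (cball K0 n) K \<partial>count_space x)"
proof -
  have ex: "\<exists>n::nat. K \<in> cball K0 n" for K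
    using real_arch_simple[of "dist K0 K"] by simp
  have "(\<integral>\<^sup>+K. g K \<partial>count_space x)
      = (\<integral>\<^sup>+K. (SUP n::nat. g K * indicator (cball K0 n) K) \<partial>count_space x)"
  proof (rule nn_integral_cong)
    fix K
    obtain n :: nat where "K \<in> cball K0 n" using ex by blast
    then show "g K = (SUP n::nat. g K * indicator (cball K0 n) K)"
      by (intro antisym SUP_upper2[of n] SUP_least) (auto split: split_indicator)
  qed
  also have "\<dots> = (SUP n::nat. \<integral>\<^sup>+K. g K * indicator (cball K0 n) K \<partial>count_space x)"
    by (rule nn_integral_monotone_convergence_SUP)
      (auto simp: incseq_def le_fun_def split: split_indicator)
  finally show ?thesis .
qed

text \<open>In a ball, the sum is the number of points times the mean of \<open>g p\<close> under
  the empirical measure of these points. The empirical measure is a measurable kernel because its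
  values on Borel sets are quotients of counts, and kernels preserve joint measurability; the balls
  then exhaust the space.\<close>

lemma measurable_config_sum:
  assumes g: "(\<lambda>(p, K). g p K) \<in> borel_measurable (P \<Otimes>\<^sub>M borel)"
    and Y [measurable]: "Y \<in> measurable P config_space"
  shows "(\<lambda>p. \<integral>\<^sup>+K. g p K \<partial>count_space (Y p)) \<in> borel_measurable P"
proof -
  obtain K0 :: particle where True by blast
  have fin: "finite (Y p \<inter> cball K0 (real n))" if "p \<in> space P" for p n
    using measurable_space[OF Y that] by (simp add: space_config_space locally_finite_bounded)
  define S where "S n p = Y p \<inter> cball K0 (real n)" for n p
  \<comment> \<open>Without points in the ball this is the zero measure, in agreement with
    \<open>0 / 0 = 0\<close> for extended reals; so \<open>k n\<close> is a kernel of
    subprobabilities only.\<close>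
  define k where "k n p = distr (uniform_count_measure (S n p)) borel (\<lambda>K. K)" for n p
  have id: "(\<lambda>K. K) \<in> measurable (uniform_count_measure (S n p)) borel" for n p
    by (simp add: measurable_def)
  have em: "emeasure (k n p) A = of_nat (card (Y p \<inter> (cball K0 (real n) \<inter> A))) / of_nat (card (Y p \<inter> cball K0 (real n)))"
    if "p \<in> space P" "A \<in> sets borel" for n p A
  proof -
    have "emeasure (k n p) A = emeasure (uniform_count_measure (S n p)) (S n p \<inter> A)"
      unfolding k_def using that(2) id by (subst emeasure_distr) (auto simp: Int_commute space_uniform_count_measure)
    also have "\<dots> = of_nat (card (S n p \<inter> A)) / of_nat (card (S n p))"
    proof (cases "S n p = {}")
      case False
      then have "0 < card (S n p)" using fin[OF that(1), of n] by (simp add: S_def card_gt_0_iff)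
      then show ?thesis using fin[OF that(1), of n]
        by (subst emeasure_uniform_count_measure)
          (auto simp: S_def ennreal_of_nat_eq_real_of_nat divide_ennreal)
    qed (simp add: emeasure_uniform_count_measure)
    finally show ?thesis by (simp add: S_def Int_assoc)
  qed
  have k: "k n \<in> measurable P (subprob_algebra borel)" for n
  proof (rule measurable_subprob_algebra)
    fix p assume p: "p \<in> space P"
    show "subprob_space (k n p)"
    proof
      show "emeasure (k n p) (space (k n p)) \<le> 1"
        using em[OF p, of UNIV n]
        by (simp add: k_def) (metis divide_eq_1_ennreal ennreal_zero_divide of_nat_0 of_nat_eq_0_iff order_refl zero_le_one ennreal_of_nat_neq_top infinity_ennreal_def)
    qed (simp add: k_def)
    show "sets (k n p) = sets borel" by (simp add: k_def)
  next
    fix A :: "particle set" assume A: "A \<in> sets borel"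
    have [measurable]: "(\<lambda>p. card (Y p \<inter> (cball K0 (real n) \<inter> A))) \<in> measurable P (count_space UNIV)"
      "(\<lambda>p. card (Y p \<inter> cball K0 (real n))) \<in> measurable P (count_space UNIV)"
      using A by (auto intro!: measurable_compose[OF Y] measurable_card_Int bounded_Int)
    show "(\<lambda>p. emeasure (k n p) A) \<in> borel_measurable P"
      by (subst measurable_cong[OF em[OF _ A]], assumption) measurable
  qed
  have eq: "(\<integral>\<^sup>+K. g p K * indicator (cball K0 (real n)) K \<partial>count_space (Y p))
      = of_nat (card (Y p \<inter> cball K0 (real n))) * (\<integral>\<^sup>+K. g p K \<partial>k n p)" if p: "p \<in> space P" for n p
  proof -
    have gp: "g p \<in> borel_measurable borel"
      using measurable_compose[OF measurable_Pair1'[OF p] g] by simp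
    have "(\<integral>\<^sup>+K. g p K * indicator (cball K0 (real n)) K \<partial>count_space (Y p)) = (\<Sum>K\<in>S n p. g p K)"
      using fin[OF p, of n] by (subst nn_integral_count_space'[of "S n p"]) (auto simp: S_def)
    moreover have "(\<integral>\<^sup>+K. g p K \<partial>k n p) = ennreal (1 / card (S n p)) * (\<Sum>K\<in>S n p. g p K)"
      unfolding k_def using fin[OF p, of n] id gp
      by (subst nn_integral_distr)
        (auto simp: uniform_count_measure_def nn_integral_point_measure_finite S_def sum_distrib_left)
    moreover have "of_nat (card (S n p)) * ennreal (1 / card (S n p)) = 1" if "S n p \<noteq> {}"
    proof -
      have "0 < card (S n p)" using fin[OF p, of n] that by (simp add: S_def card_gt_0_iff)
      then show ?thesis
        by (simp add: ennreal_of_nat_eq_real_of_nat flip: ennreal_mult)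
    qed
    ultimately show ?thesis
      by (cases "S n p = {}") (auto simp: S_def simp flip: mult.assoc)
  qed
  have [measurable]: "(\<lambda>p. card (Y p \<inter> cball K0 (real n))) \<in> measurable P (count_space UNIV)" for n
    by (auto intro!: measurable_compose[OF Y] measurable_card_Int)
  have [measurable]: "(\<lambda>p. \<integral>\<^sup>+K. g p K \<partial>k n p) \<in> borel_measurable P" for n
    by (rule nn_integral_measurable_subprob_algebra2[OF g k])
  have "(\<lambda>p. SUP n::nat. of_nat (card (Y p \<inter> cball K0 (real n))) * (\<integral>\<^sup>+K. g p K \<partial>k n p)) \<in> borel_measurable P"
    by measurable
  moreover have "(\<integral>\<^sup>+K. g p K \<partial>count_space (Y p)) =
      (SUP n::nat. of_nat (card (Y p \<inter> cball K0 (real n))) * (\<integral>\<^sup>+K. g p K \<partial>k n p))"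
    if "p \<in> space P" for p
    unfolding nn_integral_count_space_SUP_cball[of "Y p" "g p" K0] using eq[OF that] by simp
  ultimately show ?thesis by (subst measurable_cong) auto
qed

text \<open>Membership of \<open>k p\<close> means that the sum of the indicator of the diagonal
  over \<open>Y p\<close> is not zero, and the diagonal is closed.\<close>

lemma measurable_config_member:
  assumes [measurable]: "Y \<in> measurable P config_space" "k \<in> measurable P borel"
  shows "Measurable.pred P (\<lambda>p. k p \<in> Y p)"
proof -
  have [measurable]: "{q::particle \<times> particle. fst q = snd q} \<in> sets (borel \<Otimes>\<^sub>M borel)"
    unfolding borel_prod by (intro borel_closed closed_Collect_eq continuous_intros)
  have [measurable]: "Measurable.pred (P \<Otimes>\<^sub>M borel) (\<lambda>q. k (fst q) = snd q)"
  proof -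
    have "(\<lambda>q. (k (fst q), snd q)) -` {q. fst q = snd q} \<inter> space (P \<Otimes>\<^sub>M borel) \<in> sets (P \<Otimes>\<^sub>M borel)"
      by measurable
    then show ?thesis by (simp add: pred_def Int_def conj_commute vimage_def)
  qed
  have "(\<lambda>(p, K). indicator {K. k p = K} K :: ennreal) \<in> borel_measurable (P \<Otimes>\<^sub>M borel)"
    unfolding indicator_def by (simp add: case_prod_unfold)
  then have [measurable]: "(\<lambda>p. \<integral>\<^sup>+K. indicator {K. k p = K} K \<partial>count_space (Y p)) \<in> borel_measurable P"
    by (rule measurable_config_sum) measurable
  have eq: "(k p \<in> Y p) \<longleftrightarrow> (\<integral>\<^sup>+K. indicator {K. k p = K} K \<partial>count_space (Y p)) \<noteq> 0" for p
  proof -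
    have "{K. k p = K} = {k p}" by auto
    then show ?thesis by (subst nn_integral_count_space_indicator_finite) (auto simp: Int_insert_right)
  qed
  show ?thesis unfolding eq by measurable
qed

lemma measurable_config_Int:
  assumes [measurable]: "Y \<in> measurable P config_space" "S \<in> sets borel"
  shows "(\<lambda>p. Y p \<inter> S) \<in> measurable P config_space"
proof (rule measurable_configI)
  show lf: "locally_finite (Y p \<inter> S)" if "p \<in> space P" for p
    using measurable_space[OF assms(1) that] locally_finite_subset[of "Y p" "Y p \<inter> S"] by (simp add: space_config_space)
  fix B :: "particle set" assume [measurable]: "B \<in> sets borel" and B: "bounded B"
  have "(\<lambda>p. \<integral>\<^sup>+K. indicator (B \<inter> S) K \<partial>count_space (Y p)) \<in> borel_measurable P"
    by (rule measurable_config_sum) auto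
  moreover have "(\<integral>\<^sup>+K. indicator B K \<partial>count_space (Y p \<inter> S)) = (\<integral>\<^sup>+K. indicator (B \<inter> S) K \<partial>count_space (Y p))" for p
    unfolding nn_integral_count_space_UNIV[of "Y p \<inter> S"] nn_integral_count_space_UNIV[of "Y p"]
    by (intro nn_integral_cong) (auto split: split_indicator)
  ultimately show "(\<lambda>p. \<integral>\<^sup>+K. indicator B K \<partial>count_space (Y p \<inter> S)) \<in> borel_measurable P" by simp
qed

text \<open>Points common to both configurations must be counted once, so those of
  \<open>Y' p\<close> that belong to \<open>Y p\<close> are discounted; this is where measurability
  of membership enters.\<close>

lemma measurable_config_Un:
  assumes Y [measurable]: "Y \<in> measurable P config_space" "Y' \<in> measurable P config_space"
  shows "(\<lambda>p. Y p \<union> Y' p) \<in> measurable P config_space"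
proof (rule measurable_configI)
  show lf: "locally_finite (Y p \<union> Y' p)" if "p \<in> space P" for p
    using measurable_space[OF Y(1) that] measurable_space[OF Y(2) that]
    by (simp add: space_config_space locally_finite_Un)
  fix B :: "particle set" assume [measurable]: "B \<in> sets borel" and B: "bounded B"
  have [measurable]: "Measurable.pred (P \<Otimes>\<^sub>M borel) (\<lambda>q. snd q \<in> Y (fst q))"
    by (rule measurable_config_member) measurable
  have "(\<lambda>p. \<integral>\<^sup>+K. indicator B K * of_bool (K \<notin> Y p) \<partial>count_space (Y' p)) \<in> borel_measurable P"
    by (rule measurable_config_sum) (auto simp: case_prod_unfold of_bool_def)
  moreover have "(\<lambda>p. \<integral>\<^sup>+K. indicator B K \<partial>count_space (Y p)) \<in> borel_measurable P"
    by (rule measurable_config_sum) auto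
  moreover have "(\<integral>\<^sup>+K. indicator B K \<partial>count_space (Y p \<union> Y' p)) = (\<integral>\<^sup>+K. indicator B K \<partial>count_space (Y p)) +
      (\<integral>\<^sup>+K. indicator B K * of_bool (K \<notin> Y p) \<partial>count_space (Y' p))" for p
    unfolding nn_integral_count_space_UNIV[of "Y p \<union> Y' p"] nn_integral_count_space_UNIV[of "Y p"]
      nn_integral_count_space_UNIV[of "Y' p"]
    by (subst nn_integral_add[symmetric]) (auto intro!: nn_integral_cong split: split_indicator)
  ultimately show "(\<lambda>p. \<integral>\<^sup>+K. indicator B K \<partial>count_space (Y p \<union> Y' p)) \<in> borel_measurable P" by simp
qed

lemma measurable_config_insert:
  assumes [measurable]: "Y \<in> measurable P config_space" "k \<in> measurable P borel"
  shows "(\<lambda>p. insert (k p) (Y p)) \<in> measurable P config_space"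
proof -
  have "(\<lambda>p. {k p}) \<in> measurable P config_space"
  proof (rule measurable_configI)
    fix B :: "particle set" assume [measurable]: "B \<in> sets borel"
    have "(\<integral>\<^sup>+K. indicator B K \<partial>count_space {k p}) = indicator B (k p)" for p
      by (simp add: nn_integral_count_space_finite)
    then show "(\<lambda>p. \<integral>\<^sup>+K. indicator B K \<partial>count_space {k p}) \<in> borel_measurable P" by simp
  qed (simp add: locally_finite_finite)
  from measurable_config_Un[OF this assms(1)] show ?thesis by simp
qed

lemma measurable_config_remove:
  assumes Y [measurable]: "Y \<in> measurable P config_space" "k \<in> measurable P borel"
  shows "(\<lambda>p. Y p - {k p}) \<in> measurable P config_space"
proof (rule measurable_configI)
  show lf: "locally_finite (Y p - {k p})" if "p \<in> space P" for p
    using measurable_space[OF Y(1) that] locally_finite_subset[of "Y p" "Y p - {k p}"] by (auto simp: space_config_space)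
  fix B :: "particle set" assume [measurable]: "B \<in> sets borel" and B: "bounded B"
  have [measurable]: "Measurable.pred (P \<Otimes>\<^sub>M borel) (\<lambda>q. snd q \<in> {k (fst q)})"
    by (rule measurable_config_member[where Y="\<lambda>q. {k (fst q)}"])
       (use measurable_config_insert[of "\<lambda>_. {}" "P \<Otimes>\<^sub>M borel" "\<lambda>q. k (fst q)"] in
        \<open>auto simp: space_config_space locally_finite_finite intro!: measurable_const\<close>)
  have "(\<lambda>p. \<integral>\<^sup>+K. indicator B K * of_bool (K \<notin> {k p}) \<partial>count_space (Y p)) \<in> borel_measurable P"
    by (rule measurable_config_sum) (auto simp: case_prod_unfold of_bool_def)
  moreover have "(\<integral>\<^sup>+K. indicator B K \<partial>count_space (Y p - {k p})) =
      (\<integral>\<^sup>+K. indicator B K * of_bool (K \<notin> {k p}) \<partial>count_space (Y p))" for p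
    unfolding nn_integral_count_space_UNIV[of "Y p - {k p}"] nn_integral_count_space_UNIV[of "Y p"]
    by (intro nn_integral_cong) (auto split: split_indicator)
  ultimately show "(\<lambda>p. \<integral>\<^sup>+K. indicator B K \<partial>count_space (Y p - {k p})) \<in> borel_measurable P" by simp
qed

section \<open>Cardinalities, hits and energies as measurable functionals\<close>

lemma real_card_eq_nn_integral: "real (card x) = enn2real (\<integral>\<^sup>+K. 1 \<partial>count_space x)"
  by (cases "finite x") (auto simp: ennreal_of_nat_eq_real_of_nat)

text \<open>Every unordered pair has exactly two preimages. If \<open>R\<close> is infinite then so
  is the set of unordered pairs, and both sides are 0 by the convention for
  \<open>card\<close>.\<close>

lemma card_unordered_pairs:
  assumes sym: "\<And>K L. (K, L) \<in> R \<Longrightarrow> (L, K) \<in> R" and irrefl: "\<And>K. (K, K) \<notin> R"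
  shows "real (card R) = 2 * real (card ((\<lambda>(K, L). {K, L}) ` R))"
proof (cases "finite R")
  case True
  let ?f = "\<lambda>(K, L). {K, L}"
  have "card {r\<in>R. ?f r = e} = 2" if "e \<in> ?f ` R" for e
  proof -
    from that obtain K L where KL: "(K, L) \<in> R" "e = {K, L}" by auto
    then have "K \<noteq> L" using irrefl by auto
    moreover have "{r\<in>R. ?f r = e} = {(K, L), (L, K)}"
      using KL sym by (auto simp: doubleton_eq_iff)
    ultimately show ?thesis by simp
  qed
  then have "card R = (\<Sum>e\<in>?f ` R. 2)"
    using sum.image_gen[OF True, of "\<lambda>_. 1::nat" ?f] by simp
  then show ?thesis by simp
next
  case False
  have R: "R \<subseteq> \<Union>((\<lambda>(K, L). {K, L}) ` R) \<times> \<Union>((\<lambda>(K, L). {K, L}) ` R)" by fastforce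
  have "infinite ((\<lambda>(K, L). {K, L}) ` R)"
    using False
  proof (rule contrapos_nn)
    assume "finite ((\<lambda>(K, L). {K, L}) ` R)"
    then have "finite (\<Union>((\<lambda>(K, L). {K, L}) ` R))" by (rule finite_Union) auto
    then show "finite R" using finite_subset[OF R] finite_SigmaI by metis
  qed
  with False show ?thesis by simp
qed

text \<open>The ordered version of the relation behind \<open>energy\<close>: ordered pairs turn the
  energy into an iterated sum over the configuration, to which the measurability of sums applies
  twice.\<close>

definition interacting :: "(real^2) set \<Rightarrow> particle \<Rightarrow> particle \<Rightarrow> bool" where
  "interacting \<Delta> K L \<longleftrightarrow> K \<noteq> L \<and> hit K L \<and> (circumcentre K \<in> \<Delta> \<or> circumcentre L \<in> \<Delta>)"

lemma energy_eq_ordered: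
  "2 * real (energy \<Delta> x) = real (card {(K, L). K \<in> x \<and> L \<in> x \<and> interacting \<Delta> K L})"
proof -
  have "{{K, L} | K L. K \<in> x \<and> L \<in> x \<and> K \<noteq> L \<and> hit K L \<and> (circumcentre K \<in> \<Delta> \<or> circumcentre L \<in> \<Delta>)}
    = (\<lambda>(K, L). {K, L}) ` {(K, L). K \<in> x \<and> L \<in> x \<and> interacting \<Delta> K L}"
    by (auto simp: interacting_def)
  then show ?thesis unfolding energy_def
    by (subst card_unordered_pairs) (auto simp: interacting_def hit_commute)
qed

text \<open>\<open>enn2real\<close> sends an infinite number of pairs to 0, just as
  \<open>card\<close> does, so no finiteness has to be assumed.\<close>

lemma energy_eq_nn_integral:
  "real (energy \<Delta> x) =
     enn2real (\<integral>\<^sup>+K. \<integral>\<^sup>+L. of_bool (interacting \<Delta> K L) \<partial>count_space x \<partial>count_space x) / 2"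
proof -
  let ?R = "{(K, L). K \<in> x \<and> L \<in> x \<and> interacting \<Delta> K L}"
  have "(\<integral>\<^sup>+K. \<integral>\<^sup>+L. of_bool (interacting \<Delta> K L) \<partial>count_space x \<partial>count_space x) =
     (\<integral>\<^sup>+K. \<integral>\<^sup>+L. indicator ?R (K, L) \<partial>count_space UNIV \<partial>count_space UNIV)"
    unfolding nn_integral_count_space_UNIV[of x]
    by (auto intro!: nn_integral_cong simp flip: nn_integral_multc split: split_indicator)
  also have "\<dots> = emeasure (count_space UNIV) ?R"
    by (subst nn_integral_fst_count_space) simp
  finally have "enn2real (\<integral>\<^sup>+K. \<integral>\<^sup>+L. of_bool (interacting \<Delta> K L) \<partial>count_space x \<partial>count_space x) = real (card ?R)"
    by (cases "finite ?R") (auto simp: ennreal_of_nat_eq_real_of_nat)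
  then show ?thesis using energy_eq_ordered[of \<Delta> x] by simp
qed

lemma measurable_interacting [measurable]:
  assumes [measurable]: "\<Delta> \<in> sets borel"
  shows "Measurable.pred (borel \<Otimes>\<^sub>M borel) (\<lambda>p. interacting \<Delta> (fst p) (snd p))"
proof -
  have [measurable]: "Measurable.pred (borel \<Otimes>\<^sub>M borel) (\<lambda>q::particle \<times> particle. fst q = snd q)"
    unfolding borel_prod pred_def by (auto intro!: borel_closed closed_Collect_eq continuous_intros)
  show ?thesis unfolding interacting_def by measurable
qed

lemma measurable_energy:
  assumes [measurable]: "\<Delta> \<in> sets borel" "Y \<in> measurable P config_space"
  shows "(\<lambda>p. real (energy \<Delta> (Y p))) \<in> borel_measurable P"
proof -
  have "(\<lambda>(p, K). \<integral>\<^sup>+L. of_bool (interacting \<Delta> K L) \<partial>count_space (Y p)) \<in> borel_measurable (P \<Otimes>\<^sub>M borel)"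
    unfolding case_prod_unfold
  proof (rule measurable_config_sum)
    have "(\<lambda>q. (snd (fst q), snd q)) \<in> measurable ((P \<Otimes>\<^sub>M borel) \<Otimes>\<^sub>M borel) (borel \<Otimes>\<^sub>M borel)" by measurable
    from measurable_compose[OF this measurable_interacting[OF assms(1)]]
    have [measurable]: "Measurable.pred ((P \<Otimes>\<^sub>M borel) \<Otimes>\<^sub>M borel) (\<lambda>q. interacting \<Delta> (snd (fst q)) (snd q))" by simp
    show "(\<lambda>(q, L). of_bool (interacting \<Delta> (snd q) L)) \<in> borel_measurable ((P \<Otimes>\<^sub>M borel) \<Otimes>\<^sub>M borel)"
      unfolding case_prod_unfold of_bool_def by measurable
  qed measurable
  then have [measurable]: "(\<lambda>p. \<integral>\<^sup>+K. \<integral>\<^sup>+L. of_bool (interacting \<Delta> K L) \<partial>count_space (Y p) \<partial>count_space (Y p)) \<in> borel_measurable P"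
    by (rule measurable_config_sum) fact
  show ?thesis unfolding energy_eq_nn_integral by measurable
qed

lemma measurable_card_config:
  assumes [measurable]: "Y \<in> measurable P config_space"
  shows "(\<lambda>p. card (Y p)) \<in> measurable P (count_space UNIV)"
proof -
  have "(\<lambda>p. \<integral>\<^sup>+K. 1 \<partial>count_space (Y p)) \<in> borel_measurable P"
    by (rule measurable_config_sum) auto
  then have "(\<lambda>p. real (card (Y p))) \<in> borel_measurable P"
    unfolding real_card_eq_nn_integral by measurable
  then have "(\<lambda>p. nat \<lfloor>real (card (Y p))\<rfloor>) \<in> measurable P (count_space UNIV)" by measurable
  then show ?thesis by simp
qed

lemma measurable_hits:
  assumes [measurable]: "Y \<in> measurable P config_space" "k \<in> measurable P borel"
  shows "(\<lambda>p. real (card {L \<in> Y p. hit L (k p)})) \<in> borel_measurable P"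
proof -
  have "(\<lambda>q. (snd q, k (fst q))) \<in> measurable (P \<Otimes>\<^sub>M borel) (borel \<Otimes>\<^sub>M borel)" by measurable
  from measurable_compose[OF this measurable_hit]
  have [measurable]: "Measurable.pred (P \<Otimes>\<^sub>M borel) (\<lambda>q. hit (snd q) (k (fst q)))" by simp
  have "(\<lambda>p. \<integral>\<^sup>+L. of_bool (hit L (k p)) \<partial>count_space (Y p)) \<in> borel_measurable P"
    by (rule measurable_config_sum) (auto simp: case_prod_unfold of_bool_def)
  moreover have "real (card {L \<in> Y p. hit L (k p)}) = enn2real (\<integral>\<^sup>+L. of_bool (hit L (k p)) \<partial>count_space (Y p))" for p
    unfolding real_card_eq_nn_integral nn_integral_count_space_UNIV[of "Y p"]
      nn_integral_count_space_UNIV[of "{L \<in> Y p. hit L (k p)}"]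
    by (intro arg_cong[of _ _ enn2real] nn_integral_cong) (auto split: split_indicator)
  ultimately show ?thesis by simp
qed

section \<open>The Mecke equation\<close>

lemma poisson_law_space:
  assumes "poisson_law \<mu> \<pi>" shows "space \<pi> = {x. locally_finite x}"
  using assms sets_eq_imp_space_eq[of \<pi> config_space] by (auto simp: poisson_law_def space_config_space)

lemma sets_card_Int_eq:
  assumes "B \<in> sets borel" "bounded B"
  shows "{y\<in>space config_space. card (y \<inter> B) = k} \<in> sets config_space"
  using measurable_sets[OF measurable_card_Int[OF assms], of "{k}"] by (simp add: vimage_def Int_def conj_commute)

lemma poisson_law_counts:
  assumes P: "poisson_law \<mu> \<pi>" and fin: "finite \<A>" and disj: "disjoint \<A>"
    and B: "\<And>A. A \<in> \<A> \<Longrightarrow> A \<in> sets borel \<and> bounded A"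
  shows "emeasure \<pi> {y\<in>space config_space. \<forall>A\<in>\<A>. card (y \<inter> A) = m A} =
    (\<Prod>A\<in>\<A>. ennreal (measure \<mu> A ^ m A / fact (m A) * exp (- measure \<mu> A)))"
proof -
  have S: "sets \<pi> = sets config_space" using P by (simp add: poisson_law_def)
  have sp: "space \<pi> = space config_space" using S by (rule sets_eq_imp_space_eq)
  interpret prob_space \<pi> using P by (simp add: poisson_law_def)
  show ?thesis
  proof (cases "\<A> = {}")
    case True
    then show ?thesis using emeasure_space_1 by (simp add: sp)
  next
    case False
    have ind: "indep_vars (\<lambda>_. count_space UNIV) (\<lambda>A y. card (y \<inter> A)) \<A>"
      using P fin disj B unfolding poisson_law_def by blast
    have "prob (\<Inter>A\<in>\<A>. (\<lambda>y. card (y \<inter> A)) -` {m A} \<inter> space \<pi>) =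
        (\<Prod>A\<in>\<A>. prob ((\<lambda>y. card (y \<inter> A)) -` {m A} \<inter> space \<pi>))"
      by (rule indep_varsD_finite[OF ind False fin]) auto
    moreover have "(\<lambda>y. card (y \<inter> A)) -` {m A} \<inter> space \<pi> = {y\<in>space \<pi>. card (y \<inter> A) = m A}" for A
      by auto
    moreover have "prob {y\<in>space \<pi>. card (y \<inter> A) = m A} = measure \<mu> A ^ m A / fact (m A) * exp (- measure \<mu> A)"
      if "A \<in> \<A>" for A using P B[OF that] unfolding poisson_law_def by blast
    moreover have "{y\<in>space config_space. \<forall>A\<in>\<A>. card (y \<inter> A) = m A} =
        (\<Inter>A\<in>\<A>. (\<lambda>y. card (y \<inter> A)) -` {m A} \<inter> space \<pi>)"
      using False by (auto simp: sp)
    ultimately show ?thesis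
      by (simp add: emeasure_eq_measure prod_ennreal)
  qed
qed

text \<open>Removing a point of \<open>A0\<close> lowers the count of \<open>A0\<close> by one and
  leaves the other counts alone, the sets being disjoint. On \<open>E'\<close> each of the
  \<open>Suc (m A0)\<close> points of \<open>A0\<close> contributes 1, elsewhere none does.\<close>

lemma sum_remove_point_indicator:
  assumes y: "locally_finite y" and disj: "disjoint \<A>" and A0: "A0 \<in> \<A>" "bounded A0"
    and E: "E = {y. locally_finite y \<and> (\<forall>A\<in>\<A>. card (y \<inter> A) = m A)}"
    and E': "E' = {y. locally_finite y \<and> (\<forall>A\<in>\<A>. card (y \<inter> A) = (m(A0 := Suc (m A0))) A)}"
  shows "(\<integral>\<^sup>+K. indicator A0 K * indicator E (y - {K}) \<partial>count_space y)
    = of_nat (Suc (m A0)) * indicator E' y"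
proof -
  have fin: "finite (y \<inter> A0)" using y A0 by (simp add: locally_finite_bounded)
  have lf: "locally_finite (y - {K})" for K using y by (rule locally_finite_subset) auto
  have iff: "y - {K} \<in> E \<longleftrightarrow> y \<in> E'" if "K \<in> y \<inter> A0" for K
  proof -
    have "(y - {K}) \<inter> A = y \<inter> A" if "A \<in> \<A>" "A \<noteq> A0" for A
    proof -
      have "A \<inter> A0 = {}" using disj that A0(1) by (simp add: disjoint_def)
      then show ?thesis using \<open>K \<in> y \<inter> A0\<close> by auto
    qed
    moreover have "(y - {K}) \<inter> A0 = (y \<inter> A0) - {K}" by auto
    then have "card (y \<inter> A0) = Suc (card ((y - {K}) \<inter> A0))"
      using card.remove[OF fin that] by simp
    ultimately have "card ((y - {K}) \<inter> A) = m A \<longleftrightarrow> card (y \<inter> A) = (m(A0 := Suc (m A0))) A"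
      if "A \<in> \<A>" for A
      using that by (cases "A = A0") simp_all
    then show ?thesis using y lf unfolding E E' by simp
  qed
  have "(\<integral>\<^sup>+K. indicator A0 K * indicator E (y - {K}) \<partial>count_space y)
      = (\<Sum>K\<in>y \<inter> A0. indicator E (y - {K}))"
    using fin by (subst nn_integral_count_space'[of "y \<inter> A0"]) auto
  also have "\<dots> = (\<Sum>K\<in>y \<inter> A0. indicator E' y)"
    using iff by (intro sum.cong) (auto split: split_indicator)
  also have "\<dots> = of_nat (Suc (m A0)) * indicator E' y"
    using A0(1) by (auto simp: E' split: split_indicator)
  finally show ?thesis .
qed

text \<open>For a single count this is the Poisson recursion: \<open>k + 1\<close> times the
  probability of \<open>k + 1\<close> points equals the mean times the probability of
  \<open>k\<close> points. Independence carries the remaining factors along.\<close>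

lemma mecke_atom:
  assumes P: "poisson_law \<mu> \<pi>" and fin: "finite \<A>" and disj: "disjoint \<A>"
    and B: "\<And>A. A \<in> \<A> \<Longrightarrow> A \<in> sets borel \<and> bounded A" and A0: "A0 \<in> \<A>"
    and E: "E = {y. locally_finite y \<and> (\<forall>A\<in>\<A>. card (y \<inter> A) = m A)}"
  shows "(\<integral>\<^sup>+y. \<integral>\<^sup>+K. indicator A0 K * indicator E (y - {K}) \<partial>count_space y \<partial>\<pi>) =
    emeasure \<mu> A0 * emeasure \<pi> E"
proof -
  have S: "sets \<pi> = sets config_space" using P by (simp add: poisson_law_def)
  define m' where "m' = m(A0 := Suc (m A0))"
  define E' where "E' = {y. locally_finite y \<and> (\<forall>A\<in>\<A>. card (y \<inter> A) = m' A)}"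
  define p where "p A k = measure \<mu> A ^ k / fact k * exp (- measure \<mu> A)" for A k
  have fmu: "emeasure \<mu> A0 = ennreal (measure \<mu> A0)"
    using P A0 B[OF A0] unfolding poisson_law_def by (auto simp: emeasure_eq_ennreal_measure)
  have E'_sets: "E' \<in> sets \<pi>"
  proof -
    have "{y\<in>space config_space. \<forall>A\<in>\<A>. card (y \<inter> A) = m' A} \<in> sets config_space"
      using fin B by (intro sets.sets_Collect_finite_All) (auto intro!: sets_card_Int_eq)
    then show ?thesis by (simp add: E'_def S space_config_space)
  qed
  have "(\<integral>\<^sup>+y. \<integral>\<^sup>+K. indicator A0 K * indicator E (y - {K}) \<partial>count_space y \<partial>\<pi>)
      = (\<integral>\<^sup>+y. of_nat (Suc (m A0)) * indicator E' y \<partial>\<pi>)"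
    by (intro nn_integral_cong sum_remove_point_indicator[OF _ disj A0 _ E])
      (use B[OF A0] in \<open>auto simp: poisson_law_space[OF P] E'_def m'_def\<close>)
  also have "\<dots> = of_nat (Suc (m A0)) * emeasure \<pi> E'"
    using E'_sets by (rule nn_integral_cmult_indicator)
  also have "emeasure \<pi> E' = (\<Prod>A\<in>\<A>. ennreal (p A (m' A)))"
    unfolding E'_def p_def using poisson_law_counts[OF P fin disj B, of m'] by (simp add: space_config_space)
  also have "\<dots> = ennreal (p A0 (Suc (m A0))) * (\<Prod>A\<in>\<A> - {A0}. ennreal (p A (m A)))"
    by (subst prod.remove[OF fin A0]) (simp add: m'_def cong: prod.cong_simp)
  also have "of_nat (Suc (m A0)) * (ennreal (p A0 (Suc (m A0))) * (\<Prod>A\<in>\<A> - {A0}. ennreal (p A (m A))))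
      = ennreal (measure \<mu> A0) * (ennreal (p A0 (m A0)) * (\<Prod>A\<in>\<A> - {A0}. ennreal (p A (m A))))"
  proof -
    have "real (Suc (m A0)) * p A0 (Suc (m A0)) = measure \<mu> A0 * p A0 (m A0)"
      by (simp add: p_def field_simps del: of_nat_Suc)
    then have "of_nat (Suc (m A0)) * ennreal (p A0 (Suc (m A0))) = ennreal (measure \<mu> A0) * ennreal (p A0 (m A0))"
      unfolding ennreal_of_nat_eq_real_of_nat by (simp add: p_def flip: ennreal_mult del: of_nat_Suc)
    then show ?thesis by (simp only: mult.assoc[symmetric])
  qed
  also have "ennreal (p A0 (m A0)) * (\<Prod>A\<in>\<A> - {A0}. ennreal (p A (m A))) = (\<Prod>A\<in>\<A>. ennreal (p A (m A)))"
    by (rule prod.remove[OF fin A0, symmetric])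
  also have "\<dots> = emeasure \<pi> E"
    unfolding E p_def using poisson_law_counts[OF P fin disj B, of m] by (simp add: space_config_space)
  finally show ?thesis by (simp add: fmu)
qed

text \<open>Atoms are indexed by the subfamily of sets that contain a point. The empty subfamily is
  left out: its atom is the complement of the union, which need not be bounded.\<close>

lemma finite_family_atoms:
  assumes fin: "finite \<C>" and B: "\<And>C. C \<in> \<C> \<Longrightarrow> C \<in> sets borel \<and> bounded (C :: particle set)"
  obtains \<A> where "finite \<A>" "disjoint \<A>" "\<And>A. A \<in> \<A> \<Longrightarrow> A \<in> sets borel \<and> bounded A"
    "\<And>C. C \<in> \<C> \<Longrightarrow> C = \<Union>{A\<in>\<A>. A \<subseteq> C}"
proof
  define atm where "atm S = {K. \<forall>C\<in>\<C>. K \<in> C \<longleftrightarrow> C \<in> S}" for S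
  let ?A = "atm ` (Pow \<C> - {{}})"
  show "finite ?A" using fin by simp
  show "disjoint ?A"
    unfolding disjoint_def
  proof (intro ballI impI, rule equals0I)
    fix A A' K assume A: "A \<in> ?A" "A' \<in> ?A" "A \<noteq> A'" "K \<in> A \<inter> A'"
    then obtain S S' where S: "S \<subseteq> \<C>" "S' \<subseteq> \<C>" "A = atm S" "A' = atm S'" by auto
    with A(4) have "S = S'" by (auto simp: atm_def)
    with S A(3) show False by simp
  qed
  show "A \<in> sets borel \<and> bounded A" if "A \<in> ?A" for A
  proof -
    from that obtain S where S: "S \<subseteq> \<C>" "S \<noteq> {}" "A = atm S" by auto
    then obtain C where C: "C \<in> S" "C \<in> \<C>" by auto
    have "{K\<in>space borel. K \<in> C \<longleftrightarrow> C \<in> S} \<in> sets borel" if "C \<in> \<C>" for C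
    proof (cases "C \<in> S")
      case False
      then have "{K\<in>space borel. K \<in> C \<longleftrightarrow> C \<in> S} = - C" by auto
      then show ?thesis using B[OF that] borel_comp[of C] by simp
    qed (use B[OF that] in simp)
    then have "{K\<in>space borel. \<forall>C\<in>\<C>. K \<in> C \<longleftrightarrow> C \<in> S} \<in> sets borel"
      by (intro sets.sets_Collect_finite_All fin)
    then have "A \<in> sets borel" by (simp add: S(3) atm_def)
    moreover have "A \<subseteq> C" using C S by (auto simp: atm_def)
    ultimately show ?thesis using B[OF C(2)] bounded_subset by blast
  qed
  show "C = \<Union>{A\<in>?A. A \<subseteq> C}" if C: "C \<in> \<C>" for C
  proof (intro equalityI subsetI)
    fix K assume K: "K \<in> C"
    let ?S = "{C'\<in>\<C>. K \<in> C'}"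
    have "atm ?S \<in> ?A" using C K by (intro imageI) auto
    moreover have "K \<in> atm ?S" "atm ?S \<subseteq> C" using C K by (auto simp: atm_def)
    ultimately show "K \<in> \<Union>{A\<in>?A. A \<subseteq> C}" by (intro UnionI[of "atm ?S"] CollectI conjI)
  next
    fix K assume "K \<in> \<Union>{A\<in>?A. A \<subseteq> C}"
    then show "K \<in> C" by (elim UnionE CollectE conjE) (rule subsetD)
  qed
qed

section \<open>From disjoint counts to the Mecke equation for all functions\<close>

definition count_event :: "(particle set \<times> nat) set \<Rightarrow> particle set set" where
  "count_event \<P> = {y. locally_finite y \<and> (\<forall>(C, k)\<in>\<P>. card (y \<inter> C) = k)}"

text \<open>Finitely many counts are prescribed at once, for sets that may overlap, so that this
  generator is closed under intersection and contains the whole space as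
  \<open>count_event {}\<close>.\<close>

definition count_events :: "particle set set set" where
  "count_events = {count_event \<P> | \<P>. finite \<P> \<and> (\<forall>(C, k)\<in>\<P>. C \<in> sets borel \<and> bounded C)}"

lemma count_event_sets:
  assumes "finite \<P>" "\<And>C k. (C, k) \<in> \<P> \<Longrightarrow> C \<in> sets borel \<and> bounded C"
  shows "count_event \<P> \<in> sets config_space"
proof -
  have "{y\<in>space config_space. \<forall>p\<in>\<P>. card (y \<inter> fst p) = snd p} \<in> sets config_space"
    using assms by (intro sets.sets_Collect_finite_All) (auto intro!: sets_card_Int_eq)
  moreover have "count_event \<P> = {y\<in>space config_space. \<forall>p\<in>\<P>. card (y \<inter> fst p) = snd p}"
    by (auto simp: count_event_def space_config_space)
  ultimately show ?thesis by simp
qed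

lemma sets_config_space_count_events:
  "sets config_space = sigma_sets {x. locally_finite x} count_events"
proof (rule antisym)
  have "{{x. locally_finite x \<and> card (x \<inter> B) = k} | B k. B \<in> sets borel \<and> bounded B} \<subseteq> count_events"
  proof
    fix A assume "A \<in> {{x. locally_finite x \<and> card (x \<inter> B) = k} | B k. B \<in> sets borel \<and> bounded B}"
    then obtain B k where "A = {x. locally_finite x \<and> card (x \<inter> B) = k}" "B \<in> sets borel" "bounded B" by blast
    then show "A \<in> count_events"
      unfolding count_events_def count_event_def by (intro CollectI exI[of _ "{(B, k)}"]) auto
  qed
  then show "sets config_space \<subseteq> sigma_sets {x. locally_finite x} count_events"
    unfolding config_space_def by (subst sets_measure_of) (auto intro!: sigma_sets_mono' simp del: mem_Collect_eq)
  have "count_events \<subseteq> sets config_space"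
    unfolding count_events_def using count_event_sets by fastforce
  then show "sigma_sets {x. locally_finite x} count_events \<subseteq> sets config_space"
    using sets.sigma_sets_subset[of count_events config_space] by (simp add: space_config_space)
qed

text \<open>The sets are refined to disjoint atoms. The event then splits into countably many
  disjoint events that prescribe the count of every atom, and \<open>B\<close> splits into atoms;
  each resulting term is an instance of the identity for atoms.\<close>

lemma mecke_count_event:
  assumes P: "poisson_law \<mu> \<pi>" and \<mu>: "sets \<mu> = sets borel" and fin: "finite \<P>"
    and C: "\<And>C k. (C, k) \<in> \<P> \<Longrightarrow> C \<in> sets borel \<and> bounded C" and B: "B \<in> sets borel" "bounded B"
  shows "(\<integral>\<^sup>+y. \<integral>\<^sup>+K. indicator B K * indicator (count_event \<P>) (y - {K}) \<partial>count_space y \<partial>\<pi>) =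
    emeasure \<mu> B * emeasure \<pi> (count_event \<P>)"
proof -
  have S[measurable_cong]: "sets \<pi> = sets config_space" using P by (simp add: poisson_law_def)
  have "finite (insert B (fst ` \<P>))" using fin by simp
  moreover have "D \<in> sets borel \<and> bounded D" if "D \<in> insert B (fst ` \<P>)" for D
    using that C B by auto
  ultimately obtain \<A> where A: "finite \<A>" "disjoint \<A>" "\<And>A. A \<in> \<A> \<Longrightarrow> A \<in> sets borel \<and> bounded A"
    "\<And>C. C \<in> insert B (fst ` \<P>) \<Longrightarrow> C = \<Union>{A\<in>\<A>. A \<subseteq> C}"
    by (rule finite_family_atoms) (assumption, rule that)
  define E where "E m = {y. locally_finite y \<and> (\<forall>A\<in>\<A>. card (y \<inter> A) = m A)}" for m
  \<comment> \<open>All distributions of counts over the atoms that produce the prescribed totals.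
    Fixing the values outside \<open>\<A>\<close> keeps \<open>I\<close> countable and makes the
    distribution belonging to a configuration unique.\<close>
  define I where "I = {m \<in> \<A> \<rightarrow>\<^sub>E (UNIV::nat set). \<forall>(C, k)\<in>\<P>. (\<Sum>A\<in>{A\<in>\<A>. A \<subseteq> C}. m A) = k}"
  have cI: "countable I"
    unfolding I_def using countable_PiE[OF A(1), of "\<lambda>_. UNIV::nat set"]
    by (rule countable_subset[rotated]) auto
  have E_sets [measurable]: "E m \<in> sets config_space" for m
  proof -
    have "{y\<in>space config_space. \<forall>A\<in>\<A>. card (y \<inter> A) = m A} \<in> sets config_space"
      using A(1,3) by (intro sets.sets_Collect_finite_All) (auto intro!: sets_card_Int_eq)
    then show ?thesis by (simp add: E_def space_config_space)
  qed
  have card_Un: "card (y \<inter> D) = (\<Sum>A\<in>{A\<in>\<A>. A \<subseteq> D}. card (y \<inter> A))"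
    if "locally_finite y" "D \<in> insert B (fst ` \<P>)" for y D
  proof -
    have "y \<inter> D = (\<Union>A\<in>{A\<in>\<A>. A \<subseteq> D}. y \<inter> A)" using A(4)[OF that(2)] by blast
    also have "card \<dots> = (\<Sum>A\<in>{A\<in>\<A>. A \<subseteq> D}. card (y \<inter> A))"
    proof (intro card_UN_disjoint ballI impI)
      fix A' A'' assume "A' \<in> {A\<in>\<A>. A \<subseteq> D}" "A'' \<in> {A\<in>\<A>. A \<subseteq> D}" "A' \<noteq> A''"
      then have "A' \<inter> A'' = {}" using A(2) by (simp add: disjoint_def)
      then show "(y \<inter> A') \<inter> (y \<inter> A'') = {}" by blast
    qed (use A(1,3) that(1) in \<open>auto simp: locally_finite_bounded\<close>)
    finally show ?thesis .
  qed
  have ind: "indicator (count_event \<P>) y = (\<integral>\<^sup>+m. indicator (E m) y \<partial>count_space I)" for y :: "particle set"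
  proof (cases "y \<in> count_event \<P>")
    case True
    then have y: "locally_finite y" by (simp add: count_event_def)
    define m0 where "m0 = (\<lambda>A\<in>\<A>. card (y \<inter> A))"
    have "(\<Sum>A\<in>{A\<in>\<A>. A \<subseteq> C}. m0 A) = k" if "(C, k) \<in> \<P>" for C k
    proof -
      have "(\<Sum>A\<in>{A\<in>\<A>. A \<subseteq> C}. m0 A) = (\<Sum>A\<in>{A\<in>\<A>. A \<subseteq> C}. card (y \<inter> A))"
        by (intro sum.cong) (auto simp: m0_def)
      also have "\<dots> = card (y \<inter> C)"
        using card_Un[OF y, of C] that by force
      also have "\<dots> = k" using True that by (auto simp: count_event_def)
      finally show ?thesis .
    qed
    then have m0: "m0 \<in> I" unfolding I_def by (auto simp: m0_def)
    have uniq: "m = m0" if "m \<in> I" "y \<in> E m" for m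
    proof (rule PiE_ext)
      show "m \<in> \<A> \<rightarrow>\<^sub>E UNIV" "m0 \<in> \<A> \<rightarrow>\<^sub>E UNIV" using that m0 by (auto simp: I_def)
      show "m A = m0 A" if "A \<in> \<A>" for A
        using that \<open>y \<in> E m\<close> by (simp add: E_def m0_def)
    qed
    have "(\<integral>\<^sup>+m. indicator (E m) y \<partial>count_space I) = (\<Sum>m\<in>{m0}. indicator (E m) y)"
    proof (rule nn_integral_count_space')
      fix m assume "m \<in> I" "m \<notin> {m0}"
      then have "y \<notin> E m" using uniq by blast
      then show "indicator (E m) y = (0::ennreal)" by simp
    qed (use m0 in auto)
    moreover have "y \<in> E m0" using y by (simp add: E_def m0_def)
    ultimately show ?thesis using True by simp
  next
    case False
    have "y \<notin> E m" if "m \<in> I" for m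
    proof
      assume y: "y \<in> E m"
      then have lf: "locally_finite y" by (simp add: E_def)
      have "card (y \<inter> C) = k" if "(C, k) \<in> \<P>" for C k
      proof -
        have "card (y \<inter> C) = (\<Sum>A\<in>{A\<in>\<A>. A \<subseteq> C}. card (y \<inter> A))"
          using card_Un[OF lf, of C] that by force
        also have "\<dots> = (\<Sum>A\<in>{A\<in>\<A>. A \<subseteq> C}. m A)"
          using y by (intro sum.cong) (auto simp: E_def)
        also have "\<dots> = k" using \<open>m \<in> I\<close> that by (auto simp: I_def)
        finally show ?thesis .
      qed
      with lf False show False by (auto simp: count_event_def)
    qed
    then have "(\<integral>\<^sup>+m. indicator (E m) y \<partial>count_space I) = (\<integral>\<^sup>+m. 0 \<partial>count_space I)"
      by (intro nn_integral_cong) auto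
    with False show ?thesis by simp
  qed
  let ?AB = "{A\<in>\<A>. A \<subseteq> B}"
  have finAB: "finite ?AB" using A(1) by simp
  have indB: "indicator B K = (\<Sum>A\<in>?AB. indicator A K :: ennreal)" for K
  proof -
    have "indicator (\<Union>A\<in>?AB. A) K = (\<Sum>A\<in>?AB. indicator A K :: ennreal)"
      using A(2) by (intro indicator_UN_disjoint finAB)
        (auto simp: disjoint_family_on_def disjoint_def)
    moreover have "(\<Union>A\<in>?AB. A) = B" using A(4)[of B] by auto
    ultimately show ?thesis by simp
  qed
  have [measurable]: "(\<lambda>y. \<integral>\<^sup>+K. indicator A K * indicator (E m) (y - {K}) \<partial>count_space y) \<in> borel_measurable config_space"
    if "A \<in> \<A>" for A m
  proof (rule measurable_config_sum)
    have [measurable]: "(\<lambda>p. fst p - {snd p}) \<in> measurable (config_space \<Otimes>\<^sub>M borel) config_space"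
      by (rule measurable_config_remove) measurable
    have [measurable]: "A \<in> sets borel" using A(3) that by blast
    show "(\<lambda>(y, K). indicator A K * indicator (E m) (y - {K}) :: ennreal) \<in> borel_measurable (config_space \<Otimes>\<^sub>M borel)"
      unfolding case_prod_unfold by measurable
  qed measurable
  have inner: "(\<integral>\<^sup>+K. indicator B K * indicator (count_event \<P>) (y - {K}) \<partial>count_space y) =
     (\<Sum>A\<in>?AB. \<integral>\<^sup>+m. \<integral>\<^sup>+K. indicator A K * indicator (E m) (y - {K}) \<partial>count_space y \<partial>count_space I)" for y
  proof -
    have "(\<integral>\<^sup>+K. indicator B K * indicator (count_event \<P>) (y - {K}) \<partial>count_space y) =
       (\<Sum>A\<in>?AB. \<integral>\<^sup>+K. \<integral>\<^sup>+m. indicator A K * indicator (E m) (y - {K}) \<partial>count_space I \<partial>count_space y)"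
      unfolding indB ind by (subst nn_integral_sum[symmetric]) (auto simp: sum_distrib_right nn_integral_cmult)
    then show ?thesis
      by (subst (asm) nn_integral_count_space_nn_integral[OF cI]) auto
  qed
  have "(\<integral>\<^sup>+y. \<integral>\<^sup>+K. indicator B K * indicator (count_event \<P>) (y - {K}) \<partial>count_space y \<partial>\<pi>) =
     (\<integral>\<^sup>+y. \<integral>\<^sup>+m. (\<Sum>A\<in>?AB. \<integral>\<^sup>+K. indicator A K * indicator (E m) (y - {K}) \<partial>count_space y) \<partial>count_space I \<partial>\<pi>)"
    unfolding inner by (intro nn_integral_cong nn_integral_sum[symmetric]) simp
  also have "\<dots> = (\<integral>\<^sup>+m. \<integral>\<^sup>+y. (\<Sum>A\<in>?AB. \<integral>\<^sup>+K. indicator A K * indicator (E m) (y - {K}) \<partial>count_space y) \<partial>\<pi> \<partial>count_space I)"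
    by (rule nn_integral_count_space_nn_integral[OF cI]) (auto simp: measurable_cong_sets[OF S refl])
  also have "\<dots> = (\<integral>\<^sup>+m. (\<Sum>A\<in>?AB. \<integral>\<^sup>+y. \<integral>\<^sup>+K. indicator A K * indicator (E m) (y - {K}) \<partial>count_space y \<partial>\<pi>) \<partial>count_space I)"
    by (intro nn_integral_cong nn_integral_sum) (auto simp: measurable_cong_sets[OF S refl])
  also have "\<dots> = (\<integral>\<^sup>+m. (\<Sum>A\<in>?AB. emeasure \<mu> A * emeasure \<pi> (E m)) \<partial>count_space I)"
    by (intro sum.cong nn_integral_cong mecke_atom[OF P A(1,2,3)] refl) (auto simp: E_def)
  also have "\<dots> = (\<Sum>A\<in>?AB. emeasure \<mu> A) * (\<integral>\<^sup>+m. emeasure \<pi> (E m) \<partial>count_space I)"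
    by (simp add: nn_integral_cmult flip: sum_distrib_right)
  also have "(\<Sum>A\<in>?AB. emeasure \<mu> A) = emeasure \<mu> (\<Union>A\<in>?AB. A)"
    using A(2,3) \<mu> by (intro sum_emeasure finAB) (auto simp: disjoint_family_on_def disjoint_def)
  also have "(\<Union>A\<in>?AB. A) = B" using A(4)[of B] by auto
  also have "(\<integral>\<^sup>+m. emeasure \<pi> (E m) \<partial>count_space I) = (\<integral>\<^sup>+m. \<integral>\<^sup>+y. indicator (E m) y \<partial>\<pi> \<partial>count_space I)"
    by (intro nn_integral_cong) (simp add: S)
  also have "\<dots> = (\<integral>\<^sup>+y. indicator (count_event \<P>) y \<partial>\<pi>)"
    unfolding ind by (subst nn_integral_count_space_nn_integral[OF cI]) auto
  also have "\<dots> = emeasure \<pi> (count_event \<P>)"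
    using count_event_sets[OF fin C] by (simp add: S)
  finally show ?thesis .
qed

text \<open>The reduced Campbell measure, which pairs a point of the configuration with the
  remaining points. The Mecke equation states that for a Poisson law it is the product of intensity
  and law.\<close>

definition campbell :: "particle set measure \<Rightarrow> (particle \<times> particle set) measure" where
  "campbell \<pi> = measure_of (space (borel \<Otimes>\<^sub>M config_space)) (sets (borel \<Otimes>\<^sub>M config_space))
     (\<lambda>A. \<integral>\<^sup>+y. \<integral>\<^sup>+K. indicator A (K, y - {K}) \<partial>count_space y \<partial>\<pi>)"

lemma sets_campbell [simp, measurable_cong]: "sets (campbell \<pi>) = sets (borel \<Otimes>\<^sub>M config_space)"
  and space_campbell [simp]: "space (campbell \<pi>) = space (borel \<Otimes>\<^sub>M config_space)"
  unfolding campbell_def by (auto simp: sets.sets_measure_of_eq sets.space_measure_of_eq)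

lemma measurable_campbell_sum:
  assumes [measurable]: "f \<in> borel_measurable (borel \<Otimes>\<^sub>M config_space)"
  shows "(\<lambda>y. \<integral>\<^sup>+K. f (K, y - {K}) \<partial>count_space y) \<in> borel_measurable config_space"
proof (rule measurable_config_sum)
  have [measurable]: "(\<lambda>p. fst p - {snd p}) \<in> measurable (config_space \<Otimes>\<^sub>M borel) config_space"
    by (rule measurable_config_remove) measurable
  show "(\<lambda>(y, K). f (K, y - {K})) \<in> borel_measurable (config_space \<Otimes>\<^sub>M borel)"
    unfolding case_prod_unfold by measurable
qed measurable

lemma emeasure_campbell:
  assumes S: "sets \<pi> = sets config_space" and A: "A \<in> sets (borel \<Otimes>\<^sub>M config_space)"
  shows "emeasure (campbell \<pi>) A = (\<integral>\<^sup>+y. \<integral>\<^sup>+K. indicator A (K, y - {K}) \<partial>count_space y \<partial>\<pi>)"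
  using campbell_def
proof (rule emeasure_measure_of)
  show "countably_additive (sets (campbell \<pi>)) (\<lambda>A. \<integral>\<^sup>+y. \<integral>\<^sup>+K. indicator A (K, y - {K}) \<partial>count_space y \<partial>\<pi>)"
  proof (rule countably_additiveI)
    fix A :: "nat \<Rightarrow> (particle \<times> particle set) set"
    assume A: "range A \<subseteq> sets (campbell \<pi>)" "disjoint_family A"
    have [measurable]: "(\<lambda>y. \<integral>\<^sup>+K. indicator (A i) (K, y - {K}) \<partial>count_space y) \<in> borel_measurable \<pi>" for i
      unfolding measurable_cong_sets[OF S refl]
      by (rule measurable_campbell_sum) (use A(1) in \<open>auto intro!: borel_measurable_indicator\<close>)
    show "(\<Sum>i. \<integral>\<^sup>+y. \<integral>\<^sup>+K. indicator (A i) (K, y - {K}) \<partial>count_space y \<partial>\<pi>) =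
        (\<integral>\<^sup>+y. \<integral>\<^sup>+K. indicator (\<Union>i. A i) (K, y - {K}) \<partial>count_space y \<partial>\<pi>)"
      by (subst nn_integral_suminf[symmetric], simp, subst nn_integral_suminf[symmetric])
        (auto simp: suminf_indicator[OF A(2)])
  qed
qed (use A in \<open>auto simp: positive_def dest: sets.sets_into_space\<close>)

lemma nn_integral_campbell:
  assumes S: "sets \<pi> = sets config_space" and f: "f \<in> borel_measurable (borel \<Otimes>\<^sub>M config_space)"
  shows "integral\<^sup>N (campbell \<pi>) f = (\<integral>\<^sup>+y. \<integral>\<^sup>+K. f (K, y - {K}) \<partial>count_space y \<partial>\<pi>)"
proof -
  have M: "(\<lambda>y. \<integral>\<^sup>+K. f (K, y - {K}) \<partial>count_space y) \<in> borel_measurable \<pi>"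
    if "f \<in> borel_measurable (borel \<Otimes>\<^sub>M config_space)" for f
    using measurable_campbell_sum[OF that] measurable_cong_sets[OF S refl] by blast
  show ?thesis using f
  proof induction
    case (cong f g)
    have "(\<integral>\<^sup>+K. f (K, y - {K}) \<partial>count_space y) = (\<integral>\<^sup>+K. g (K, y - {K}) \<partial>count_space y)" if "y \<in> space \<pi>" for y
      using that sets_eq_imp_space_eq[OF S] cong(3) locally_finite_subset[of y]
      by (intro nn_integral_cong) (auto simp: space_pair_measure space_config_space)
    moreover have "integral\<^sup>N (campbell \<pi>) f = integral\<^sup>N (campbell \<pi>) g"
      using cong(3) by (intro nn_integral_cong) auto
    ultimately show ?case using cong(4) by (simp cong: nn_integral_cong)
  next
    case (set A)
    then show ?case by (simp add: emeasure_campbell[OF S])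
  next
    case (mult u v)
    then show ?case
      by (simp add: nn_integral_cmult measurable_cong_sets[OF sets_campbell refl] M)
  next
    case (add u v)
    then show ?case
      by (simp add: nn_integral_add measurable_cong_sets[OF sets_campbell refl] M)
  next
    case (seq U)
    have "integral\<^sup>N (campbell \<pi>) (SUP i. U i) = (SUP i. integral\<^sup>N (campbell \<pi>) (U i))"
      unfolding SUP_apply[abs_def] using seq
      by (intro nn_integral_monotone_convergence_SUP) (auto simp: measurable_cong_sets[OF sets_campbell refl])
    also have "\<dots> = (SUP i. \<integral>\<^sup>+y. \<integral>\<^sup>+K. U i (K, y - {K}) \<partial>count_space y \<partial>\<pi>)" using seq by simp
    also have "\<dots> = (\<integral>\<^sup>+y. (SUP i. \<integral>\<^sup>+K. U i (K, y - {K}) \<partial>count_space y) \<partial>\<pi>)"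
      using seq by (intro nn_integral_monotone_convergence_SUP[symmetric] M)
        (auto simp: incseq_def le_fun_def intro!: nn_integral_mono)
    also have "\<dots> = (\<integral>\<^sup>+y. \<integral>\<^sup>+K. (SUP i. U i) (K, y - {K}) \<partial>count_space y \<partial>\<pi>)"
      unfolding SUP_apply using seq
      by (intro nn_integral_cong nn_integral_monotone_convergence_SUP[symmetric])
        (auto simp: incseq_def le_fun_def)
    finally show ?case .
  qed
qed

lemma poisson_law_sigma_finite:
  assumes P: "poisson_law \<mu> \<pi>" and \<mu>: "sets \<mu> = sets borel"
  shows "sigma_finite_measure \<mu>"
proof
  obtain K0 :: particle where True by blast
  have sp: "space \<mu> = UNIV" using sets_eq_imp_space_eq[OF \<mu>] by simp
  have "(\<Union>n. cball K0 (real n)) = UNIV"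
    using real_arch_simple by (auto simp: dist_commute)
  moreover have "emeasure \<mu> (cball K0 (real n)) \<noteq> \<infinity>" for n
    using P unfolding poisson_law_def by (auto simp: less_top)
  ultimately show "\<exists>A. countable A \<and> A \<subseteq> sets \<mu> \<and> \<Union>A = space \<mu> \<and> (\<forall>a\<in>A. emeasure \<mu> a \<noteq> \<infinity>)"
    by (intro exI[of _ "range (\<lambda>n. cball K0 (real n))"]) (auto simp: \<mu> sp)
qed

text \<open>For fixed \<open>B\<close> both sides are finite measures in \<open>D\<close>, here
  \<open>N1\<close> and \<open>N2\<close>, and they agree on the intersection-stable generator
  \<open>count_events\<close>.\<close>

lemma campbell_bounded:
  assumes P: "poisson_law \<mu> \<pi>" and \<mu>: "sets \<mu> = sets borel"
    and B: "B \<in> sets borel" "bounded B" and D: "D \<in> sets config_space"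
  shows "emeasure (campbell \<pi>) (B \<times> D) = emeasure \<mu> B * emeasure \<pi> D"
proof -
  have S: "sets \<pi> = sets config_space" using P by (simp add: poisson_law_def)
  note [measurable_cong] = S
  interpret prob_space \<pi> using P by (simp add: poisson_law_def)
  have [measurable]: "B \<in> sets borel" by fact
  define N1 where "N1 = distr (density (campbell \<pi>) (\<lambda>p. indicator B (fst p))) config_space snd"
  define N2 where "N2 = density \<pi> (\<lambda>_. emeasure \<mu> B)"
  have e1: "emeasure N1 D = emeasure (campbell \<pi>) (B \<times> D)" if D: "D \<in> sets config_space" for D
  proof -
    have "emeasure N1 D = emeasure (density (campbell \<pi>) (\<lambda>p. indicator B (fst p))) (snd -` D \<inter> space (borel \<Otimes>\<^sub>M config_space))"
      unfolding N1_def using D by (subst emeasure_distr) auto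
    also have "\<dots> = (\<integral>\<^sup>+p. indicator B (fst p) * indicator (snd -` D \<inter> space (borel \<Otimes>\<^sub>M config_space)) p \<partial>campbell \<pi>)"
      using D by (subst emeasure_density) auto
    also have "\<dots> = (\<integral>\<^sup>+p. indicator (B \<times> D) p \<partial>campbell \<pi>)"
      using sets.sets_into_space[OF D] by (intro nn_integral_cong) (auto simp: space_pair_measure split: split_indicator)
    finally show ?thesis using D by simp
  qed
  have e2: "emeasure N2 D = emeasure \<mu> B * emeasure \<pi> D" if D: "D \<in> sets config_space" for D
    unfolding N2_def using D S by (subst emeasure_density) (auto simp: nn_integral_cmult_indicator)
  have eq: "emeasure N1 X = emeasure N2 X" if X: "X \<in> count_events" for X
  proof -
    obtain \<P> where XP: "X = count_event \<P>" "finite \<P>" "\<And>C k. (C, k) \<in> \<P> \<Longrightarrow> C \<in> sets borel \<and> bounded C"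
      using X unfolding count_events_def by auto
    have Xs: "X \<in> sets config_space" unfolding XP(1) by (rule count_event_sets[OF XP(2,3)])
    have "emeasure N1 X = (\<integral>\<^sup>+y. \<integral>\<^sup>+K. indicator (B \<times> X) (K, y - {K}) \<partial>count_space y \<partial>\<pi>)"
      using Xs by (simp add: e1 emeasure_campbell[OF S])
    also have "\<dots> = (\<integral>\<^sup>+y. \<integral>\<^sup>+K. indicator B K * indicator X (y - {K}) \<partial>count_space y \<partial>\<pi>)"
      by (simp add: indicator_times)
    also have "\<dots> = emeasure \<mu> B * emeasure \<pi> X"
      unfolding XP(1) by (rule mecke_count_event[OF P \<mu> XP(2,3) B])
    finally show ?thesis using Xs by (simp add: e2)
  qed
  have "N1 = N2"
  proof (rule measure_eqI_generator_eq[where \<Omega>="{x. locally_finite x}" and A="\<lambda>_. count_event {}"])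
    show "Int_stable count_events"
    proof (rule Int_stableI)
      fix X Y assume "X \<in> count_events" "Y \<in> count_events"
      then obtain \<P> \<Q> where PQ: "X = count_event \<P>" "finite \<P>" "\<forall>(C, k)\<in>\<P>. C \<in> sets borel \<and> bounded C"
        "Y = count_event \<Q>" "finite \<Q>" "\<forall>(C, k)\<in>\<Q>. C \<in> sets borel \<and> bounded C"
        unfolding count_events_def by auto
      then have "X \<inter> Y = count_event (\<P> \<union> \<Q>)" by (auto simp: count_event_def ball_Un)
      then show "X \<inter> Y \<in> count_events"
        using PQ unfolding count_events_def by (intro CollectI exI[of _ "\<P> \<union> \<Q>"]) auto
    qed
    show "sets N1 = sigma_sets {x. locally_finite x} count_events"
      "sets N2 = sigma_sets {x. locally_finite x} count_events"
      by (simp_all add: N1_def N2_def S sets_config_space_count_events)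
    have ce: "count_event {} \<in> count_events" by (auto simp: count_events_def)
    then show "range (\<lambda>_::nat. count_event {}) \<subseteq> count_events" by auto
    have "count_event {} \<in> sets config_space" by (rule count_event_sets) auto
    moreover have "emeasure \<mu> B \<noteq> \<infinity>" using P B unfolding poisson_law_def by (auto simp: less_top)
    ultimately show "emeasure N1 (count_event {}) \<noteq> \<infinity>"
      unfolding eq[OF ce] by (simp add: e2 ennreal_mult_eq_top_iff)
    show "(\<Union>i::nat. count_event {}) = {x. locally_finite x}" by (simp add: count_event_def)
    show "count_events \<subseteq> Pow {x. locally_finite x}" by (auto simp: count_events_def count_event_def)
  qed (rule eq)
  then show ?thesis using e1[OF D] e2[OF D] by simp
qed

text \<open>Rectangles with an unbounded first side are monotone limits of bounded ones, and
  rectangles determine the product because both factors are sigma-finite.\<close>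

lemma campbell_poisson:
  assumes P: "poisson_law \<mu> \<pi>" and \<mu>: "sets \<mu> = sets borel"
  shows "campbell \<pi> = \<mu> \<Otimes>\<^sub>M \<pi>"
proof -
  have S: "sets \<pi> = sets config_space" using P by (simp add: poisson_law_def)
  interpret prob_space \<pi> using P by (simp add: poisson_law_def)
  show ?thesis
  proof (rule pair_measure_eqI[symmetric])
    show "sigma_finite_measure \<mu>" by (rule poisson_law_sigma_finite[OF P \<mu>])
    show "sigma_finite_measure \<pi>" ..
    show "sets (\<mu> \<Otimes>\<^sub>M \<pi>) = sets (campbell \<pi>)"
      by (simp add: sets_pair_measure_cong[OF \<mu> S])
    fix A D assume "A \<in> sets \<mu>" "D \<in> sets \<pi>"
    then have A: "A \<in> sets borel" and D: "D \<in> sets config_space" using \<mu> S by auto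
    obtain K0 :: particle where True by blast
    define An where "An n = A \<inter> cball K0 (real n)" for n
    have An: "An n \<in> sets borel" "bounded (An n)" for n using A by (auto simp: An_def bounded_Int)
    have Un: "(\<Union>n. An n) = A" using real_arch_simple by (auto simp: An_def)
    have inc: "incseq An" by (auto simp: An_def incseq_def)
    have "(\<lambda>n. emeasure (campbell \<pi>) (An n \<times> D)) \<longlonglongrightarrow> emeasure (campbell \<pi>) (\<Union>n. An n \<times> D)"
      using inc An D by (intro Lim_emeasure_incseq) (auto simp: incseq_def)
    moreover have "(\<Union>n. An n \<times> D) = A \<times> D" using Un by auto
    moreover have "(\<lambda>n. emeasure \<mu> (An n) * emeasure \<pi> D) \<longlonglongrightarrow> emeasure \<mu> A * emeasure \<pi> D"
      using Lim_emeasure_incseq[of An \<mu>] inc An \<mu> Un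
      by (subst (1 2) mult.commute) (auto intro!: ennreal_tendsto_cmult simp: less_top[symmetric])
    ultimately show "emeasure \<mu> A * emeasure \<pi> D = emeasure (campbell \<pi>) (A \<times> D)"
      using LIMSEQ_unique by (simp add: campbell_bounded[OF P \<mu> An D])
  qed
qed

lemma mecke:
  assumes P: "poisson_law \<mu> \<pi>" and \<mu>: "sets \<mu> = sets borel"
    and f: "f \<in> borel_measurable (borel \<Otimes>\<^sub>M config_space)"
  shows "(\<integral>\<^sup>+y. \<integral>\<^sup>+K. f (K, y - {K}) \<partial>count_space y \<partial>\<pi>) = (\<integral>\<^sup>+y. \<integral>\<^sup>+K. f (K, y) \<partial>\<mu> \<partial>\<pi>)"
proof -
  have S: "sets \<pi> = sets config_space" using P by (simp add: poisson_law_def)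
  interpret \<pi>: prob_space \<pi> using P by (simp add: poisson_law_def)
  interpret \<mu>: sigma_finite_measure \<mu> by (rule poisson_law_sigma_finite[OF P \<mu>])
  interpret pair_sigma_finite \<mu> \<pi> ..
  have f': "f \<in> borel_measurable (\<mu> \<Otimes>\<^sub>M \<pi>)"
    using f measurable_cong_sets[OF sets_pair_measure_cong[OF \<mu> S] refl] by blast
  have "(\<integral>\<^sup>+y. \<integral>\<^sup>+K. f (K, y - {K}) \<partial>count_space y \<partial>\<pi>) = integral\<^sup>N (\<mu> \<Otimes>\<^sub>M \<pi>) f"
    using nn_integral_campbell[OF S f] by (simp add: campbell_poisson[OF P \<mu>])
  also have "\<dots> = (\<integral>\<^sup>+y. \<integral>\<^sup>+K. f (K, y) \<partial>\<mu> \<partial>\<pi>)"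
    by (rule nn_integral_snd[OF f', symmetric])
  finally show ?thesis .
qed

section \<open>The reference measure\<close>

text \<open>The set that carries the reference measure. Two of its members that hit each other have
  centres at most \<open>2 * R\<close> apart, which gives the interaction a finite range.\<close>

definition short_segments :: "real \<Rightarrow> particle set" where
  "short_segments R = {K\<in>segments. seg_length K \<le> 2 * R}"

lemma seg_length_dist_le: "seg_length K \<le> seg_length L + 2 * dist K L"
  unfolding seg_length_def
proof (rule diameter_le)
  fix x y assume xy: "x \<in> pts K" "y \<in> pts K"
  obtain x' where x': "x' \<in> pts L" "dist x x' \<le> dist K L" using dist_particleE1[OF xy(1)] .
  obtain y' where y': "y' \<in> pts L" "dist y y' \<le> dist K L" using dist_particleE1[OF xy(2)] .
  have "dist x' y' \<le> diameter (pts L)"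
    using x' y' by (intro diameter_bounded_bound compact_imp_bounded compact_pts)
  moreover have "dist x y \<le> dist x x' + dist x' y' + dist y y'"
    using dist_triangle[of x y x'] dist_triangle[of x' y y'] by (simp add: dist_commute)
  ultimately show "norm (x - y) \<le> diameter (pts L) + 2 * dist K L" using x' y' by (simp add: dist_norm)
qed (use pts_nonempty in auto)

lemma measurable_seg_length [measurable]: "seg_length \<in> borel_measurable borel"
proof (rule borel_measurable_continuous_onI, rule lipschitz_on_continuous_on)
  show "2-lipschitz_on UNIV seg_length"
  proof (rule lipschitz_onI)
    fix K L :: particle
    show "dist (seg_length K) (seg_length L) \<le> 2 * dist K L"
      using seg_length_dist_le[of K L] seg_length_dist_le[of L K]
      by (simp add: dist_real_def dist_commute abs_le_iff)
  qed simp
qed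

lemma short_segments_borel [measurable]: "short_segments R \<in> sets borel"
proof -
  have "short_segments R = {K\<in>space borel. seg_length K \<le> 2 * R} \<inter> segments"
    by (auto simp: short_segments_def)
  also have "\<dots> \<in> sets borel" by measurable
  finally show ?thesis .
qed

lemma segment_pts_subset_cball:
  assumes "K \<in> short_segments R" shows "pts K \<subseteq> cball (circumcentre K) R"
proof -
  obtain a b where K: "K = segment a b" using assms by (auto simp: short_segments_def segments_def)
  then have "dist a b \<le> 2 * R" using assms by (simp add: short_segments_def seg_length_segment)
  then show ?thesis
    unfolding K segment.rep_eq circumcentre_segment
    by (intro closed_segment_subset) (auto simp: dist_midpoint)
qed

lemma hit_short_dist_le:
  assumes "K \<in> short_segments R" "L \<in> short_segments R" "hit K L"
  shows "dist (circumcentre K) (circumcentre L) \<le> 2 * R"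
proof -
  obtain x where "x \<in> pts K" "x \<in> pts L" using assms(3) by (auto simp: hit_def)
  then have "dist (circumcentre K) x \<le> R" "dist (circumcentre L) x \<le> R"
    using segment_pts_subset_cball assms by force+
  then show ?thesis using dist_triangle2[of "circumcentre K" "circumcentre L" x] by simp
qed

lemma translate_segment: "translate v (segment a b) = segment (v + a) (v + b)"
  by (simp add: pts_inject[symmetric] translate.rep_eq segment.rep_eq closed_segment_translation)

lemma circumcentre_translate: "K \<in> segments \<Longrightarrow> circumcentre (translate v K) = v + circumcentre K"
  by (auto simp: segments_def translate_segment circumcentre_segment midpoint_def vec_eq_iff field_simps)

lemma seg_length_translate: "K \<in> segments \<Longrightarrow> seg_length (translate v K) = seg_length K"
  by (auto simp: segments_def translate_segment seg_length_segment)

lemma segments_translate: "K \<in> segments \<Longrightarrow> translate v K \<in> segments"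
proof -
  assume "K \<in> segments"
  then obtain a b where "a \<noteq> b" "K = segment a b" by (auto simp: segments_def)
  then show ?thesis
    unfolding segments_def translate_segment by (intro CollectI exI[of _ "v + a"] exI[of _ "v + b"]) (simp add: translate_segment)
qed

lemma short_segments_translate: "K \<in> short_segments R \<Longrightarrow> translate v K \<in> short_segments R"
  by (auto simp: short_segments_def segments_translate seg_length_translate)

lemma emeasure_lborel_scale:
  fixes W :: "'a::euclidean_space set"
  assumes "W \<in> sets borel" "c > 0"
  shows "(\<lambda>x. c *\<^sub>R x) ` W \<in> sets borel"
    and "emeasure lborel ((\<lambda>x. c *\<^sub>R x) ` W) = ennreal (c ^ DIM('a)) * emeasure lborel W"
proof -
  have eq: "(\<lambda>x. c *\<^sub>R x) ` W = (\<lambda>x. (1 / c) *\<^sub>R x) -` W \<inter> space borel"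
    using assms(2) by (force simp: image_iff)
  show meas: "(\<lambda>x. c *\<^sub>R x) ` W \<in> sets borel"
    unfolding eq by (rule measurable_sets[OF _ assms(1)]) simp
  have vim: "(\<lambda>x. 0 + c *\<^sub>R x) -` (\<lambda>x. c *\<^sub>R x) ` W = W"
    using assms(2) by auto
  have "emeasure lborel ((\<lambda>x. c *\<^sub>R x) ` W)
      = emeasure (density (distr lborel borel (\<lambda>x. 0 + c *\<^sub>R x)) (\<lambda>_. \<bar>c\<bar> ^ DIM('a))) ((\<lambda>x. c *\<^sub>R x) ` W)"
    using lborel_affine[of c "0::'a"] assms(2) by simp
  also have "\<dots> = ennreal (c ^ DIM('a)) * emeasure lborel W"
    using meas assms(2) vim
    by (simp add: emeasure_density nn_integral_cmult_indicator emeasure_distr)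
  finally show "emeasure lborel ((\<lambda>x. c *\<^sub>R x) ` W) = ennreal (c ^ DIM('a)) * emeasure lborel W" .
qed

text \<open>Since \<open>W\<close> contains the disc of radius \<open>r\<close>, the displacement
  \<open>v - w\<close> is \<open>R / r\<close> times some \<open>u\<close> in \<open>W\<close>;
  dividing \<open>w + (R / r) *\<^sub>R u\<close> by \<open>1 + R / r\<close> gives a convex
  combination. The result bounds the area of the \<open>R\<close>-neighbourhood of
  \<open>W\<close>.\<close>

lemma convex_neighbourhood_subset:
  fixes W :: "'a::real_normed_vector set"
  assumes "convex W" "cball 0 r \<subseteq> W" "r > 0" "R \<ge> 0" "w \<in> W" "dist v w \<le> R"
  shows "v \<in> (\<lambda>x. (1 + R / r) *\<^sub>R x) ` W"
proof -
  let ?c = "1 + R / r"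
  have c: "?c > 0" using assms by (simp add: add_pos_nonneg)
  have "norm (v - w) \<le> R" using assms(6) by (simp add: dist_norm)
  obtain u where u: "u \<in> W" "v - w = (R / r) *\<^sub>R u"
  proof (cases "R = 0")
    case True
    then show ?thesis using assms that[of w] by (simp add: dist_norm)
  next
    case False
    then have "R > 0" using assms(4) by simp
    have "norm ((r / R) *\<^sub>R (v - w)) = (r / R) * norm (v - w)" using assms(3) \<open>R > 0\<close> by simp
    also have "\<dots> \<le> (r / R) * R" using \<open>norm (v - w) \<le> R\<close> assms(3) \<open>R > 0\<close> by (intro mult_left_mono) auto
    finally have "(r / R) *\<^sub>R (v - w) \<in> W" using assms(2) \<open>R > 0\<close> by auto
    then show ?thesis using that[of "(r / R) *\<^sub>R (v - w)"] assms(3) \<open>R > 0\<close> by simp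
  qed
  have one: "1 / (1 + s) + s / (1 + s) = 1" if "1 + s > 0" for s :: real
    using that by (simp add: add_divide_distrib[symmetric])
  have "(1 / ?c) *\<^sub>R w + (R / r / ?c) *\<^sub>R u \<in> W"
    using assms c u(1) one[OF c] by (intro convexD) auto
  moreover have "?c *\<^sub>R ((1 / ?c) *\<^sub>R w + (R / r / ?c) *\<^sub>R u) = w + (R / r) *\<^sub>R u"
    using c by (simp add: scaleR_add_right)
  moreover have "w + (R / r) *\<^sub>R u = v" using u(2) by (metis add.commute diff_add_cancel)
  ultimately show ?thesis by (metis image_eqI)
qed

locale short_segment_law = prob_space Q for Q :: "particle measure" +
  fixes R :: real
  assumes R_pos: "R > 0" and sets_Q: "sets Q = sets borel"
    and AE_Q: "AE K in Q. K \<in> short_segments R \<and> circumcentre K = 0"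
begin

abbreviation "ref \<equiv> reference_measure Q"

lemma sets_ref [simp, measurable_cong]: "sets ref = sets borel" and space_ref [simp]: "space ref = UNIV"
  by (simp_all add: reference_measure_def)

lemma measurable_translate_Q: "(\<lambda>(K, v). translate v K) \<in> borel_measurable (Q \<Otimes>\<^sub>M lborel)"
  using measurable_translate by (simp add: measurable_cong_sets[OF sets_pair_measure_cong[OF sets_Q sets_lborel] refl])

lemma nn_integral_ref:
  assumes f: "f \<in> borel_measurable borel"
  shows "(\<integral>\<^sup>+K. f K \<partial>ref) = (\<integral>\<^sup>+K. \<integral>\<^sup>+v. f (translate v K) \<partial>lborel \<partial>Q)"
proof -
  interpret pair_sigma_finite Q lborel ..
  note measurable_translate_Q[measurable] f[measurable]
  have "(\<integral>\<^sup>+K. f K \<partial>ref) = (\<integral>\<^sup>+p. f (case p of (K, v) \<Rightarrow> translate v K) \<partial>(Q \<Otimes>\<^sub>M lborel))"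
    unfolding reference_measure_def by (rule nn_integral_distr) measurable
  also have "\<dots> = (\<integral>\<^sup>+K. \<integral>\<^sup>+v. f (translate v K) \<partial>lborel \<partial>Q)"
    by (subst lborel.nn_integral_fst[symmetric]) (auto intro!: measurable_compose[OF measurable_translate_Q])
  finally show ?thesis .
qed

lemma nn_integral_ref_cong_Q:
  assumes "f \<in> borel_measurable borel"
    "\<And>K. K \<in> short_segments R \<Longrightarrow> circumcentre K = 0 \<Longrightarrow> (\<integral>\<^sup>+v. f (translate v K) \<partial>lborel) = g K"
  shows "(\<integral>\<^sup>+K. f K \<partial>ref) = (\<integral>\<^sup>+K. g K \<partial>Q)"
  unfolding nn_integral_ref[OF assms(1)]
  by (rule nn_integral_cong_AE) (use AE_Q assms(2) in \<open>auto elim: AE_mp\<close>)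

lemma AE_ref_short: "AE K in ref. K \<in> short_segments R"
proof -
  have "(\<integral>\<^sup>+K. indicator (- short_segments R) K \<partial>ref) = (\<integral>\<^sup>+K. 0 \<partial>Q)"
    by (rule nn_integral_ref_cong_Q) (auto simp: short_segments_translate)
  then have "emeasure ref (- short_segments R) = 0" by simp
  then show ?thesis by (intro AE_I[of _ _ "- short_segments R"]) auto
qed

text \<open>Reference particles are centred at the origin, so the translate by \<open>v\<close> has
  centre \<open>v\<close> and the inner integral is the area of \<open>\<Delta>\<close> whatever the
  particle.\<close>

lemma emeasure_ref_centred_in:
  assumes [measurable]: "\<Delta> \<in> sets borel"
  shows "emeasure ref (centred_in \<Delta>) = emeasure lborel \<Delta>"
proof -
  have "(\<integral>\<^sup>+K. indicator (centred_in \<Delta>) K \<partial>ref) = (\<integral>\<^sup>+K. emeasure lborel \<Delta> \<partial>Q)"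
  proof (rule nn_integral_ref_cong_Q)
    fix K assume K: "K \<in> short_segments R" "circumcentre K = 0"
    then have "indicator (centred_in \<Delta>) (translate v K) = (indicator \<Delta> v :: ennreal)" for v
      by (auto simp: centred_in_def circumcentre_translate short_segments_def split: split_indicator)
    then show "(\<integral>\<^sup>+v. indicator (centred_in \<Delta>) (translate v K) \<partial>lborel) = emeasure lborel \<Delta>" by simp
  qed measurable
  then show ?thesis by (simp add: emeasure_space_1)
qed

text \<open>The area available to the centre of a short segment that hits a given short segment; it
  bounds the reference measure of all such segments uniformly.\<close>

definition hit_bound :: real where
  "hit_bound = measure lborel (cball (0::real^2) (2 * R))"

lemma emeasure_lborel_cball_translate:
  "emeasure lborel (cball (c::real^2) r) = emeasure lborel (cball (0::real^2) r)"
proof -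
  have "emeasure lborel (cball (0::real^2) r) = emeasure (distr lborel borel ((+) (- c))) (cball (0::real^2) r)"
    by (simp add: lborel_distr_plus)
  also have "\<dots> = emeasure lborel ((+) (- c) -` cball 0 r \<inter> space lborel)"
    by (rule emeasure_distr) auto
  also have "(+) (- c) -` cball 0 r \<inter> space lborel = cball c r"
    by (auto simp: dist_norm norm_minus_commute)
  finally show ?thesis by simp
qed

lemma measurable_hit_Collect [measurable]: "{L. hit L K} \<in> sets borel"
  unfolding hit_def by (rule measurable_meets_closed) (simp add: compact_imp_closed compact_pts)

lemma emeasure_ref_hit_le:
  assumes K: "K \<in> short_segments R"
  shows "emeasure ref {L. hit L K} \<le> ennreal hit_bound"
proof -
  have "emeasure ref {L. hit L K} \<le> emeasure ref (centred_in (cball (circumcentre K) (2 * R)))"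
  proof (rule emeasure_mono_AE)
    show "AE L in ref. L \<in> {L. hit L K} \<longrightarrow> L \<in> centred_in (cball (circumcentre K) (2 * R))"
      using AE_ref_short
      by eventually_elim
        (use hit_short_dist_le[OF _ K] in \<open>auto simp: centred_in_def dist_commute\<close>)
  qed auto
  also have "\<dots> = emeasure lborel (cball (0::real^2) (2 * R))"
    by (simp add: emeasure_ref_centred_in emeasure_lborel_cball_translate[of "circumcentre K"])
  also have "\<dots> = ennreal hit_bound"
    unfolding hit_bound_def using emeasure_lborel_cball_finite[of "0::real^2" "2 * R"]
    by (intro emeasure_eq_ennreal_measure) auto
  finally show ?thesis .
qed

text \<open>A segment centred at 0 contains 0, so its translate by \<open>v\<close> meets
  \<open>W\<close> whenever \<open>v\<close> lies in \<open>W\<close>; conversely it stays within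
  \<open>R\<close> of \<open>v\<close>, so meeting \<open>W\<close> puts \<open>v\<close> into the
  dilated set. The translation invariant weight \<open>h\<close> leaves the integral over
  \<open>v\<close>.\<close>

lemma nn_integral_ref_meet_bounds:
  assumes W: "convex W" "W \<in> sets borel" "cball 0 r \<subseteq> W" "r > 0"
    and h [measurable]: "h \<in> borel_measurable borel"
    and inv: "\<And>K v. K \<in> segments \<Longrightarrow> h (translate v K) = h K"
  shows "(\<integral>\<^sup>+K. h K \<partial>Q) * emeasure lborel W
      \<le> (\<integral>\<^sup>+K. h K * indicator {K\<in>segments. pts K \<inter> W \<noteq> {}} K \<partial>ref)" (is ?lower)
    and "(\<integral>\<^sup>+K. h K * indicator {K\<in>segments. pts K \<inter> W \<noteq> {}} K \<partial>ref)
      \<le> (\<integral>\<^sup>+K. h K \<partial>Q) * (ennreal ((1 + R / r)\<^sup>2) * emeasure lborel W)" (is ?upper)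
proof -
  have "ball 0 r \<subseteq> W" using W(3) ball_subset_cball by (rule order_trans[rotated])
  then have "ball 0 r \<subseteq> interior W" by (rule interior_maximal) simp
  then have "0 \<in> interior W" using W(4) by auto
  then have int: "interior W \<noteq> {}" by blast
  let ?H = "{K\<in>segments. pts K \<inter> W \<noteq> {}}"
  have H [measurable]: "?H \<in> sets borel"
    using W int by (intro measurable_segments_meet_convex)
  have eq: "(\<integral>\<^sup>+K. h K * indicator ?H K \<partial>ref) =
      (\<integral>\<^sup>+K. h K * (\<integral>\<^sup>+v. indicator ?H (translate v K) \<partial>lborel) \<partial>Q)"
  proof (rule nn_integral_ref_cong_Q)
    fix K assume K: "K \<in> short_segments R"
    have "(\<lambda>v. (K, v)) \<in> measurable lborel (borel \<Otimes>\<^sub>M borel)" by simp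
    from measurable_compose[OF this measurable_translate]
    have "(\<lambda>v. translate v K) \<in> borel_measurable lborel" by simp
    then have "(\<lambda>v. indicator ?H (translate v K) :: ennreal) \<in> borel_measurable lborel"
      by (rule measurable_compose) (use H in measurable)
    then show "(\<integral>\<^sup>+v. h (translate v K) * indicator ?H (translate v K) \<partial>lborel) =
        h K * (\<integral>\<^sup>+v. indicator ?H (translate v K) \<partial>lborel)"
      using K inv by (simp add: nn_integral_cmult short_segments_def)
  qed measurable
  have zero: "0 \<in> pts K" if K: "K \<in> short_segments R" "circumcentre K = 0" for K
  proof -
    obtain a b where "K = segment a b" using K(1) by (auto simp: short_segments_def segments_def)
    then show ?thesis using K(2) midpoint_in_closed_segment[of a b] by (simp add: segment.rep_eq circumcentre_segment)
  qed
  have lower: "emeasure lborel W \<le> (\<integral>\<^sup>+v. indicator ?H (translate v K) \<partial>lborel)"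
    if K: "K \<in> short_segments R" "circumcentre K = 0" for K
  proof -
    have "indicator W v \<le> (indicator ?H (translate v K) :: ennreal)" for v
    proof -
      have "v \<in> pts (translate v K)" using zero[OF K] by (force simp: translate.rep_eq)
      moreover have "translate v K \<in> segments" using K(1) by (simp add: short_segments_def segments_translate)
      ultimately show ?thesis by (auto split: split_indicator)
    qed
    then have "(\<integral>\<^sup>+v. indicator W v \<partial>lborel) \<le> (\<integral>\<^sup>+v. indicator ?H (translate v K) \<partial>lborel)"
      by (intro nn_integral_mono)
    then show ?thesis using W(2) by simp
  qed
  let ?c = "1 + R / r"
  have c: "?c > 0" using R_pos W(4) by (simp add: add_pos_pos)
  let ?W' = "(\<lambda>x. ?c *\<^sub>R x) ` W"
  have upper: "(\<integral>\<^sup>+v. indicator ?H (translate v K) \<partial>lborel) \<le> ennreal (?c\<^sup>2) * emeasure lborel W"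
    if K: "K \<in> short_segments R" "circumcentre K = 0" for K
  proof -
    have "indicator ?H (translate v K) \<le> (indicator ?W' v :: ennreal)" for v
    proof (cases "translate v K \<in> ?H")
      case True
      then obtain w where w: "w \<in> W" "w \<in> pts (translate v K)" by auto
      have "pts (translate v K) \<subseteq> cball v R"
        using segment_pts_subset_cball[OF short_segments_translate[OF K(1)], of v] K
        by (simp add: circumcentre_translate short_segments_def)
      then have "dist v w \<le> R" using w(2) by auto
      then have "v \<in> ?W'" using convex_neighbourhood_subset[OF W(1,3,4) _ w(1)] R_pos by simp
      then show ?thesis by (auto split: split_indicator)
    qed simp
    then have "(\<integral>\<^sup>+v. indicator ?H (translate v K) \<partial>lborel) \<le> (\<integral>\<^sup>+v. indicator ?W' v \<partial>lborel)"
      by (intro nn_integral_mono)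
    also have "\<dots> = ennreal (?c\<^sup>2) * emeasure lborel W"
      using emeasure_lborel_scale[OF W(2) c] by simp
    finally show ?thesis .
  qed
  have m: "h \<in> borel_measurable Q" using h by (simp add: measurable_cong_sets[OF sets_Q refl])
  show ?lower
    unfolding eq nn_integral_multc[OF m, symmetric]
    by (rule nn_integral_mono_AE, use AE_Q in eventually_elim) (use lower in \<open>auto intro!: mult_left_mono\<close>)
  show ?upper
    unfolding eq nn_integral_multc[OF m, symmetric]
    by (rule nn_integral_mono_AE, use AE_Q in eventually_elim) (use upper in \<open>auto intro!: mult_left_mono\<close>)
qed

end

section \<open>The isotropic law as a law of short centred segments\<close>

lemma measurable_centred_segment:
  "(\<lambda>(\<theta>, r). centred_segment \<theta> r) \<in> borel_measurable (borel \<Otimes>\<^sub>M borel)"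
proof -
  have "continuous_on UNIV (\<lambda>p::real \<times> real. (\<lambda>(a, b). segment a b)
      (- ((snd p / 2) *\<^sub>R (\<chi> i. if i = 1 then cos (fst p) else sin (fst p))),
       (snd p / 2) *\<^sub>R (\<chi> i. if i = 1 then cos (fst p) else sin (fst p))))"
  proof (rule continuous_on_compose2[OF continuous_segment])
    have ci: "continuous_on UNIV (\<lambda>p::real \<times> real. if i = 1 then cos (fst p) else sin (fst p))" for i :: 2
      by (cases "i = 1") (auto intro!: continuous_intros)
    show "continuous_on UNIV (\<lambda>p::real \<times> real.
        (- ((snd p / 2) *\<^sub>R (\<chi> i. if i = 1 then cos (fst p) else sin (fst p)) :: real^2),
         (snd p / 2) *\<^sub>R (\<chi> i. if i = 1 then cos (fst p) else sin (fst p)) :: real^2))"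
      by (intro continuous_intros ci) auto
  qed simp
  \<comment> \<open>Continuity is shown for the componentwise form, where the rule for
    \<open>\<chi>\<close> reduces it to the two coordinates.\<close>
  moreover have "(vector [cos t, sin t] :: real^2) = (\<chi> i. if i = 1 then cos t else sin t)" for t :: real
    by (simp add: vec_eq_iff forall_2)
  ultimately have "continuous_on UNIV (\<lambda>p. centred_segment (fst p) (snd p))"
    by (simp add: centred_segment_def)
  then show ?thesis unfolding borel_prod case_prod_unfold by (rule borel_measurable_continuous_onI)
qed

lemma centred_segment_facts:
  assumes "r > 0"
  shows "centred_segment \<theta> r \<in> segments" "seg_length (centred_segment \<theta> r) = r"
    "circumcentre (centred_segment \<theta> r) = 0"
proof -
  let ?u = "vector [cos \<theta>, sin \<theta>] :: real^2"
  have u: "norm ?u = 1" by (simp add: norm_vec_def L2_set_def sum_2)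
  have d: "dist (- ((r / 2) *\<^sub>R ?u)) ((r / 2) *\<^sub>R ?u) = r"
  proof -
    have "- ((r / 2) *\<^sub>R ?u) - (r / 2) *\<^sub>R ?u = (- r) *\<^sub>R ?u"
      by (simp add: vec_eq_iff field_simps)
    then show ?thesis using u assms by (simp add: dist_norm)
  qed
  then show "seg_length (centred_segment \<theta> r) = r" by (simp add: centred_segment_def seg_length_segment)
  show "centred_segment \<theta> r \<in> segments"
    using d assms unfolding centred_segment_def segments_def by force
  show "circumcentre (centred_segment \<theta> r) = 0"
    by (simp add: centred_segment_def circumcentre_segment midpoint_def)
qed

text \<open>Almost every sampled length lies in \<open>(0, 2 * R]\<close>, where
  \<open>centred_segment\<close> has exactly that length. The second claim turns integrals of
  functions of the length into integrals over \<open>QL\<close>, which later normalises the length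
  weight.\<close>

lemma isotropic_short_segment_law:
  assumes R: "R > 0" and QL: "prob_space QL" "sets QL = sets borel" "measure QL {0<..2 * R} = 1"
  shows "short_segment_law (isotropic_segment_law QL) R"
    and "f \<in> borel_measurable borel \<Longrightarrow>
      (\<integral>\<^sup>+K. f (seg_length K) \<partial>isotropic_segment_law QL) = (\<integral>\<^sup>+r. f r \<partial>QL)"
    and "AE r in QL. r \<in> {0<..2 * R}"
proof -
  let ?U = "uniform_measure lborel {0..<pi}"
  interpret QL: prob_space QL by fact
  interpret U: prob_space ?U by (rule prob_space_uniform_measure) (auto simp: pi_gt_zero)
  interpret UQ: pair_prob_space ?U QL ..
  have sets_eq: "sets (?U \<Otimes>\<^sub>M QL) = sets (borel \<Otimes>\<^sub>M borel)"
    by (rule sets_pair_measure_cong) (simp_all add: QL)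
  have m [measurable]: "(\<lambda>(\<theta>, r). centred_segment \<theta> r) \<in> measurable (?U \<Otimes>\<^sub>M QL) borel"
    using measurable_centred_segment by (simp add: measurable_cong_sets[OF sets_eq refl])
  show AE_r: "AE r in QL. r \<in> {0<..2 * R}"
    using QL.prob_eq_1[of "{0<..2 * R}"] QL by simp
  have AE_p: "AE p in ?U \<Otimes>\<^sub>M QL. snd p \<in> {0<..2 * R}"
  proof -
    have "{p\<in>space (borel \<Otimes>\<^sub>M borel). snd p \<in> {0<..2 * R}} \<in> sets (borel \<Otimes>\<^sub>M (borel :: real measure))"
      by measurable
    then have "{p\<in>space (?U \<Otimes>\<^sub>M QL). snd p \<in> {0<..2 * R}} \<in> sets (?U \<Otimes>\<^sub>M QL)"
      by (simp only: sets_eq sets_eq_imp_space_eq[OF sets_eq])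
    then show ?thesis
      by (rule UQ.AE_pair_measure) (use AE_r in simp)
  qed
  interpret Q: prob_space "isotropic_segment_law QL"
    unfolding isotropic_segment_law_def by (rule UQ.prob_space_distr[OF m])
  show "short_segment_law (isotropic_segment_law QL) R"
  proof
    show "sets (isotropic_segment_law QL) = sets borel" by (simp add: isotropic_segment_law_def)
    have [measurable]: "{K. K \<in> short_segments R \<and> circumcentre K = 0} \<in> sets borel"
    proof -
      have "{K\<in>space borel. K \<in> short_segments R \<and> circumcentre K = 0} \<in> sets borel" by measurable
      then show ?thesis by simp
    qed
    have "AE p in ?U \<Otimes>\<^sub>M QL. (case p of (\<theta>, r) \<Rightarrow> centred_segment \<theta> r) \<in> short_segments R \<and>
        circumcentre (case p of (\<theta>, r) \<Rightarrow> centred_segment \<theta> r) = 0"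
      using AE_p by eventually_elim (auto simp: short_segments_def centred_segment_facts)
    then show "AE K in isotropic_segment_law QL. K \<in> short_segments R \<and> circumcentre K = 0"
      unfolding isotropic_segment_law_def by (subst AE_distr_iff[OF m]) auto
  qed (rule R)
  show "(\<integral>\<^sup>+K. f (seg_length K) \<partial>isotropic_segment_law QL) = (\<integral>\<^sup>+r. f r \<partial>QL)"
    if [measurable]: "f \<in> borel_measurable borel"
  proof -
    have "(\<integral>\<^sup>+K. f (seg_length K) \<partial>isotropic_segment_law QL) =
        (\<integral>\<^sup>+p. f (seg_length (case p of (\<theta>, r) \<Rightarrow> centred_segment \<theta> r)) \<partial>(?U \<Otimes>\<^sub>M QL))"
      unfolding isotropic_segment_law_def by (rule nn_integral_distr[OF m]) measurable
    also have "\<dots> = (\<integral>\<^sup>+p. f (snd p) \<partial>(?U \<Otimes>\<^sub>M QL))"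
      by (rule nn_integral_cong_AE, use AE_p in eventually_elim)
        (auto simp: centred_segment_facts case_prod_unfold)
    also have "\<dots> = (\<integral>\<^sup>+\<theta>. \<integral>\<^sup>+r. f r \<partial>QL \<partial>?U)"
      by (subst QL.nn_integral_fst[symmetric]) (auto simp: measurable_cong_sets[OF sets_eq refl])
    also have "\<dots> = (\<integral>\<^sup>+r. f r \<partial>QL)" by (simp add: U.emeasure_space_1)
    finally show ?thesis .
  qed
qed

section \<open>From the DLR equations to the GNZ equation\<close>

lemma measurable_gibbs_weight:
  assumes [measurable]: "\<Delta> \<in> sets borel" and Z: "z \<in> measurable M config_space" and Y: "y \<in> measurable M config_space"
  shows "(\<lambda>p. gibbs_weight \<tau> \<beta> \<Delta> (z p) (y p)) \<in> borel_measurable M"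
proof -
  have [measurable]: "(\<lambda>p. \<tau> ^ card (y p)) \<in> borel_measurable M"
    by (rule measurable_compose[OF measurable_card_config[OF Y]]) simp
  have [measurable]: "(\<lambda>p. real (energy \<Delta> (y p \<union> z p))) \<in> borel_measurable M"
    by (intro measurable_energy measurable_config_Un Y Z) simp
  show ?thesis unfolding gibbs_weight_def by measurable
qed

lemma finite_hits: "locally_finite x \<Longrightarrow> finite {L\<in>x. hit L K}"
  by (simp add: locally_finite_def)

text \<open>The new pairs join \<open>K\<close> to the particles that hit it. Finiteness of the old
  set of pairs, needed because \<open>card\<close> of an infinite set is 0, holds since each pair
  has a member centred in \<open>\<Delta>\<close>, of which there are finitely many, each hit by
  finitely many others.\<close>

lemma energy_insert:
  assumes x: "locally_finite x" "finite (x \<inter> centred_in \<Delta>)" and K: "circumcentre K \<in> \<Delta>" "K \<notin> x"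
  shows "energy \<Delta> (insert K x) = energy \<Delta> x + card {L\<in>x. hit L K}"
proof -
  define E where "E x = {{K, L} | K L. K \<in> x \<and> L \<in> x \<and> K \<noteq> L \<and> hit K L \<and>
     (circumcentre K \<in> \<Delta> \<or> circumcentre L \<in> \<Delta>)}" for x
  \<comment> \<open>An unordered pair may be named so that the first member is the one centred in
    \<open>\<Delta>\<close>, which removes the disjunction.\<close>
  have E_iff: "e \<in> E x \<longleftrightarrow> (\<exists>K L. e = {K, L} \<and> K \<in> x \<and> L \<in> x \<and> K \<noteq> L \<and> hit L K \<and>
      circumcentre K \<in> \<Delta>)" for e x
  proof
    assume "e \<in> E x"
    then obtain A B where "e = {A, B}" "A \<in> x" "B \<in> x" "A \<noteq> B" "hit A B"
      "circumcentre A \<in> \<Delta> \<or> circumcentre B \<in> \<Delta>" unfolding E_def by blast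
    then show "\<exists>K L. e = {K, L} \<and> K \<in> x \<and> L \<in> x \<and> K \<noteq> L \<and> hit L K \<and> circumcentre K \<in> \<Delta>"
      using hit_commute insert_commute by metis
  qed (use hit_commute in \<open>unfold E_def, blast\<close>)
  have eq: "E (insert K x) = E x \<union> (\<lambda>L. {K, L}) ` {L\<in>x. hit L K}"
  proof (intro equalityI subsetI)
    fix e assume "e \<in> E (insert K x)"
    then obtain A B where AB: "e = {A, B}" "A \<in> insert K x" "B \<in> insert K x" "A \<noteq> B" "hit B A"
      "circumcentre A \<in> \<Delta>" unfolding E_iff by blast
    consider "A = K" | "B = K" "A \<noteq> K" | "A \<noteq> K" "B \<noteq> K" by blast
    then show "e \<in> E x \<union> (\<lambda>L. {K, L}) ` {L\<in>x. hit L K}"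
    proof cases
      case 1
      then have "B \<in> {L\<in>x. hit L K}" using AB by simp
      then show ?thesis using AB(1) 1 by blast
    next
      case 2
      then have "A \<in> {L\<in>x. hit L K}" using AB hit_commute by simp
      then show ?thesis using AB(1) 2 by (intro UnI2 image_eqI[of _ _ A]) (simp_all add: insert_commute)
    next
      case 3
      then have "e \<in> E x" using AB unfolding E_iff by blast
      then show ?thesis by blast
    qed
  next
    fix e assume e: "e \<in> E x \<union> (\<lambda>L. {K, L}) ` {L\<in>x. hit L K}"
    show "e \<in> E (insert K x)"
    proof (cases "e \<in> E x")
      case True
      then show ?thesis unfolding E_iff by blast
    next
      case False
      then obtain L where "e = {K, L}" "L \<in> x" "hit L K" using e by blast
      then show ?thesis using K unfolding E_iff by blast
    qed
  qed
  have "E x \<subseteq> (\<Union>A\<in>x \<inter> centred_in \<Delta>. (\<lambda>L. {A, L}) ` {L\<in>x. hit L A})"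
  proof
    fix e assume "e \<in> E x"
    then obtain A B where "e = {A, B}" "A \<in> x" "B \<in> x" "hit B A" "circumcentre A \<in> \<Delta>"
      unfolding E_iff by blast
    then show "e \<in> (\<Union>A\<in>x \<inter> centred_in \<Delta>. (\<lambda>L. {A, L}) ` {L\<in>x. hit L A})"
      by (intro UN_I[of A] image_eqI[of _ _ B]) (auto simp: centred_in_def)
  qed
  then have "finite (E x)"
    by (rule finite_subset) (use x finite_hits in auto)
  moreover have "E x \<inter> (\<lambda>L. {K, L}) ` {L\<in>x. hit L K} = {}"
    using K unfolding E_def by (auto simp: doubleton_eq_iff)
  moreover have "card ((\<lambda>L. {K, L}) ` {L\<in>x. hit L K}) = card {L\<in>x. hit L K}"
    using K by (intro card_image) (auto simp: inj_on_def doubleton_eq_iff)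
  ultimately show ?thesis
    unfolding energy_def E_def[symmetric] eq using finite_hits[OF x(1)] by (simp add: card_Un_disjoint)
qed

lemma cond_intensity_eq:
  "cond_intensity \<tau> \<beta> K x = \<tau> * exp (- \<beta> * real (card {L\<in>x. hit L K}))"
  by (simp add: cond_intensity_def hit_commute[of K])

lemma measurable_cond_intensity:
  assumes "Y \<in> measurable P config_space" "k \<in> measurable P borel"
  shows "(\<lambda>p. cond_intensity \<tau> \<beta> (k p) (Y p)) \<in> borel_measurable P"
proof -
  define n where "n p = real (card {L \<in> Y p. hit L (k p)})" for p
  have [measurable]: "n \<in> borel_measurable P" unfolding n_def using assms by (rule measurable_hits)
  have "(\<lambda>p. \<tau> * exp (- \<beta> * n p)) \<in> borel_measurable P" by measurable
  then show ?thesis by (simp add: cond_intensity_eq n_def)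
qed

text \<open>As nothing outside hits \<open>K\<close>, the energy increases by the number of hits
  within \<open>y\<close> alone, so the factor gained is free of \<open>z\<close>.\<close>

lemma gibbs_weight_insert:
  assumes \<tau>: "\<tau> > 0" and y: "finite y" and z: "locally_finite z" "z \<inter> centred_in \<Delta> = {}"
    and K: "circumcentre K \<in> \<Delta>" "K \<notin> y" "\<And>L. L \<in> z \<Longrightarrow> \<not> hit L K"
  shows "gibbs_weight \<tau> \<beta> \<Delta> z (insert K y) = gibbs_weight \<tau> \<beta> \<Delta> z y * ennreal (cond_intensity \<tau> \<beta> K y)"
proof -
  have "K \<notin> z" using z K by (auto simp: centred_in_def)
  moreover have "finite ((y \<union> z) \<inter> centred_in \<Delta>)" using y z(2) by (simp add: Int_Un_distrib2)
  ultimately have "energy \<Delta> (insert K (y \<union> z)) = energy \<Delta> (y \<union> z) + card {L\<in>y \<union> z. hit L K}"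
    using K y z locally_finite_Un[OF locally_finite_finite[OF y] z(1)] by (intro energy_insert) auto
  moreover have "{L\<in>y \<union> z. hit L K} = {L\<in>y. hit L K}" using K(3) by auto
  ultimately have e: "energy \<Delta> (insert K (y \<union> z)) = energy \<Delta> (y \<union> z) + card {L\<in>y. hit L K}" by simp
  show ?thesis
    unfolding gibbs_weight_def cond_intensity_eq using \<tau> y K(2) e
    by (subst ennreal_mult[symmetric]) (auto simp: algebra_simps exp_diff exp_minus divide_simps)
qed

locale gibbs_window = short_segment_law +
  fixes \<tau> \<beta> :: real and \<Delta> :: "(real^2) set" and P \<pi> :: "particle set measure"
  assumes \<tau>_pos: "\<tau> > 0" and \<beta>_nonneg: "\<beta> \<ge> 0"
    and \<Delta>: "\<Delta> \<in> sets borel" "bounded \<Delta>"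
    and P: "prob_space P" and sets_P: "sets P = sets config_space"
    and \<pi>: "poisson_law (density ref (indicator (centred_in \<Delta>))) \<pi>"
    and kernel: "\<And>A. A \<in> sets config_space \<Longrightarrow> AE x in P.
      nn_cond_exp P (vimage_algebra (space P) (\<lambda>x. x \<inter> centred_in (- \<Delta>)) config_space)
        (indicator {x. x \<inter> centred_in \<Delta> \<in> A}) x
      = emeasure (gibbs_kernel \<tau> \<beta> \<Delta> \<pi> (x \<inter> centred_in (- \<Delta>))) A"
begin

definition "\<mu> = density ref (indicator (centred_in \<Delta>))"

lemma sets_\<mu> [simp, measurable_cong]: "sets \<mu> = sets borel" and space_\<mu> [simp]: "space \<mu> = UNIV"
  by (simp_all add: \<mu>_def)

lemma sets_\<pi> [measurable_cong]: "sets \<pi> = sets config_space"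
  using \<pi> by (simp add: poisson_law_def)

lemma space_\<pi>: "space \<pi> = {x. locally_finite x}"
  using sets_eq_imp_space_eq[OF sets_\<pi>] by (simp add: space_config_space)

lemma space_P: "space P = {x. locally_finite x}"
  using sets_eq_imp_space_eq[OF sets_P] by (simp add: space_config_space)

lemma \<Delta>_compl [measurable]: "- \<Delta> \<in> sets borel"
  using \<Delta>(1) by (rule borel_comp)

lemma poisson_\<pi>: "poisson_law \<mu> \<pi>"
  using \<pi> by (simp add: \<mu>_def)

sublocale P: prob_space P by (rule P)
sublocale \<pi>: prob_space \<pi> using \<pi> by (simp add: poisson_law_def)
sublocale P\<pi>: pair_sigma_finite P \<pi> ..
sublocale \<mu>: finite_measure \<mu>
proof
  have "emeasure \<mu> UNIV = emeasure ref (centred_in \<Delta>)"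
    unfolding \<mu>_def using \<Delta>(1) by (subst emeasure_density) auto
  also have "\<dots> = emeasure lborel \<Delta>" using \<Delta>(1) by (rule emeasure_ref_centred_in)
  also have "\<dots> < \<infinity>" using \<Delta>(2) by (rule emeasure_bounded_finite)
  finally show "emeasure \<mu> (space \<mu>) \<noteq> \<infinity>" by simp
qed

lemma nn_integral_\<mu>:
  assumes [measurable]: "f \<in> borel_measurable borel"
  shows "(\<integral>\<^sup>+K. f K \<partial>\<mu>) = (\<integral>\<^sup>+K. indicator (centred_in \<Delta>) K * f K \<partial>ref)"
  unfolding \<mu>_def using \<Delta>(1) by (subst nn_integral_density) auto

lemma AE_\<mu>: "AE K in \<mu>. K \<in> short_segments R \<and> K \<in> centred_in \<Delta>"
proof -
  have "AE K in ref. 0 < (indicator (centred_in \<Delta>) K :: ennreal) \<longrightarrow> K \<in> short_segments R \<and> K \<in> centred_in \<Delta>"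
    using AE_ref_short by eventually_elim (auto split: split_indicator)
  then show ?thesis unfolding \<mu>_def using \<Delta>(1) by (subst AE_density) auto
qed

text \<open>By the Mecke equation the expected number of points in \<open>N\<close> is the intensity
  of \<open>N\<close>, here 0.\<close>

lemma AE_\<pi>_avoids:
  assumes [measurable]: "N \<in> sets borel" and N: "emeasure \<mu> N = 0"
  shows "AE y in \<pi>. y \<inter> N = {}"
proof -
  have "(\<integral>\<^sup>+y. \<integral>\<^sup>+K. indicator N K \<partial>count_space y \<partial>\<pi>) = (\<integral>\<^sup>+y. \<integral>\<^sup>+K. indicator N K \<partial>\<mu> \<partial>\<pi>)"
    using mecke[OF poisson_\<pi> sets_\<mu>, of "\<lambda>p. indicator N (fst p)"] by simp
  also have "\<dots> = 0" using N by simp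
  finally have z: "(\<integral>\<^sup>+y. \<integral>\<^sup>+K. indicator N K \<partial>count_space y \<partial>\<pi>) = 0" .
  have [measurable]: "(\<lambda>y. \<integral>\<^sup>+K. indicator N K \<partial>count_space y) \<in> borel_measurable \<pi>"
    by (rule measurable_config_sum) measurable
  have "AE y in \<pi>. (\<integral>\<^sup>+K. indicator N K \<partial>count_space y) = (0::ennreal)"
    using z by (subst (asm) nn_integral_0_iff_AE) auto
  then show ?thesis
    by eventually_elim (auto simp: nn_integral_0_iff_AE AE_count_space)
qed

text \<open>Every part is an instance of the Mecke equation. The expected number of points is the
  finite mass of \<open>\<mu>\<close>, and null sets are avoided. The expected
  \<open>\<mu>\<close>-measure of \<open>y\<close> equals the expected number of points
  \<open>K\<close> lying in \<open>y - {K}\<close>, which is 0.\<close>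

lemma AE_\<pi>_good: "AE y in \<pi>. finite y \<and> y \<subseteq> short_segments R \<and> y \<subseteq> centred_in \<Delta> \<and> (AE K in \<mu>. K \<notin> y)"
proof -
  have m1: "(\<lambda>y. \<integral>\<^sup>+K. 1 \<partial>count_space y) \<in> borel_measurable \<pi>"
    by (rule measurable_config_sum) measurable
  have "(\<integral>\<^sup>+y. \<integral>\<^sup>+K. 1 \<partial>count_space y \<partial>\<pi>) = (\<integral>\<^sup>+y. \<integral>\<^sup>+K. 1 \<partial>\<mu> \<partial>\<pi>)"
    using mecke[OF poisson_\<pi> sets_\<mu>, of "\<lambda>p. 1"] by simp
  also have "\<dots> = emeasure \<mu> UNIV" by (simp add: \<pi>.emeasure_space_1)
  finally have "(\<integral>\<^sup>+y. \<integral>\<^sup>+K. 1 \<partial>count_space y \<partial>\<pi>) \<noteq> \<infinity>" using \<mu>.emeasure_finite[of UNIV] by simp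
  then have "AE y in \<pi>. (\<integral>\<^sup>+K. 1 \<partial>count_space y) \<noteq> (\<infinity>::ennreal)"
    by (rule nn_integral_PInf_AE[OF m1])
  then have fin: "AE y in \<pi>. finite y"
    by eventually_elim (metis emeasure_count_space_infinite nn_integral_const mult_1 order_refl space_count_space)
  have "AE K in \<mu>. K \<notin> - (short_segments R \<inter> centred_in \<Delta>)" using AE_\<mu> by auto
  then have "emeasure \<mu> (- (short_segments R \<inter> centred_in \<Delta>)) = 0"
    using \<Delta>(1) by (subst (asm) AE_iff_measurable[of "- (short_segments R \<inter> centred_in \<Delta>)"]) auto
  then have sub: "AE y in \<pi>. y \<inter> - (short_segments R \<inter> centred_in \<Delta>) = {}"
    using \<Delta>(1) by (intro AE_\<pi>_avoids) auto
  have mem: "Measurable.pred (borel \<Otimes>\<^sub>M config_space) (\<lambda>p. fst p \<in> snd p)"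
    by (rule measurable_config_member) measurable
  then have mem': "(\<lambda>p. of_bool (fst p \<in> snd p) :: ennreal) \<in> borel_measurable (borel \<Otimes>\<^sub>M config_space)"
    by (simp add: of_bool_def)
  have "(\<integral>\<^sup>+y. \<integral>\<^sup>+K. of_bool (K \<in> y) \<partial>\<mu> \<partial>\<pi>) = (\<integral>\<^sup>+y. \<integral>\<^sup>+K. of_bool (K \<in> y - {K}) \<partial>count_space y \<partial>\<pi>)"
    using mecke[OF poisson_\<pi> sets_\<mu> mem'] by simp
  then have z: "(\<integral>\<^sup>+y. \<integral>\<^sup>+K. of_bool (K \<in> y) \<partial>\<mu> \<partial>\<pi>) = (0::ennreal)" by simp
  have mem'': "(\<lambda>(y, K). of_bool (K \<in> y) :: ennreal) \<in> borel_measurable (\<pi> \<Otimes>\<^sub>M \<mu>)"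
  proof -
    have [measurable]: "Measurable.pred (\<pi> \<Otimes>\<^sub>M \<mu>) (\<lambda>p. snd p \<in> fst p)"
      by (rule measurable_config_member) measurable
    show ?thesis by (simp add: of_bool_def case_prod_unfold)
  qed
  have "AE y in \<pi>. (\<integral>\<^sup>+K. of_bool (K \<in> y) \<partial>\<mu>) = (0::ennreal)"
    using z \<mu>.borel_measurable_nn_integral[OF mem''] by (subst (asm) nn_integral_0_iff_AE) auto
  moreover have "AE y in \<pi>. (\<lambda>K. of_bool (K \<in> y) :: ennreal) \<in> borel_measurable \<mu>"
    using measurable_Pair2[OF mem''] by (intro AE_I2) simp
  ultimately have "AE y in \<pi>. AE K in \<mu>. K \<notin> y"
    by eventually_elim (simp add: nn_integral_0_iff_AE)
  with fin sub show ?thesis by eventually_elim blast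
qed

text \<open>The normalised Gibbs density of \<open>y\<close>, averaged over the configuration
  outside the window. The normalising integral does not involve \<open>y\<close>, so a factor gained
  by inserting a particle survives the average.\<close>

definition q :: "particle set \<Rightarrow> ennreal" where
  "q y = (\<integral>\<^sup>+x. gibbs_weight \<tau> \<beta> \<Delta> (x \<inter> centred_in (- \<Delta>)) y /
     (\<integral>\<^sup>+y'. gibbs_weight \<tau> \<beta> \<Delta> (x \<inter> centred_in (- \<Delta>)) y' \<partial>\<pi>) \<partial>P)"

lemma measurable_outside [measurable]: "(\<lambda>x. x \<inter> centred_in (- \<Delta>)) \<in> measurable P config_space"
  and measurable_inside [measurable]: "(\<lambda>x. x \<inter> centred_in \<Delta>) \<in> measurable P config_space"
  using \<Delta>(1) by (auto intro!: measurable_config_Int simp: measurable_cong_sets[OF sets_P refl])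

lemma measurable_weight_pair:
  "(\<lambda>(x, y). gibbs_weight \<tau> \<beta> \<Delta> (x \<inter> centred_in (- \<Delta>)) y) \<in> borel_measurable (P \<Otimes>\<^sub>M \<pi>)"
  unfolding case_prod_unfold
  using \<Delta>(1) by (intro measurable_gibbs_weight measurable_compose[OF measurable_fst measurable_outside])
    (auto intro!: measurable_snd'' simp: sets_\<pi>)

lemma measurable_density_pair:
  "(\<lambda>(x, y). gibbs_weight \<tau> \<beta> \<Delta> (x \<inter> centred_in (- \<Delta>)) y /
     (\<integral>\<^sup>+y'. gibbs_weight \<tau> \<beta> \<Delta> (x \<inter> centred_in (- \<Delta>)) y' \<partial>\<pi>)) \<in> borel_measurable (P \<Otimes>\<^sub>M \<pi>)"
proof -
  have [measurable]: "(\<lambda>x. \<integral>\<^sup>+y'. gibbs_weight \<tau> \<beta> \<Delta> (x \<inter> centred_in (- \<Delta>)) y' \<partial>\<pi>) \<in> borel_measurable P"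
    by (rule \<pi>.borel_measurable_nn_integral[OF measurable_weight_pair])
  show ?thesis using measurable_weight_pair by (simp add: case_prod_unfold)
qed

lemma measurable_q [measurable]: "q \<in> borel_measurable config_space"
proof -
  have "q \<in> borel_measurable \<pi>"
    unfolding q_def
    by (rule P.borel_measurable_nn_integral)
      (use measurable_compose[OF measurable_pair_swap' measurable_density_pair] in \<open>simp add: case_prod_unfold\<close>)
  then show ?thesis by (simp add: measurable_cong_sets[OF sets_\<pi> refl])
qed

definition "P_in = distr P config_space (\<lambda>x. x \<inter> centred_in \<Delta>)"

text \<open>A conditional expectation integrates to the expectation, so the probability of an inner
  event is the mean of the Gibbs kernel over the outer configuration; exchanging the order of
  integration collects that mean in \<open>q\<close>.\<close>

lemma P_in_eq_density: "P_in = density \<pi> q"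
proof (rule measure_eqI)
  show "sets P_in = sets (density \<pi> q)" by (simp add: P_in_def sets_\<pi>)
  fix A assume "A \<in> sets P_in"
  then have A: "A \<in> sets config_space" by (simp add: P_in_def)
  let ?F = "vimage_algebra (space P) (\<lambda>x. x \<inter> centred_in (- \<Delta>)) config_space"
  let ?I = "{x. x \<inter> centred_in \<Delta> \<in> A}"
  have "finite_measure_subalgebra P ?F"
  proof
    show "subalgebra P ?F"
      unfolding subalgebra_def using sets_image_in_sets[OF refl measurable_outside] by simp
  qed
  then interpret F: finite_measure_subalgebra P ?F .
  have I: "(indicator ?I :: _ \<Rightarrow> ennreal) \<in> borel_measurable P"
  proof -
    have "(\<lambda>x. indicator A (x \<inter> centred_in \<Delta>) :: ennreal) \<in> borel_measurable P"
      using A by measurable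
    moreover have "indicator ?I = (\<lambda>x. indicator A (x \<inter> centred_in \<Delta>) :: ennreal)"
      by (auto simp: fun_eq_iff split: split_indicator)
    ultimately show ?thesis by simp
  qed
  have "emeasure P_in A = (\<integral>\<^sup>+x. indicator ?I x \<partial>P)"
  proof -
    have "emeasure P_in A = (\<integral>\<^sup>+x. indicator A x \<partial>P_in)" using A by (simp add: P_in_def)
    also have "\<dots> = (\<integral>\<^sup>+x. indicator A (x \<inter> centred_in \<Delta>) \<partial>P)"
      unfolding P_in_def using A by (intro nn_integral_distr) auto
    finally show ?thesis by (simp add: indicator_def)
  qed
  also have "\<dots> = (\<integral>\<^sup>+x. nn_cond_exp P ?F (indicator ?I) x \<partial>P)"
    using F.nn_cond_exp_intg[of "\<lambda>_. 1" "indicator ?I"] I by simp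
  also have "\<dots> = (\<integral>\<^sup>+x. emeasure (gibbs_kernel \<tau> \<beta> \<Delta> \<pi> (x \<inter> centred_in (- \<Delta>))) A \<partial>P)"
    by (rule nn_integral_cong_AE[OF kernel[OF A]])
  also have "\<dots> = (\<integral>\<^sup>+x. \<integral>\<^sup>+y. gibbs_weight \<tau> \<beta> \<Delta> (x \<inter> centred_in (- \<Delta>)) y /
     (\<integral>\<^sup>+y'. gibbs_weight \<tau> \<beta> \<Delta> (x \<inter> centred_in (- \<Delta>)) y' \<partial>\<pi>) * indicator A y \<partial>\<pi> \<partial>P)"
  proof (rule nn_integral_cong)
    fix x assume x: "x \<in> space P"
    have "(\<lambda>y. gibbs_weight \<tau> \<beta> \<Delta> (x \<inter> centred_in (- \<Delta>)) y /
       (\<integral>\<^sup>+y'. gibbs_weight \<tau> \<beta> \<Delta> (x \<inter> centred_in (- \<Delta>)) y' \<partial>\<pi>)) \<in> borel_measurable \<pi>"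
      using measurable_compose[OF measurable_Pair1'[OF x] measurable_density_pair] by simp
    then show "emeasure (gibbs_kernel \<tau> \<beta> \<Delta> \<pi> (x \<inter> centred_in (- \<Delta>))) A =
      (\<integral>\<^sup>+y. gibbs_weight \<tau> \<beta> \<Delta> (x \<inter> centred_in (- \<Delta>)) y /
       (\<integral>\<^sup>+y'. gibbs_weight \<tau> \<beta> \<Delta> (x \<inter> centred_in (- \<Delta>)) y' \<partial>\<pi>) * indicator A y \<partial>\<pi>)"
      unfolding gibbs_kernel_def using A by (intro emeasure_density) (auto simp: sets_\<pi>)
  qed
  also have "\<dots> = (\<integral>\<^sup>+y. \<integral>\<^sup>+x. gibbs_weight \<tau> \<beta> \<Delta> (x \<inter> centred_in (- \<Delta>)) y /
     (\<integral>\<^sup>+y'. gibbs_weight \<tau> \<beta> \<Delta> (x \<inter> centred_in (- \<Delta>)) y' \<partial>\<pi>) * indicator A y \<partial>P \<partial>\<pi>)"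
    by (rule P\<pi>.Fubini'[symmetric])
      (use measurable_density_pair A in \<open>simp add: case_prod_unfold sets_\<pi>\<close>)
  also have "\<dots> = (\<integral>\<^sup>+y. q y * indicator A y \<partial>\<pi>)"
    unfolding q_def
  proof (intro nn_integral_cong nn_integral_multc)
    fix y assume y: "y \<in> space \<pi>"
    show "(\<lambda>x. gibbs_weight \<tau> \<beta> \<Delta> (x \<inter> centred_in (- \<Delta>)) y /
       (\<integral>\<^sup>+y'. gibbs_weight \<tau> \<beta> \<Delta> (x \<inter> centred_in (- \<Delta>)) y' \<partial>\<pi>)) \<in> borel_measurable P"
      using measurable_compose[OF measurable_Pair2'[OF y] measurable_density_pair] by simp
  qed
  also have "\<dots> = emeasure (density \<pi> q) A"
    using A by (subst emeasure_density) (auto simp: sets_\<pi> measurable_cong_sets[OF sets_\<pi> refl])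
  finally show "emeasure P_in A = emeasure (density \<pi> q) A" .
qed

lemma AE_P_in_good: "AE y in P_in. finite y \<and> y \<subseteq> short_segments R \<and> y \<subseteq> centred_in \<Delta> \<and> (AE K in \<mu>. K \<notin> y)"
  unfolding P_in_eq_density
proof (subst AE_density)
  show "AE y in \<pi>. 0 < q y \<longrightarrow> finite y \<and> y \<subseteq> short_segments R \<and> y \<subseteq> centred_in \<Delta> \<and> (AE K in \<mu>. K \<notin> y)"
    using AE_\<pi>_good by eventually_elim blast
qed (simp add: measurable_cong_sets[OF sets_\<pi> refl])

lemma AE_P_inside_short: "AE x in P. x \<inter> centred_in \<Delta> \<subseteq> short_segments R"
proof (rule AE_distrD[OF measurable_inside])
  show "AE y in distr P config_space (\<lambda>x. x \<inter> centred_in \<Delta>). y \<subseteq> short_segments R"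
    unfolding P_in_def[symmetric] using AE_P_in_good by eventually_elim blast
qed

lemma GNZ:
  assumes short: "AE x in P. x \<subseteq> short_segments R"
    and D: "\<And>K. K \<in> D \<Longrightarrow> cball (circumcentre K) (2 * R) \<subseteq> \<Delta>" "D \<subseteq> short_segments R"
    and f: "f \<in> borel_measurable (borel \<Otimes>\<^sub>M config_space)" "\<And>K y. K \<notin> D \<Longrightarrow> f (K, y) = 0"
  shows "(\<integral>\<^sup>+y. \<integral>\<^sup>+K. f (K, y - {K}) \<partial>count_space y \<partial>P_in) =
    (\<integral>\<^sup>+y. \<integral>\<^sup>+K. f (K, y) * ennreal (cond_intensity \<tau> \<beta> K y) \<partial>ref \<partial>P_in)"
proof -
  have cD: "circumcentre K \<in> \<Delta>" if "K \<in> D" for K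
    using D(1)[OF that] R_pos by (auto simp: subset_eq)
  have ins [measurable]: "(\<lambda>p. insert (fst p) (snd p)) \<in> measurable (borel \<Otimes>\<^sub>M config_space) config_space"
    by (rule measurable_config_insert) measurable
  have ci [measurable]: "(\<lambda>p. ennreal (cond_intensity \<tau> \<beta> (fst p) (snd p))) \<in> borel_measurable (borel \<Otimes>\<^sub>M config_space)"
    by (intro measurable_compose[OF measurable_cond_intensity measurable_ennreal]) measurable
  note f(1)[measurable]
  have m: "(\<lambda>p. f p * q (insert (fst p) (snd p))) \<in> borel_measurable (borel \<Otimes>\<^sub>M config_space)" by measurable
  \<comment> \<open>A short segment centred outside the window is more than \<open>2 * R\<close>
    away from the centre of \<open>K\<close>, so it cannot hit \<open>K\<close>; hence the factor is
    the same for almost every outer configuration.\<close>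
  have qins: "q (insert K y) = q y * ennreal (cond_intensity \<tau> \<beta> K y)"
    if y: "finite y" and K: "K \<in> D" "K \<notin> y" for K y
  proof -
    let ?Z = "\<lambda>x. \<integral>\<^sup>+y'. gibbs_weight \<tau> \<beta> \<Delta> (x \<inter> centred_in (- \<Delta>)) y' \<partial>\<pi>"
    have "y \<in> space \<pi>" using y by (simp add: space_\<pi> locally_finite_finite)
    then have meas: "(\<lambda>x. gibbs_weight \<tau> \<beta> \<Delta> (x \<inter> centred_in (- \<Delta>)) y / ?Z x) \<in> borel_measurable P"
      using measurable_compose[OF measurable_Pair2' measurable_density_pair] by simp
    have "q (insert K y) = (\<integral>\<^sup>+x. gibbs_weight \<tau> \<beta> \<Delta> (x \<inter> centred_in (- \<Delta>)) y / ?Z x * ennreal (cond_intensity \<tau> \<beta> K y) \<partial>P)"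
      unfolding q_def
    proof (rule nn_integral_cong_AE, use short AE_space in eventually_elim)
      fix x assume x: "x \<subseteq> short_segments R" "x \<in> space P"
      have lf: "locally_finite (x \<inter> centred_in (- \<Delta>))"
        using x(2) locally_finite_subset[of x] by (simp add: space_P)
      have hit: "\<not> hit L K" if "L \<in> x \<inter> centred_in (- \<Delta>)" for L
        using hit_short_dist_le[of L R K] that x D(2) K(1) D(1)[OF K(1)] by (force simp: centred_in_def dist_commute)
      have "gibbs_weight \<tau> \<beta> \<Delta> (x \<inter> centred_in (- \<Delta>)) (insert K y) =
          gibbs_weight \<tau> \<beta> \<Delta> (x \<inter> centred_in (- \<Delta>)) y * ennreal (cond_intensity \<tau> \<beta> K y)"
        using hit cD K by (intro gibbs_weight_insert \<tau>_pos y lf) (auto simp: centred_in_def)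
      then show "gibbs_weight \<tau> \<beta> \<Delta> (x \<inter> centred_in (- \<Delta>)) (insert K y) / ?Z x =
          gibbs_weight \<tau> \<beta> \<Delta> (x \<inter> centred_in (- \<Delta>)) y / ?Z x * ennreal (cond_intensity \<tau> \<beta> K y)"
        by (simp add: divide_ennreal_def mult_ac)
    qed
    also have "\<dots> = q y * ennreal (cond_intensity \<tau> \<beta> K y)"
      unfolding q_def using meas by (rule nn_integral_multc)
    finally show ?thesis .
  qed
  have mcs: "(\<lambda>y. \<integral>\<^sup>+K. f (K, y - {K}) \<partial>count_space y) \<in> borel_measurable \<pi>"
    using measurable_campbell_sum[OF f(1)] by (simp add: measurable_cong_sets[OF sets_\<pi> refl])
  have q': "q \<in> borel_measurable \<pi>" by (simp add: measurable_cong_sets[OF sets_\<pi> refl])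
  have "(\<integral>\<^sup>+y. \<integral>\<^sup>+K. f (K, y - {K}) \<partial>count_space y \<partial>P_in) = (\<integral>\<^sup>+y. q y * (\<integral>\<^sup>+K. f (K, y - {K}) \<partial>count_space y) \<partial>\<pi>)"
    unfolding P_in_eq_density by (rule nn_integral_density[OF q' mcs])
  \<comment> \<open>For a point \<open>K\<close> of \<open>y\<close>, reinserting it after removal
    gives \<open>y\<close> back. Written this way, the density becomes part of a function of
    \<open>(K, y - {K})\<close>, to which the Mecke equation applies.\<close>
  also have "\<dots> = (\<integral>\<^sup>+y. \<integral>\<^sup>+K. f (K, y - {K}) * q (insert K (y - {K})) \<partial>count_space y \<partial>\<pi>)"
  proof (rule nn_integral_cong)
    fix y
    have "q y * (\<integral>\<^sup>+K. f (K, y - {K}) \<partial>count_space y) = (\<integral>\<^sup>+K. f (K, y - {K}) * q y \<partial>count_space y)"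
      by (subst mult.commute, rule nn_integral_multc[symmetric]) simp
    also have "\<dots> = (\<integral>\<^sup>+K. f (K, y - {K}) * q (insert K (y - {K})) \<partial>count_space y)"
      by (intro nn_integral_cong) (simp add: insert_absorb)
    finally show "q y * (\<integral>\<^sup>+K. f (K, y - {K}) \<partial>count_space y) = (\<integral>\<^sup>+K. f (K, y - {K}) * q (insert K (y - {K})) \<partial>count_space y)" .
  qed
  also have "\<dots> = (\<integral>\<^sup>+y. \<integral>\<^sup>+K. f (K, y) * q (insert K y) \<partial>\<mu> \<partial>\<pi>)"
    using mecke[OF poisson_\<pi> sets_\<mu> m] by simp
  \<comment> \<open>The insertion rule for \<open>q\<close> asks for a particle that is not yet
    present, which is true for \<open>\<mu>\<close>-almost every \<open>K\<close>.\<close>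
  also have "\<dots> = (\<integral>\<^sup>+y. q y * (\<integral>\<^sup>+K. f (K, y) * ennreal (cond_intensity \<tau> \<beta> K y) \<partial>\<mu>) \<partial>\<pi>)"
  proof (rule nn_integral_cong_AE, use AE_\<pi>_good AE_space in eventually_elim)
    fix y assume y: "finite y \<and> y \<subseteq> short_segments R \<and> y \<subseteq> centred_in \<Delta> \<and> (AE K in \<mu>. K \<notin> y)" "y \<in> space \<pi>"
    have ym: "(\<lambda>K. (K, y)) \<in> measurable \<mu> (borel \<Otimes>\<^sub>M config_space)"
      using y(2) sets_eq_imp_space_eq[OF sets_\<pi>] by (intro measurable_Pair) auto
    have mm: "(\<lambda>K. f (K, y) * ennreal (cond_intensity \<tau> \<beta> K y)) \<in> borel_measurable \<mu>"
      using measurable_compose[OF ym f(1)] measurable_compose[OF ym ci] by simp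
    have "(\<integral>\<^sup>+K. f (K, y) * q (insert K y) \<partial>\<mu>) = (\<integral>\<^sup>+K. q y * (f (K, y) * ennreal (cond_intensity \<tau> \<beta> K y)) \<partial>\<mu>)"
    proof (rule nn_integral_cong_AE)
      have "AE K in \<mu>. K \<notin> y" using y(1) by blast
      then show "AE K in \<mu>. f (K, y) * q (insert K y) = q y * (f (K, y) * ennreal (cond_intensity \<tau> \<beta> K y))"
      proof eventually_elim
        fix K assume "K \<notin> y"
        then show "f (K, y) * q (insert K y) = q y * (f (K, y) * ennreal (cond_intensity \<tau> \<beta> K y))"
          using qins[of y K] y(1) f(2)[of K y] by (cases "K \<in> D") (simp_all add: mult_ac)
      qed
    qed
    also have "\<dots> = q y * (\<integral>\<^sup>+K. f (K, y) * ennreal (cond_intensity \<tau> \<beta> K y) \<partial>\<mu>)"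
      using mm by (rule nn_integral_cmult)
    finally show "(\<integral>\<^sup>+K. f (K, y) * q (insert K y) \<partial>\<mu>) = q y * (\<integral>\<^sup>+K. f (K, y) * ennreal (cond_intensity \<tau> \<beta> K y) \<partial>\<mu>)" .
  qed
  also have "\<dots> = (\<integral>\<^sup>+y. \<integral>\<^sup>+K. f (K, y) * ennreal (cond_intensity \<tau> \<beta> K y) \<partial>\<mu> \<partial>P_in)"
    unfolding P_in_eq_density
  proof (rule nn_integral_density[OF q', symmetric])
    have "(\<lambda>(y, K). f (K, y) * ennreal (cond_intensity \<tau> \<beta> K y)) \<in> borel_measurable (\<pi> \<Otimes>\<^sub>M \<mu>)"
    proof -
      have "(\<lambda>p. (snd p, fst p)) \<in> measurable (\<pi> \<Otimes>\<^sub>M \<mu>) (borel \<Otimes>\<^sub>M config_space)" by measurable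
      from measurable_compose[OF this f(1)] measurable_compose[OF this ci] show ?thesis
        by (simp add: case_prod_unfold)
    qed
    then show "(\<lambda>y. \<integral>\<^sup>+K. f (K, y) * ennreal (cond_intensity \<tau> \<beta> K y) \<partial>\<mu>) \<in> borel_measurable \<pi>"
      by (rule \<mu>.borel_measurable_nn_integral)
  qed
  also have "\<dots> = (\<integral>\<^sup>+y. \<integral>\<^sup>+K. f (K, y) * ennreal (cond_intensity \<tau> \<beta> K y) \<partial>ref \<partial>P_in)"
  proof (rule nn_integral_cong)
    fix y assume "y \<in> space P_in"
    then have ym: "(\<lambda>K. (K, y)) \<in> measurable borel (borel \<Otimes>\<^sub>M config_space)"
      by (intro measurable_Pair) (auto simp: P_in_def)
    have mm: "(\<lambda>K. f (K, y) * ennreal (cond_intensity \<tau> \<beta> K y)) \<in> borel_measurable borel"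
      using measurable_compose[OF ym f(1)] measurable_compose[OF ym ci] by simp
    show "(\<integral>\<^sup>+K. f (K, y) * ennreal (cond_intensity \<tau> \<beta> K y) \<partial>\<mu>) = (\<integral>\<^sup>+K. f (K, y) * ennreal (cond_intensity \<tau> \<beta> K y) \<partial>ref)"
      unfolding nn_integral_\<mu>[OF mm]
      by (intro nn_integral_cong) (use f(2) cD in \<open>auto simp: centred_in_def split: split_indicator\<close>)
  qed
  finally show ?thesis .
qed

end

lemma DLR_gibbs_window:
  assumes "short_segment_law Q R" "\<tau> > 0" "\<beta> \<ge> 0" "prob_space P" "sets P = sets config_space" "DLR \<tau> \<beta> Q P"
    and "r > 0"
  obtains \<pi> where "gibbs_window Q R \<tau> \<beta> (cball 0 r) P \<pi>"
proof -
  have "emeasure lborel (cball (0::real^2) r) > 0"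
  proof -
    have "emeasure lborel (cball (0::real^2) r) \<noteq> 0"
    proof
      assume "emeasure lborel (cball (0::real^2) r) = 0"
      then have "measure lborel (cball (0::real^2) r) = 0" by (simp add: measure_def)
      then show False using content_cball_pos[OF assms(7), of "0::real^2"] by simp
    qed
    then show ?thesis by (simp add: zero_less_iff_neq_zero)
  qed
  then obtain \<pi> where "poisson_law (density (reference_measure Q) (indicator (centred_in (cball 0 r)))) \<pi>"
    "\<And>A. A \<in> sets config_space \<Longrightarrow> AE x in P.
      nn_cond_exp P (vimage_algebra (space P) (\<lambda>x. x \<inter> centred_in (- cball 0 r)) config_space)
        (indicator {x. x \<inter> centred_in (cball 0 r) \<in> A}) x
      = emeasure (gibbs_kernel \<tau> \<beta> (cball 0 r) \<pi> (x \<inter> centred_in (- cball 0 r))) A"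
    using assms(6) unfolding DLR_def by (auto dest!: bspec[of _ _ "cball 0 r"])
  with assms have "gibbs_window Q R \<tau> \<beta> (cball 0 r) P \<pi>"
    by (intro gibbs_window.intro gibbs_window_axioms.intro) auto
  then show thesis by (rule that)
qed

text \<open>In each disc the law has a density with respect to a Poisson law that lives on short
  segments, and countably many discs cover all centres.\<close>

lemma AE_gibbs_short:
  assumes "short_segment_law Q R" "\<tau> > 0" "\<beta> \<ge> 0" "prob_space P" "sets P = sets config_space" "DLR \<tau> \<beta> Q P"
  shows "AE x in P. x \<subseteq> short_segments R"
proof -
  have "AE x in P. x \<inter> centred_in (cball 0 (real (Suc n))) \<subseteq> short_segments R" for n
  proof -
    obtain \<pi> where "gibbs_window Q R \<tau> \<beta> (cball 0 (real (Suc n))) P \<pi>"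
      using DLR_gibbs_window[OF assms, of "real (Suc n)"] by auto
    then show ?thesis by (rule gibbs_window.AE_P_inside_short)
  qed
  then have "AE x in P. \<forall>n. x \<inter> centred_in (cball 0 (real (Suc n))) \<subseteq> short_segments R"
    by (simp add: AE_all_countable)
  then show ?thesis
  proof eventually_elim
    fix x assume x: "\<forall>n. x \<inter> centred_in (cball 0 (real (Suc n))) \<subseteq> short_segments R"
    show "x \<subseteq> short_segments R"
    proof
      fix K assume "K \<in> x"
      obtain n where "norm (circumcentre K) \<le> real n" using real_arch_simple by blast
      then have "K \<in> x \<inter> centred_in (cball 0 (real (Suc n)))" using \<open>K \<in> x\<close> by (simp add: centred_in_def)
      then show "K \<in> short_segments R" using x by blast
    qed
  qed
qed

section \<open>The Stein identity for the innovation\<close>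

lemma infsum_eq_nn_integral_count_space:
  fixes f :: "'a \<Rightarrow> real"
  assumes fin: "finite {x\<in>X. f x \<noteq> 0}" and nonneg: "\<And>x. x \<in> X \<Longrightarrow> 0 \<le> f x"
  shows "(\<Sum>\<^sub>\<infinity>x\<in>X. f x) = enn2real (\<integral>\<^sup>+x. ennreal (f x) \<partial>count_space X)"
proof -
  let ?S = "{x\<in>X. f x \<noteq> 0}"
  have "(\<Sum>\<^sub>\<infinity>x\<in>X. f x) = (\<Sum>\<^sub>\<infinity>x\<in>?S. f x)" by (rule infsum_cong_neutral) auto
  also have "\<dots> = (\<Sum>x\<in>?S. f x)" using fin by simp
  finally have "(\<Sum>\<^sub>\<infinity>x\<in>X. f x) = (\<Sum>x\<in>?S. f x)" .
  moreover have "(\<integral>\<^sup>+x. ennreal (f x) \<partial>count_space X) = (\<Sum>x\<in>?S. ennreal (f x))"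
    using fin by (intro nn_integral_count_space') auto
  moreover have "\<dots> = ennreal (\<Sum>x\<in>?S. f x)" using nonneg by (intro sum_ennreal) auto
  moreover have "0 \<le> (\<Sum>x\<in>?S. f x)" using nonneg by (intro sum_nonneg) auto
  ultimately show ?thesis by simp
qed

text \<open>The mean value theorem for \<open>g\<close>, followed by the Lipschitz bound for
  \<open>g'\<close>; this simple route yields the constant \<open>B\<close> in place of
  \<open>B / 2\<close>.\<close>

lemma taylor2_bound:
  fixes g g' g'' :: "real \<Rightarrow> real"
  assumes d: "\<And>x. (g has_real_derivative g' x) (at x)" "\<And>x. (g' has_real_derivative g'' x) (at x)"
    and B: "\<And>x. \<bar>g'' x\<bar> \<le> B"
  shows "\<bar>g (x + h) - g x - g' x * h\<bar> \<le> B * h\<^sup>2"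
proof -
  have lip: "\<bar>g' y - g' x\<bar> \<le> B * \<bar>y - x\<bar>" for x y
    using field_differentiable_bound[of UNIV g' g'' B y x] d(2) B
    by (auto intro: has_field_derivative_at_within)
  have mvt: "\<exists>z. g (x + h) - g x = g' z * h \<and> \<bar>z - x\<bar> \<le> \<bar>h\<bar>"
  proof (cases h "0::real" rule: linorder_cases)
    case less
    obtain z where "x + h < z" "z < x" "g x - g (x + h) = (x - (x + h)) * g' z"
      using MVT2[of "x + h" x g g'] d(1) less by auto
    then show ?thesis by (intro exI[of _ z]) (auto simp: algebra_simps)
  next
    case greater
    obtain z where "x < z" "z < x + h" "g (x + h) - g x = (x + h - x) * g' z"
      using MVT2[of x "x + h" g g'] d(1) greater by auto
    then show ?thesis by (intro exI[of _ z]) (auto simp: algebra_simps)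
  qed auto
  then obtain z where z: "g (x + h) - g x = g' z * h" "\<bar>z - x\<bar> \<le> \<bar>h\<bar>" by blast
  have "\<bar>g (x + h) - g x - g' x * h\<bar> = \<bar>g' z - g' x\<bar> * \<bar>h\<bar>"
    unfolding z(1) by (simp add: abs_mult[symmetric] algebra_simps)
  also have "\<dots> \<le> (B * \<bar>h\<bar>) * \<bar>h\<bar>"
  proof (rule mult_right_mono)
    have "0 \<le> B" using B[of 0] by linarith
    then show "\<bar>g' z - g' x\<bar> \<le> B * \<bar>h\<bar>"
      using lip[of z x] z(2) by (meson mult_left_mono order_trans)
  qed simp
  also have "\<dots> = B * h\<^sup>2" by (simp add: power2_eq_square)
  finally show ?thesis .
qed

text \<open>The radius is composed of \<open>\<rho>\<close> for the support of
  \<open>\<phi>\<close>, \<open>2 * R\<close> for the particles that can hit such a segment, and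
  another \<open>2 * R\<close> so that those particles in turn are hit only from inside the window
  and the GNZ equation covers them.\<close>

locale gibbs_innovation = gibbs_window Q R \<tau> \<beta> "cball 0 (\<rho> + 4 * R)" P \<pi>
  for Q R \<tau> \<beta> \<rho> P \<pi> +
  fixes \<phi> :: "particle \<Rightarrow> real" and b :: real
  assumes \<rho>: "\<rho> \<ge> 0" and b: "b \<ge> 0"
    and short_P: "AE x in P. x \<subseteq> short_segments R"
    and \<phi>_measurable: "(\<lambda>K. indicator segments K * \<phi> K) \<in> borel_measurable borel"
    and \<phi>_nonneg: "\<And>K. 0 \<le> \<phi> K"
    and \<phi>_finite: "\<And>x. locally_finite x \<Longrightarrow> finite {K\<in>x \<inter> segments. \<phi> K \<noteq> 0}"
    and \<phi>_le: "\<And>K. K \<in> short_segments R \<Longrightarrow> \<phi> K \<le> b"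
    and \<phi>_support: "\<And>K. K \<in> short_segments R \<Longrightarrow> \<phi> K \<noteq> 0 \<Longrightarrow> norm (circumcentre K) \<le> \<rho>"
begin

abbreviation "\<Delta> \<equiv> cball (0::real^2) (\<rho> + 4 * R)"

text \<open>Unlike \<open>\<phi>\<close>, the truncated function is bounded by \<open>b\<close> and
  supported near the origin without exceptions. Neither the reference measure nor, almost surely,
  the process sees the difference.\<close>

definition "w K = indicator (short_segments R) K * \<phi> K"
definition "l K y = cond_intensity \<tau> \<beta> K y"
definition "F x = innovation \<tau> \<beta> Q \<phi> x"
definition "N x = enn2real (\<integral>\<^sup>+K. ennreal (w K) \<partial>count_space x)"
definition "A x = (\<integral>K. w K * l K x \<partial>\<mu>)"
definition "S1 = (\<integral>K. w K \<partial>\<mu>)"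
definition "S2 = (\<integral>K. (w K)\<^sup>2 \<partial>\<mu>)"

lemma w_measurable [measurable]: "w \<in> borel_measurable borel"
proof -
  have "w = (\<lambda>K. indicator (short_segments R) K * (indicator segments K * \<phi> K))"
    by (auto simp: w_def fun_eq_iff short_segments_def split: split_indicator)
  then show ?thesis using \<phi>_measurable by simp
qed

lemma w_nonneg: "0 \<le> w K" using \<phi>_nonneg by (simp add: w_def)
lemma w_le: "w K \<le> b" using \<phi>_le b by (auto simp: w_def split: split_indicator)
lemma w_support: "w K \<noteq> 0 \<Longrightarrow> K \<in> short_segments R \<and> norm (circumcentre K) \<le> \<rho>"
  using \<phi>_support by (auto simp: w_def split: split_indicator_asm)

lemma w_centred: "w K \<noteq> 0 \<Longrightarrow> K \<in> centred_in \<Delta>"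
  using w_support[of K] R_pos by (simp add: centred_in_def)

lemma l_pos: "0 < l K y" using \<tau>_pos by (simp add: l_def cond_intensity_def)
lemma l_nonneg: "0 \<le> l K y" using l_pos by (rule less_imp_le)
lemma l_le: "l K y \<le> \<tau>"
  using \<tau>_pos \<beta>_nonneg by (simp add: l_def cond_intensity_def mult_le_cancel_left1)

lemma l_measurable_K: "y \<in> space config_space \<Longrightarrow> (\<lambda>K. l K y) \<in> borel_measurable borel"
  unfolding l_def by (rule measurable_cond_intensity) auto

lemma l_measurable_pair: "(\<lambda>p. l (fst p) (snd p)) \<in> borel_measurable (borel \<Otimes>\<^sub>M config_space)"
  unfolding l_def by (rule measurable_cond_intensity) auto

lemma integrable_\<mu>_bounded:
  assumes "f \<in> borel_measurable borel" "\<And>K. \<bar>f K\<bar> \<le> B"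
  shows "integrable \<mu> (f :: particle \<Rightarrow> real)"
  using assms by (intro \<mu>.integrable_const_bound[of _ B]) auto

lemma w_integrable: "integrable \<mu> w"
  using w_nonneg w_le by (intro integrable_\<mu>_bounded[of _ b]) auto

lemma w2_integrable: "integrable \<mu> (\<lambda>K. (w K)\<^sup>2)"
  using w_nonneg w_le by (intro integrable_\<mu>_bounded[of _ "b\<^sup>2"]) (auto intro: power_mono)

lemma integrable_w_mult:
  assumes [measurable]: "f \<in> borel_measurable borel" and f: "\<And>K. \<bar>f K\<bar> \<le> B"
  shows "integrable \<mu> (\<lambda>K. w K * f K)"
proof (rule integrable_\<mu>_bounded[of _ "b * B"])
  show "\<bar>w K * f K\<bar> \<le> b * B" for K
    using mult_mono[OF w_le[of K] f[of K] b abs_ge_zero] w_nonneg[of K] by (simp add: abs_mult)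
qed measurable

lemma S1_nonneg: "0 \<le> S1" and S2_nonneg: "0 \<le> S2"
  unfolding S1_def S2_def using w_nonneg by (auto intro: integral_nonneg_AE)

lemma w_l_integrable: "y \<in> space config_space \<Longrightarrow> integrable \<mu> (\<lambda>K. w K * l K y)"
  using l_measurable_K[of y] l_nonneg l_le by (intro integrable_w_mult[of _ \<tau>]) auto

lemma A_nonneg: "0 \<le> A y"
  unfolding A_def using w_nonneg l_nonneg by (intro integral_nonneg_AE) auto

lemma A_le: "y \<in> space config_space \<Longrightarrow> A y \<le> \<tau> * S1"
proof -
  assume y: "y \<in> space config_space"
  have "A y \<le> (\<integral>K. w K * \<tau> \<partial>\<mu>)"
    unfolding A_def using w_nonneg l_le w_integrable
    by (intro integral_mono w_l_integrable y mult_left_mono) auto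
  then show ?thesis by (simp add: S1_def mult.commute)
qed

lemma A_measurable [measurable]: "A \<in> borel_measurable config_space"
proof -
  have "(\<lambda>p. (snd p, fst p)) \<in> measurable (config_space \<Otimes>\<^sub>M \<mu>) (borel \<Otimes>\<^sub>M config_space)" by measurable
  from measurable_compose[OF this l_measurable_pair]
  have "(\<lambda>(x, K). w K * l K x) \<in> borel_measurable (config_space \<Otimes>\<^sub>M \<mu>)" by (simp add: case_prod_unfold)
  then show ?thesis unfolding A_def by (rule \<mu>.borel_measurable_lebesgue_integral)
qed

lemma N_measurable [measurable]: "N \<in> borel_measurable config_space"
proof -
  have [measurable]: "(\<lambda>x. \<integral>\<^sup>+K. ennreal (w K) \<partial>count_space x) \<in> borel_measurable config_space"
    by (rule measurable_config_sum) measurable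
  show ?thesis unfolding N_def by measurable
qed

lemma innovation_integral:
  assumes x: "locally_finite x"
  shows "(LINT K:segments|ref. \<phi> K * cond_intensity \<tau> \<beta> K x) = A x"
proof -
  have x': "x \<in> space config_space" using x by (simp add: space_config_space)
  have m [measurable]: "(\<lambda>K. w K * l K x) \<in> borel_measurable borel"
    using l_measurable_K[OF x'] by measurable
  have m': "(\<lambda>K. (indicator segments K * \<phi> K) * l K x) \<in> borel_measurable borel"
    using l_measurable_K[OF x'] \<phi>_measurable by measurable
  have "(LINT K:segments|ref. \<phi> K * cond_intensity \<tau> \<beta> K x) = (\<integral>K. (indicator segments K * \<phi> K) * l K x \<partial>ref)"
    by (simp add: set_lebesgue_integral_def l_def mult.assoc)
  also have "\<dots> = (\<integral>K. w K * l K x \<partial>ref)"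
  proof (rule integral_cong_AE)
    show "AE K in ref. indicator segments K * \<phi> K * l K x = w K * l K x"
      using AE_ref_short by eventually_elim (auto simp: w_def short_segments_def)
  qed (use m m' in auto)
  also have "\<dots> = (\<integral>K. indicator (centred_in \<Delta>) K *\<^sub>R (w K * l K x) \<partial>ref)"
    using w_support R_pos by (intro Bochner_Integration.integral_cong) (force simp: centred_in_def split: split_indicator)+
  also have "\<dots> = A x"
    unfolding A_def \<mu>_def using \<Delta>(1)
    by (subst integral_density[symmetric]) (auto simp: ennreal_indicator)
  finally show ?thesis .
qed

text \<open>This form admits configurations with long segments; they form a null set, but
  measurability of \<open>F\<close> concerns every configuration.\<close>

lemma F_eq_general:
  assumes x: "locally_finite x"
  shows "F x = enn2real (\<integral>\<^sup>+K. ennreal (indicator segments K * \<phi> K) \<partial>count_space x) - A x"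
proof -
  have "(\<Sum>\<^sub>\<infinity>K\<in>x \<inter> segments. \<phi> K) = enn2real (\<integral>\<^sup>+K. ennreal (\<phi> K) \<partial>count_space (x \<inter> segments))"
    using \<phi>_finite[OF x] \<phi>_nonneg by (intro infsum_eq_nn_integral_count_space) auto
  also have "(\<integral>\<^sup>+K. ennreal (\<phi> K) \<partial>count_space (x \<inter> segments)) =
      (\<integral>\<^sup>+K. ennreal (indicator segments K * \<phi> K) \<partial>count_space x)"
    unfolding nn_integral_count_space_UNIV[of "x \<inter> segments"] nn_integral_count_space_UNIV[of x]
    by (intro nn_integral_cong) (auto split: split_indicator)
  finally show ?thesis unfolding F_def innovation_def by (simp add: innovation_integral[OF x])
qed

lemma F_measurable [measurable]: "F \<in> borel_measurable config_space"
proof -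
  have [measurable]: "(\<lambda>x. \<integral>\<^sup>+K. ennreal (indicator segments K * \<phi> K) \<partial>count_space x) \<in> borel_measurable config_space"
    by (rule measurable_config_sum) (use \<phi>_measurable in measurable)
  have "(\<lambda>x. enn2real (\<integral>\<^sup>+K. ennreal (indicator segments K * \<phi> K) \<partial>count_space x) - A x) \<in> borel_measurable config_space"
    by measurable
  then show ?thesis
    by (subst measurable_cong[OF F_eq_general]) (auto simp: space_config_space)
qed

lemma F_eq:
  assumes x: "locally_finite x" "x \<subseteq> short_segments R"
  shows "F x = N x - A x"
proof -
  have "(\<integral>\<^sup>+K. ennreal (indicator segments K * \<phi> K) \<partial>count_space x) = (\<integral>\<^sup>+K. ennreal (w K) \<partial>count_space x)"
    using x(2) by (intro nn_integral_cong) (auto simp: w_def short_segments_def split: split_indicator)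
  then show ?thesis by (simp add: F_eq_general[OF x(1)] N_def)
qed

lemma w_finite: "locally_finite x \<Longrightarrow> finite {K\<in>x. w K \<noteq> 0}"
  using \<phi>_finite[of x] by (rule finite_subset[rotated])
    (auto simp: w_def short_segments_def split: split_indicator_asm)

text \<open>The sum involves only particles centred within \<open>\<rho>\<close>; the compensator
  depends only on particles hitting a short segment centred there, so within
  \<open>\<rho> + 2 * R\<close>.\<close>

lemma F_inside:
  assumes x: "locally_finite x" "x \<subseteq> short_segments R"
  shows "F (x \<inter> centred_in \<Delta>) = F x"
proof -
  have "N (x \<inter> centred_in \<Delta>) = N x"
    unfolding N_def nn_integral_count_space_UNIV[of "x \<inter> centred_in \<Delta>"] nn_integral_count_space_UNIV[of x]
  proof (intro arg_cong[of _ _ enn2real] nn_integral_cong)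
    fix K show "ennreal (w K) * indicator (x \<inter> centred_in \<Delta>) K = ennreal (w K) * indicator x K"
      using w_centred[of K] by (cases "w K = 0") (auto split: split_indicator)
  qed
  moreover have "A (x \<inter> centred_in \<Delta>) = A x"
    unfolding A_def
  proof (intro Bochner_Integration.integral_cong refl)
    fix K
    show "w K * l K (x \<inter> centred_in \<Delta>) = w K * l K x"
    proof (cases "w K = 0")
      case False
      have "L \<in> centred_in \<Delta>" if "L \<in> x" "hit K L" for L
      proof -
        have "norm (circumcentre L) \<le> norm (circumcentre K) + dist (circumcentre K) (circumcentre L)"
          by (metis dist_0_norm dist_triangle)
        also have "\<dots> \<le> \<rho> + 2 * R"
          using hit_short_dist_le[of K R L] that x(2) w_support[OF False] by (intro add_mono) auto
        finally show ?thesis using R_pos by (simp add: centred_in_def)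
      qed
      then have "{L \<in> x \<inter> centred_in \<Delta>. hit K L} = {L \<in> x. hit K L}" by auto
      then show ?thesis by (simp add: l_def cond_intensity_def)
    qed simp
  qed
  ultimately show ?thesis
    using F_eq[OF x] F_eq[of "x \<inter> centred_in \<Delta>"] x locally_finite_subset[OF x(1), of "x \<inter> centred_in \<Delta>"] by auto
qed

sublocale P_in: prob_space P_in
  unfolding P_in_def by (rule P.prob_space_distr[OF measurable_inside])

lemma sets_P_in [simp, measurable_cong]: "sets P_in = sets config_space"
  and space_P_in: "space P_in = space config_space"
  by (simp_all add: P_in_def)

lemma AE_F_inside: "AE x in P. F (x \<inter> centred_in \<Delta>) = F x"
  using short_P AE_space by eventually_elim (auto simp: space_P intro: F_inside)

lemma integral_P_F:
  fixes h :: "real \<Rightarrow> real"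
  assumes [measurable]: "h \<in> borel_measurable borel"
  shows "(\<integral>x. h (F x) \<partial>P) = (\<integral>y. h (F y) \<partial>P_in)"
proof -
  have "(\<integral>y. h (F y) \<partial>P_in) = (\<integral>x. h (F (x \<inter> centred_in \<Delta>)) \<partial>P)"
    unfolding P_in_def by (rule integral_distr[OF measurable_inside]) simp
  also have "\<dots> = (\<integral>x. h (F x) \<partial>P)"
  proof (rule integral_cong_AE)
    show "(\<lambda>x. h (F x)) \<in> borel_measurable P"
      using measurable_compose[OF F_measurable assms] by (simp add: measurable_cong_sets[OF sets_P refl])
    show "(\<lambda>x. h (F (x \<inter> centred_in \<Delta>))) \<in> borel_measurable P" by measurable
    show "AE x in P. h (F (x \<inter> centred_in \<Delta>)) = h (F x)"
      using AE_F_inside by eventually_elim simp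
  qed
  finally show ?thesis by simp
qed

section \<open>The GNZ equation in the window and the Stein identity\<close>

definition "D r = {K\<in>short_segments R. norm (circumcentre K) \<le> r}"

lemma GNZ_D:
  assumes r: "r \<le> \<rho> + 2 * R" and f: "f \<in> borel_measurable (borel \<Otimes>\<^sub>M config_space)" "\<And>K y. K \<notin> D r \<Longrightarrow> f (K, y) = 0"
  shows "(\<integral>\<^sup>+y. \<integral>\<^sup>+K. f (K, y - {K}) \<partial>count_space y \<partial>P_in) =
    (\<integral>\<^sup>+y. \<integral>\<^sup>+K. f (K, y) * ennreal (l K y) \<partial>\<mu> \<partial>P_in)"
proof -
  have "(\<integral>\<^sup>+y. \<integral>\<^sup>+K. f (K, y - {K}) \<partial>count_space y \<partial>P_in) =
    (\<integral>\<^sup>+y. \<integral>\<^sup>+K. f (K, y) * ennreal (l K y) \<partial>ref \<partial>P_in)"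
    unfolding l_def
  proof (rule GNZ[OF short_P _ _ f])
    fix K assume K: "K \<in> D r"
    show "cball (circumcentre K) (2 * R) \<subseteq> cball 0 (\<rho> + 4 * R)"
      using K r by (auto simp: D_def cball_subset_cball_iff)
  qed (auto simp: D_def)
  also have "\<dots> = (\<integral>\<^sup>+y. \<integral>\<^sup>+K. f (K, y) * ennreal (l K y) \<partial>\<mu> \<partial>P_in)"
  proof (rule nn_integral_cong)
    fix y assume "y \<in> space P_in"
    then have ym: "(\<lambda>K. (K, y)) \<in> measurable borel (borel \<Otimes>\<^sub>M config_space)"
      by (intro measurable_Pair) (auto simp: space_P_in)
    have mm: "(\<lambda>K. f (K, y) * ennreal (l K y)) \<in> borel_measurable borel"
      using measurable_compose[OF ym f(1)] measurable_compose[OF ym l_measurable_pair] by simp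
    show "(\<integral>\<^sup>+K. f (K, y) * ennreal (l K y) \<partial>ref) = (\<integral>\<^sup>+K. f (K, y) * ennreal (l K y) \<partial>\<mu>)"
      unfolding nn_integral_\<mu>[OF mm]
      by (intro nn_integral_cong) (use f(2) r R_pos in \<open>force simp: centred_in_def D_def split: split_indicator\<close>)
  qed
  finally show ?thesis .
qed

lemma F_insert_measurable: "(\<lambda>p. F (insert (fst p) (snd p))) \<in> borel_measurable (borel \<Otimes>\<^sub>M config_space)"
  by (rule measurable_compose[OF measurable_config_insert F_measurable]) auto

lemma inner_integrable:
  assumes [measurable]: "g \<in> borel_measurable borel" and g: "\<And>x. \<bar>g x\<bar> \<le> B" and y: "y \<in> space config_space"
  shows "integrable \<mu> (\<lambda>K. w K * (l K y * g (F (insert K y))))"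
proof (rule integrable_w_mult)
  have ym: "(\<lambda>K. (K, y)) \<in> measurable borel (borel \<Otimes>\<^sub>M config_space)" using y by simp
  show "(\<lambda>K. l K y * g (F (insert K y))) \<in> borel_measurable borel"
    using measurable_compose[OF ym F_insert_measurable] l_measurable_K[OF y] by simp
  show "\<bar>l K y * g (F (insert K y))\<bar> \<le> \<tau> * B" for K
    using mult_mono[OF l_le[of K y] g[of "F (insert K y)"]] l_nonneg \<tau>_pos by (simp add: abs_mult)
qed

lemma outer_measurable:
  assumes [measurable]: "g \<in> borel_measurable borel"
  shows "(\<lambda>y. \<integral>K. w K * (l K y * g (F (insert K y))) \<partial>\<mu>) \<in> borel_measurable config_space"
proof (rule \<mu>.borel_measurable_lebesgue_integral)
  have sw: "(\<lambda>p. (snd p, fst p)) \<in> measurable (config_space \<Otimes>\<^sub>M \<mu>) (borel \<Otimes>\<^sub>M config_space)" by measurable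
  show "(\<lambda>(y, K). w K * (l K y * g (F (insert K y)))) \<in> borel_measurable (config_space \<Otimes>\<^sub>M \<mu>)"
    using measurable_compose[OF sw l_measurable_pair] measurable_compose[OF sw F_insert_measurable]
    by (simp add: case_prod_unfold)
qed

lemma w_l_bound:
  assumes g: "\<And>x. \<bar>g x\<bar> \<le> B" and y: "y \<in> space config_space" and m: "g \<in> borel_measurable borel"
  shows "\<bar>\<integral>K. w K * (l K y * g (F (insert K y))) \<partial>\<mu>\<bar> \<le> \<tau> * B * S1"
proof -
  have "\<bar>\<integral>K. w K * (l K y * g (F (insert K y))) \<partial>\<mu>\<bar> \<le> (\<integral>K. \<bar>w K * (l K y * g (F (insert K y)))\<bar> \<partial>\<mu>)"
    by (rule integral_abs_bound)
  also have "\<dots> \<le> (\<integral>K. w K * (\<tau> * B) \<partial>\<mu>)"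
  proof (rule integral_mono)
    show "integrable \<mu> (\<lambda>K. \<bar>w K * (l K y * g (F (insert K y)))\<bar>)"
      using inner_integrable[OF m g y] by (rule integrable_abs)
    show "integrable \<mu> (\<lambda>K. w K * (\<tau> * B))" using w_integrable by simp
    show "\<bar>w K * (l K y * g (F (insert K y)))\<bar> \<le> w K * (\<tau> * B)" for K
      using mult_mono[OF l_le[of K y] g[of "F (insert K y)"]] l_nonneg[of K y] w_nonneg[of K] \<tau>_pos
      by (simp add: abs_mult mult_left_mono)
  qed
  also have "\<dots> = \<tau> * B * S1" by (simp add: S1_def mult_ac)
  finally show ?thesis .
qed

lemma N_mult_eq:
  assumes y: "locally_finite y" and c: "0 \<le> c"
  shows "ennreal (N y * c) = (\<integral>\<^sup>+K. ennreal (w K * c) \<partial>count_space y)"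
proof -
  let ?S = "{K\<in>y. w K \<noteq> 0}"
  have s: "(\<integral>\<^sup>+K. ennreal (w K * c) \<partial>count_space y) = ennreal ((\<Sum>K\<in>?S. w K) * c)" if "0 \<le> c" for c
  proof -
    have "(\<integral>\<^sup>+K. ennreal (w K * c) \<partial>count_space y) = (\<Sum>K\<in>?S. ennreal (w K * c))"
      using w_finite[OF y] by (intro nn_integral_count_space') auto
    also have "\<dots> = ennreal (\<Sum>K\<in>?S. w K * c)" using w_nonneg that by (intro sum_ennreal) simp
    finally show ?thesis by (simp add: sum_distrib_right)
  qed
  have "N y = (\<Sum>K\<in>?S. w K)" unfolding N_def using s[of 1] w_nonneg by (simp add: sum_nonneg)
  then show ?thesis using s[OF c] by simp
qed

text \<open>The GNZ equation for \<open>w K * g (F (insert K y))\<close>: at a point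
  \<open>K\<close> of \<open>y\<close>, with \<open>y - {K}\<close> in place of \<open>y\<close>,
  the inserted configuration is \<open>y\<close>, so \<open>g (F y)\<close> factors out of the sum.
  As the right-hand side is finite, integrability of the left-hand side comes along.\<close>

lemma GNZ_N_nonneg:
  assumes g: "g \<in> borel_measurable borel" "\<And>x. 0 \<le> g x" "\<And>x. g x \<le> B"
  shows "integrable P_in (\<lambda>y. N y * g (F y))"
    and "(\<integral>y. N y * g (F y) \<partial>P_in) = (\<integral>y. \<integral>K. w K * (l K y * g (F (insert K y))) \<partial>\<mu> \<partial>P_in)"
proof -
  have gB: "\<bar>g x\<bar> \<le> B" for x using g by simp
  let ?H = "\<lambda>y. \<integral>K. w K * (l K y * g (F (insert K y))) \<partial>\<mu>"
  have H0: "0 \<le> ?H y" for y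
    using w_nonneg l_nonneg g(2) by (intro integral_nonneg_AE) auto
  have Hint: "integrable P_in ?H"
    using w_l_bound[OF gB _ g(1)] outer_measurable[OF g(1)]
    by (intro P_in.integrable_const_bound[of _ "\<tau> * B * S1"] AE_I2) (auto simp: space_P_in)
  have mf: "(\<lambda>p. ennreal (w (fst p) * g (F (insert (fst p) (snd p))))) \<in> borel_measurable (borel \<Otimes>\<^sub>M config_space)"
    using F_insert_measurable g(1) by measurable
  have "(\<integral>\<^sup>+y. ennreal (N y * g (F y)) \<partial>P_in) = (\<integral>\<^sup>+y. \<integral>\<^sup>+K. ennreal (w K * g (F (insert K (y - {K})))) \<partial>count_space y \<partial>P_in)"
  proof (rule nn_integral_cong)
    fix y assume "y \<in> space P_in"
    then have y: "locally_finite y" by (simp add: space_P_in space_config_space)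
    show "ennreal (N y * g (F y)) = (\<integral>\<^sup>+K. ennreal (w K * g (F (insert K (y - {K})))) \<partial>count_space y)"
      unfolding N_mult_eq[OF y g(2)] by (intro nn_integral_cong) (simp add: insert_absorb)
  qed
  also have "\<dots> = (\<integral>\<^sup>+y. \<integral>\<^sup>+K. ennreal (w K * g (F (insert K y))) * ennreal (l K y) \<partial>\<mu> \<partial>P_in)"
    using GNZ_D[OF _ mf, of \<rho>] w_support R_pos by (force simp: D_def)
  also have "\<dots> = (\<integral>\<^sup>+y. ennreal (?H y) \<partial>P_in)"
  proof (rule nn_integral_cong)
    fix y assume "y \<in> space P_in"
    then have y: "y \<in> space config_space" by (simp add: space_P_in)
    have "(\<integral>\<^sup>+K. ennreal (w K * g (F (insert K y))) * ennreal (l K y) \<partial>\<mu>) = (\<integral>\<^sup>+K. ennreal (w K * (l K y * g (F (insert K y)))) \<partial>\<mu>)"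
      using w_nonneg g(2) l_nonneg by (intro nn_integral_cong) (simp add: mult_ac flip: ennreal_mult)
    also have "\<dots> = ennreal (?H y)"
      using inner_integrable[OF g(1) gB y] w_nonneg g(2) l_nonneg by (intro nn_integral_eq_integral) auto
    finally show "(\<integral>\<^sup>+K. ennreal (w K * g (F (insert K y))) * ennreal (l K y) \<partial>\<mu>) = ennreal (?H y)" .
  qed
  also have "\<dots> = ennreal (\<integral>y. ?H y \<partial>P_in)"
    using Hint H0 by (intro nn_integral_eq_integral) auto
  finally have eq: "(\<integral>\<^sup>+y. ennreal (N y * g (F y)) \<partial>P_in) = ennreal (\<integral>y. ?H y \<partial>P_in)" .
  have nn: "0 \<le> N y * g (F y)" for y using g(2) by (simp add: N_def)
  have ms: "(\<lambda>y. N y * g (F y)) \<in> borel_measurable P_in" using g(1) by measurable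
  show "integrable P_in (\<lambda>y. N y * g (F y))"
    using eq nn ms by (intro integrableI_nonneg) auto
  have "0 \<le> (\<integral>y. ?H y \<partial>P_in)" using H0 by (intro integral_nonneg_AE) auto
  then show "(\<integral>y. N y * g (F y) \<partial>P_in) = (\<integral>y. ?H y \<partial>P_in)"
    using eq nn ms by (subst integral_eq_nn_integral) auto
qed

lemma GNZ_N:
  assumes g: "g \<in> borel_measurable borel" "\<And>x. \<bar>g x\<bar> \<le> B"
  shows "integrable P_in (\<lambda>y. N y * g (F y))"
    and "(\<integral>y. N y * g (F y) \<partial>P_in) = (\<integral>y. \<integral>K. w K * (l K y * g (F (insert K y))) \<partial>\<mu> \<partial>P_in)"
proof -
  have B: "0 \<le> B" using g(2)[of 0] by linarith
  \<comment> \<open>The GNZ equation concerns nonnegative functions, so the bounded \<open>g\<close>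
    is shifted by \<open>B\<close>, and the constant function \<open>B\<close> is subtracted by
    means of the same lemma.\<close>
  define g1 where "g1 x = g x + B" for x
  have g1: "g1 \<in> borel_measurable borel" "0 \<le> g1 x" "g1 x \<le> 2 * B" for x
    using g unfolding g1_def by (auto simp: abs_le_iff) (smt (verit) g(2))
  note 1 = GNZ_N_nonneg[OF g1]
  have 2: "integrable P_in (\<lambda>y. N y * B)"
    "(\<integral>y. N y * B \<partial>P_in) = (\<integral>y. \<integral>K. w K * (l K y * B) \<partial>\<mu> \<partial>P_in)"
    by (rule GNZ_N_nonneg[of "\<lambda>_. B" B]; use B in simp)+
  have sub: "N y * g (F y) = N y * g1 (F y) - N y * B" for y by (simp add: g1_def algebra_simps)
  show "integrable P_in (\<lambda>y. N y * g (F y))"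
    unfolding sub using 1(1) 2(1) by (rule Bochner_Integration.integrable_diff)
  have gB: "\<bar>g1 x\<bar> \<le> 2 * B" for x using g1 by simp
  have cB: "\<bar>B\<bar> \<le> B" using B by simp
  have Hint: "integrable P_in (\<lambda>y. \<integral>K. w K * (l K y * g1 (F (insert K y))) \<partial>\<mu>)"
    using w_l_bound[OF gB _ g1(1)] outer_measurable[OF g1(1)]
    by (intro P_in.integrable_const_bound[of _ "\<tau> * (2 * B) * S1"] AE_I2) (auto simp: space_P_in)
  have Hint2: "integrable P_in (\<lambda>y. \<integral>K. w K * (l K y * B) \<partial>\<mu>)"
    using w_l_bound[of "\<lambda>_. B" B] outer_measurable[of "\<lambda>_. B"] B
    by (intro P_in.integrable_const_bound[of _ "\<tau> * B * S1"] AE_I2) (auto simp: space_P_in)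
  have "(\<integral>y. N y * g (F y) \<partial>P_in) = (\<integral>y. N y * g1 (F y) \<partial>P_in) - (\<integral>y. N y * B \<partial>P_in)"
    unfolding sub using 1(1) 2(1) by (rule Bochner_Integration.integral_diff)
  also have "\<dots> = (\<integral>y. (\<integral>K. w K * (l K y * g1 (F (insert K y))) \<partial>\<mu>) - (\<integral>K. w K * (l K y * B) \<partial>\<mu>) \<partial>P_in)"
    unfolding 1(2) 2(2) using Hint Hint2 by (rule Bochner_Integration.integral_diff[symmetric])
  also have "\<dots> = (\<integral>y. \<integral>K. w K * (l K y * g (F (insert K y))) \<partial>\<mu> \<partial>P_in)"
  proof (rule Bochner_Integration.integral_cong[OF refl])
    fix y assume "y \<in> space P_in"
    then have y: "y \<in> space config_space" by (simp add: space_P_in)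
    show "(\<integral>K. w K * (l K y * g1 (F (insert K y))) \<partial>\<mu>) - (\<integral>K. w K * (l K y * B) \<partial>\<mu>) = (\<integral>K. w K * (l K y * g (F (insert K y))) \<partial>\<mu>)"
      using inner_integrable[OF g1(1) gB y] inner_integrable[of "\<lambda>_. B", OF _ cB y]
      by (subst Bochner_Integration.integral_diff[symmetric]) (auto simp: g1_def algebra_simps)
  qed
  finally show "(\<integral>y. N y * g (F y) \<partial>P_in) = (\<integral>y. \<integral>K. w K * (l K y * g (F (insert K y))) \<partial>\<mu> \<partial>P_in)" .
qed

definition "J g y = (\<integral>K. w K * l K y * (g (F (insert K y)) - g (F y)) \<partial>\<mu>)"

lemma J_integrable_inner:
  assumes g: "g \<in> borel_measurable borel" "\<And>x. \<bar>g x\<bar> \<le> B" and y: "y \<in> space config_space"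
  shows "integrable \<mu> (\<lambda>K. w K * l K y * (g (F (insert K y)) - g (F y)))"
  using Bochner_Integration.integrable_diff[OF inner_integrable[OF g y] integrable_mult_left[OF w_l_integrable[OF y], of "g (F y)"]]
  by (simp add: algebra_simps)

lemma J_eq:
  assumes g: "g \<in> borel_measurable borel" "\<And>x. \<bar>g x\<bar> \<le> B" and y: "y \<in> space config_space"
  shows "J g y = (\<integral>K. w K * (l K y * g (F (insert K y))) \<partial>\<mu>) - A y * g (F y)"
proof -
  have i: "integrable \<mu> (\<lambda>K. w K * l K y * g (F y))"
    using w_l_integrable[OF y] by simp
  have "J g y = (\<integral>K. w K * (l K y * g (F (insert K y))) - w K * l K y * g (F y) \<partial>\<mu>)"
    unfolding J_def by (intro Bochner_Integration.integral_cong) (simp_all add: algebra_simps)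
  also have "\<dots> = (\<integral>K. w K * (l K y * g (F (insert K y))) \<partial>\<mu>) - (\<integral>K. w K * l K y * g (F y) \<partial>\<mu>)"
    by (rule Bochner_Integration.integral_diff[OF inner_integrable[OF g y] i])
  finally show ?thesis by (simp add: A_def)
qed

text \<open>In \<open>F = N - A\<close> the sum is handled by the GNZ equation, which evaluates
  \<open>g\<close> after inserting \<open>K\<close>, while the compensator contributes the same
  integral with \<open>g\<close> evaluated before; the difference is \<open>J\<close>.\<close>

lemma stein_identity:
  assumes g: "g \<in> borel_measurable borel" "\<And>x. \<bar>g x\<bar> \<le> B"
  shows "integrable P_in (\<lambda>y. F y * g (F y))" and "integrable P_in (J g)"
    and "(\<integral>y. F y * g (F y) \<partial>P_in) = (\<integral>y. J g y \<partial>P_in)"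
proof -
  have Ag: "integrable P_in (\<lambda>y. A y * g (F y))"
  proof (rule P_in.integrable_const_bound[of _ "(\<tau> * S1) * B"])
    show "AE y in P_in. norm (A y * g (F y)) \<le> \<tau> * S1 * B"
    proof (rule AE_I2)
      fix y assume "y \<in> space P_in"
      then have "A y \<le> \<tau> * S1" using A_le by (simp add: space_P_in)
      then show "norm (A y * g (F y)) \<le> \<tau> * S1 * B"
        using mult_mono[of "A y" "\<tau> * S1" "\<bar>g (F y)\<bar>" B] A_nonneg[of y] g(2) by (simp add: abs_mult)
    qed
  qed (use g(1) in measurable)
  have AE_eq: "AE y in P_in. F y * g (F y) = N y * g (F y) - A y * g (F y)"
    using AE_P_in_good
    by eventually_elim (auto simp: F_eq locally_finite_finite algebra_simps)
  have int: "integrable P_in (\<lambda>y. N y * g (F y) - A y * g (F y))"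
    using GNZ_N(1)[OF g] Ag by (rule Bochner_Integration.integrable_diff)
  have m: "(\<lambda>y. F y * g (F y)) \<in> borel_measurable P_in" using g(1) by measurable
  show "integrable P_in (\<lambda>y. F y * g (F y))"
    using integrable_cong_AE[OF m _ AE_eq] int by simp
  have Hint: "integrable P_in (\<lambda>y. \<integral>K. w K * (l K y * g (F (insert K y))) \<partial>\<mu>)"
    using w_l_bound[OF g(2) _ g(1)] outer_measurable[OF g(1)]
    by (intro P_in.integrable_const_bound[of _ "\<tau> * B * S1"] AE_I2) (auto simp: space_P_in)
  have Jc: "J g y = (\<integral>K. w K * (l K y * g (F (insert K y))) \<partial>\<mu>) - A y * g (F y)" if "y \<in> space P_in" for y
    using that J_eq[OF g] by (simp add: space_P_in)
  have iJ: "integrable P_in (\<lambda>y. (\<integral>K. w K * (l K y * g (F (insert K y))) \<partial>\<mu>) - A y * g (F y))"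
    using Hint Ag by (rule Bochner_Integration.integrable_diff)
  show "integrable P_in (J g)"
    by (subst Bochner_Integration.integrable_cong[OF refl Jc]) (auto intro: iJ)
  have "(\<integral>y. F y * g (F y) \<partial>P_in) = (\<integral>y. N y * g (F y) - A y * g (F y) \<partial>P_in)"
    using m int AE_eq by (intro integral_cong_AE) auto
  also have "\<dots> = (\<integral>y. \<integral>K. w K * (l K y * g (F (insert K y))) \<partial>\<mu> \<partial>P_in) - (\<integral>y. A y * g (F y) \<partial>P_in)"
    using GNZ_N[OF g] Ag by simp
  also have "\<dots> = (\<integral>y. (\<integral>K. w K * (l K y * g (F (insert K y))) \<partial>\<mu>) - A y * g (F y) \<partial>P_in)"
    using Hint Ag by simp
  also have "\<dots> = (\<integral>y. J g y \<partial>P_in)"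
    by (intro Bochner_Integration.integral_cong refl Jc[symmetric])
  finally show "(\<integral>y. F y * g (F y) \<partial>P_in) = (\<integral>y. J g y \<partial>P_in)" .
qed

end

section \<open>Effect of one added particle, moment bounds and the Stein estimate\<close>

context gibbs_innovation
begin

lemma l_insert:
  assumes "finite y" "K \<notin> y"
  shows "l L (insert K y) = l L y * exp (- \<beta> * of_bool (hit L K))"
proof (cases "hit L K")
  case True
  then have "{M \<in> insert K y. hit L M} = insert K {M \<in> y. hit L M}" by auto
  then have "card {M \<in> insert K y. hit L M} = Suc (card {M \<in> y. hit L M})" using assms by simp
  then show ?thesis using True by (simp add: l_def cond_intensity_def algebra_simps exp_diff exp_minus divide_simps)
next
  case False
  then have "{M \<in> insert K y. hit L M} = {M \<in> y. hit L M}" by auto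
  then show ?thesis using False by (simp add: l_def cond_intensity_def)
qed

lemma N_finite: "finite y \<Longrightarrow> N y = (\<Sum>K\<in>y. w K)"
  using w_nonneg by (simp add: N_def nn_integral_count_space_finite sum_ennreal sum_nonneg)

lemma hit_bound_nonneg: "0 \<le> hit_bound"
  by (simp add: hit_bound_def)

lemma measure_\<mu>_hit_le:
  assumes "K \<in> short_segments R" shows "measure \<mu> {L. hit L K} \<le> hit_bound"
proof -
  have "emeasure \<mu> {L. hit L K} = (\<integral>\<^sup>+L. indicator {L. hit L K} L \<partial>\<mu>)" by simp
  also have "\<dots> = (\<integral>\<^sup>+L. indicator (centred_in \<Delta>) L * indicator {L. hit L K} L \<partial>ref)"
    by (rule nn_integral_\<mu>) simp
  also have "\<dots> \<le> (\<integral>\<^sup>+L. indicator {L. hit L K} L \<partial>ref)"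
    by (intro nn_integral_mono) (auto split: split_indicator)
  also have "\<dots> \<le> ennreal hit_bound" using emeasure_ref_hit_le[OF assms] by simp
  finally show ?thesis
    using hit_bound_nonneg by (simp add: \<mu>.emeasure_eq_measure)
qed

definition "r_max = b * \<tau> * \<beta> * hit_bound"

lemma r_max_nonneg: "0 \<le> r_max"
  using b \<tau>_pos \<beta>_nonneg hit_bound_nonneg by (simp add: r_max_def)

text \<open>Inserting \<open>K\<close> multiplies the conditional intensity by
  \<open>exp (- \<beta>)\<close> at exactly those \<open>L\<close> that hit \<open>K\<close>. The
  loss is at most \<open>b * \<tau> * \<beta>\<close> per unit of reference measure, on a set of
  measure at most \<open>hit_bound\<close>.\<close>

lemma A_insert:
  assumes y: "finite y" and K: "K \<in> short_segments R" "K \<notin> y"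
  shows "0 \<le> A y - A (insert K y)" "A y - A (insert K y) \<le> r_max"
proof -
  have ys: "y \<in> space config_space" "insert K y \<in> space config_space"
    using y by (auto simp: space_config_space locally_finite_finite)
  have eq: "A y - A (insert K y) = (\<integral>L. w L * l L y - w L * l L (insert K y) \<partial>\<mu>)"
    unfolding A_def by (rule Bochner_Integration.integral_diff[symmetric]) (intro w_l_integrable ys)+
  have tm: "w L * l L y - w L * l L (insert K y) = w L * l L y * (1 - exp (- \<beta> * of_bool (hit L K)))" for L
    by (simp add: l_insert[OF y K(2)] algebra_simps)
  have e: "0 \<le> 1 - exp (- \<beta> * of_bool (hit L K))" "1 - exp (- \<beta> * of_bool (hit L K)) \<le> \<beta> * indicator {L. hit L K} L" for L
    using \<beta>_nonneg exp_ge_add_one_self[of "- \<beta>"] by auto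
  show "0 \<le> A y - A (insert K y)"
    unfolding eq tm using e(1) w_nonneg l_nonneg by (intro integral_nonneg_AE) auto
  have "A y - A (insert K y) \<le> (\<integral>L. b * \<tau> * \<beta> * indicator {L. hit L K} L \<partial>\<mu>)"
    unfolding eq
  proof (rule integral_mono)
    show "integrable \<mu> (\<lambda>L. w L * l L y - w L * l L (insert K y))"
      by (intro Bochner_Integration.integrable_diff w_l_integrable ys)
    show "w L * l L y - w L * l L (insert K y) \<le> b * \<tau> * \<beta> * indicator {L. hit L K} L" for L
    proof -
      have "w L * l L y \<le> b * \<tau>" using w_le l_le l_nonneg b by (intro mult_mono) auto
      then have "w L * l L y * (1 - exp (- \<beta> * of_bool (hit L K))) \<le> b * \<tau> * (\<beta> * indicator {L. hit L K} L)"
        by (rule mult_mono) (use e b \<tau>_pos in auto)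
      then show ?thesis unfolding tm by (simp add: mult_ac)
    qed
  qed (auto intro!: integrable_real_indicator simp: less_top[symmetric])
  also have "\<dots> = b * \<tau> * \<beta> * measure \<mu> {L. hit L K}" by simp
  also have "\<dots> \<le> r_max"
    unfolding r_max_def using measure_\<mu>_hit_le[OF K(1)] b \<tau>_pos \<beta>_nonneg by (intro mult_left_mono) auto
  finally show "A y - A (insert K y) \<le> r_max" .
qed

lemma F_insert:
  assumes y: "finite y" "y \<subseteq> short_segments R" and K: "K \<in> short_segments R" "K \<notin> y"
  obtains r where "F (insert K y) = F y + (w K + r)" "0 \<le> r" "r \<le> r_max"
proof
  have "F (insert K y) = N (insert K y) - A (insert K y)" "F y = N y - A y"
    using y K by (auto intro!: F_eq locally_finite_finite)
  then show "F (insert K y) = F y + (w K + (A y - A (insert K y)))"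
    using y K by (simp add: N_finite)
qed (use A_insert[OF y(1) K] in auto)

definition good :: "particle set \<Rightarrow> bool" where
  "good y \<longleftrightarrow> finite y \<and> y \<subseteq> short_segments R \<and> y \<in> space config_space \<and> (AE K in \<mu>. K \<in> short_segments R \<and> K \<notin> y)"

lemma AE_good: "AE y in P_in. good y"
  using AE_P_in_good AE_space
proof eventually_elim
  case (elim y)
  then have "AE K in \<mu>. K \<notin> y" by blast
  then have "AE K in \<mu>. K \<in> short_segments R \<and> K \<notin> y" using AE_\<mu> by eventually_elim blast
  then show ?case using elim by (simp add: good_def space_P_in)
qed

lemma weighted_bound:
  assumes y: "y \<in> space config_space" and f: "integrable \<mu> (\<lambda>K. w K * l K y * f K)"
    and B: "AE K in \<mu>. \<bar>f K\<bar> \<le> B" "0 \<le> B"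
  shows "\<bar>\<integral>K. w K * l K y * f K \<partial>\<mu>\<bar> \<le> \<tau> * S1 * B"
proof -
  have "\<bar>\<integral>K. w K * l K y * f K \<partial>\<mu>\<bar> \<le> (\<integral>K. \<bar>w K * l K y * f K\<bar> \<partial>\<mu>)" by (rule integral_abs_bound)
  also have "\<dots> \<le> (\<integral>K. w K * (\<tau> * B) \<partial>\<mu>)"
  proof (rule integral_mono_AE)
    show "AE K in \<mu>. \<bar>w K * l K y * f K\<bar> \<le> w K * (\<tau> * B)"
      using B(1)
    proof eventually_elim
      fix K assume "\<bar>f K\<bar> \<le> B"
      then have "l K y * \<bar>f K\<bar> \<le> \<tau> * B" using l_le l_nonneg \<tau>_pos by (intro mult_mono) auto
      then show "\<bar>w K * l K y * f K\<bar> \<le> w K * (\<tau> * B)"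
        using w_nonneg[of K] l_nonneg[of K y] by (simp add: abs_mult mult.assoc mult_left_mono)
    qed
  qed (use f w_integrable in auto)
  also have "\<dots> = \<tau> * S1 * B" by (simp add: S1_def mult_ac)
  finally show ?thesis .
qed

lemma J_lipschitz_bound:
  assumes g: "g \<in> borel_measurable borel" "\<And>x. \<bar>g x\<bar> \<le> B" and lip: "\<And>x z. \<bar>g x - g z\<bar> \<le> \<bar>x - z\<bar>"
    and y: "good y"
  shows "\<bar>J g y\<bar> \<le> \<tau> * S1 * (b + r_max)"
  unfolding J_def
proof (rule weighted_bound)
  show ys: "y \<in> space config_space" using y by (simp add: good_def)
  show "integrable \<mu> (\<lambda>K. w K * l K y * (g (F (insert K y)) - g (F y)))" by (rule J_integrable_inner[OF g ys])
  have "AE K in \<mu>. K \<in> short_segments R \<and> K \<notin> y" using y by (simp add: good_def)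
  then show "AE K in \<mu>. \<bar>g (F (insert K y)) - g (F y)\<bar> \<le> b + r_max"
  proof eventually_elim
    fix K assume K: "K \<in> short_segments R \<and> K \<notin> y"
    then obtain r where r: "F (insert K y) = F y + (w K + r)" "0 \<le> r" "r \<le> r_max"
      using F_insert[of y K] y unfolding good_def by metis
    have "\<bar>g (F (insert K y)) - g (F y)\<bar> \<le> \<bar>w K + r\<bar>" using lip[of "F (insert K y)" "F y"] r(1) by simp
    also have "\<dots> \<le> b + r_max" using r w_nonneg[of K] w_le[of K] by simp
    finally show "\<bar>g (F (insert K y)) - g (F y)\<bar> \<le> b + r_max" .
  qed
qed (use b r_max_nonneg in simp)

lemma second_moment:
  shows "integrable P_in (\<lambda>y. (F y)\<^sup>2)" and "(\<integral>y. (F y)\<^sup>2 \<partial>P_in) \<le> \<tau> * S1 * (b + r_max)"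
proof -
  let ?C = "\<tau> * S1 * (b + r_max)"
  have C: "0 \<le> ?C" using \<tau>_pos S1_nonneg b r_max_nonneg by simp
  \<comment> \<open>Clipping makes \<open>g m\<close> bounded, as the identity demands, while the
    Lipschitz constant 1 keeps the bound for \<open>J\<close> independent of \<open>m\<close>;
    moreover \<open>F y * g m (F y)\<close> increases to \<open>(F y)\<^sup>2\<close>.\<close>
  define g where "g m x = max (- real m) (min (real m) x)" for m :: nat and x :: real
  have g: "g m \<in> borel_measurable borel" "\<bar>g m x\<bar> \<le> real m" "\<bar>g m x - g m z\<bar> \<le> \<bar>x - z\<bar>" for m x z
    unfolding g_def by (auto simp: max_def min_def abs_if)
  have Fg: "x * g m x = \<bar>x\<bar> * min (real m) \<bar>x\<bar>" for m x
  proof (cases "x < 0")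
    case True
    then have "g m x = - min (real m) \<bar>x\<bar>" by (simp add: g_def max_def min_def)
    then show ?thesis using True by simp
  next
    case False
    then have "g m x = min (real m) \<bar>x\<bar>" by (simp add: g_def max_def min_def)
    then show ?thesis using False by simp
  qed
  have bound: "(\<integral>\<^sup>+y. ennreal (F y * g m (F y)) \<partial>P_in) \<le> ennreal ?C" for m
  proof -
    have nn: "0 \<le> F y * g m (F y)" for y by (simp add: Fg)
    have "(\<integral>y. F y * g m (F y) \<partial>P_in) = (\<integral>y. J (g m) y \<partial>P_in)" by (rule stein_identity(3)[OF g(1,2)])
    also have "\<dots> \<le> (\<integral>y. ?C \<partial>P_in)"
    proof (rule integral_mono_AE)
      show "integrable P_in (J (g m))" by (rule stein_identity(2)[OF g(1,2)])
      show "AE y in P_in. J (g m) y \<le> ?C"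
        using AE_good by eventually_elim (use J_lipschitz_bound[OF g] in \<open>auto simp: abs_le_iff\<close>)
    qed simp
    also have "\<dots> = ?C" using P_in.prob_space by simp
    finally show ?thesis
      using stein_identity(1)[OF g(1,2), of m] nn C by (subst nn_integral_eq_integral) auto
  qed
  have sup: "(SUP m. ennreal (F y * g m (F y))) = ennreal ((F y)\<^sup>2)" for y
  proof (rule antisym)
    show "(SUP m. ennreal (F y * g m (F y))) \<le> ennreal ((F y)\<^sup>2)"
    proof (intro SUP_least ennreal_leI)
      fix m have "\<bar>F y\<bar> * min (real m) \<bar>F y\<bar> \<le> \<bar>F y\<bar> * \<bar>F y\<bar>" by (intro mult_left_mono) auto
      then show "F y * g m (F y) \<le> (F y)\<^sup>2" by (simp add: Fg power2_eq_square)
    qed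
    obtain m :: nat where "\<bar>F y\<bar> \<le> real m" using real_arch_simple by blast
    then have "(F y)\<^sup>2 = F y * g m (F y)" by (simp add: Fg power2_eq_square min_def)
    then show "ennreal ((F y)\<^sup>2) \<le> (SUP m. ennreal (F y * g m (F y)))" by (intro SUP_upper2[of m]) auto
  qed
  have "(\<integral>\<^sup>+y. ennreal ((F y)\<^sup>2) \<partial>P_in) = (SUP m. \<integral>\<^sup>+y. ennreal (F y * g m (F y)) \<partial>P_in)"
    unfolding sup[symmetric]
  proof (rule nn_integral_monotone_convergence_SUP)
    show "incseq (\<lambda>m y. ennreal (F y * g m (F y)))"
      unfolding incseq_def le_fun_def Fg by (auto intro!: ennreal_leI mult_left_mono)
    show "(\<lambda>y. ennreal (F y * g m (F y))) \<in> borel_measurable P_in" for m using g(1) by measurable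
  qed
  also have "\<dots> \<le> ennreal ?C" by (intro SUP_least bound)
  finally have le: "(\<integral>\<^sup>+y. ennreal ((F y)\<^sup>2) \<partial>P_in) \<le> ennreal ?C" .
  show int: "integrable P_in (\<lambda>y. (F y)\<^sup>2)"
    using le by (intro integrableI_nonneg) (auto simp: top_unique less_top[symmetric])
  show "(\<integral>y. (F y)\<^sup>2 \<partial>P_in) \<le> ?C"
    using le C nn_integral_eq_integral[OF int] by simp
qed

text \<open>The GNZ equation for the number of hits, with the conditional intensity bounded by
  \<open>\<tau>\<close>. The hitting particles may be centred as far out as
  \<open>\<rho> + 2 * R\<close>.\<close>

lemma expected_hits_le:
  assumes K: "K \<in> short_segments R" "norm (circumcentre K) \<le> \<rho>"
  shows "(\<integral>\<^sup>+y. ennreal (real (card {L\<in>y. hit K L})) \<partial>P_in) \<le> ennreal (\<tau> * hit_bound)"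
proof -
  let ?D = "D (\<rho> + 2 * R)"
  have D [measurable]: "?D \<in> sets borel"
  proof -
    have "?D = short_segments R \<inter> centred_in (cball 0 (\<rho> + 2 * R))" by (auto simp: D_def centred_in_def)
    then show ?thesis by simp
  qed
  define f where "f p = (indicator (?D \<inter> {L. hit L K}) (fst p) :: ennreal)" for p :: "particle \<times> particle set"
  have f: "f \<in> borel_measurable (borel \<Otimes>\<^sub>M config_space)" unfolding f_def by measurable
  have "(\<integral>\<^sup>+y. ennreal (real (card {L\<in>y. hit K L})) \<partial>P_in) = (\<integral>\<^sup>+y. \<integral>\<^sup>+L. f (L, y - {L}) \<partial>count_space y \<partial>P_in)"
  proof (rule nn_integral_cong_AE, use AE_good in eventually_elim)
    fix y assume y: "good y"
    have "L \<in> ?D" if "L \<in> y" "hit L K" for L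
    proof -
      have "dist (circumcentre L) (circumcentre K) \<le> 2 * R"
        using hit_short_dist_le[OF _ K(1) that(2)] that(1) y by (auto simp: good_def)
      then have "norm (circumcentre L) \<le> \<rho> + 2 * R"
        using K(2) norm_triangle_sub[of "circumcentre L" "circumcentre K"] by (simp add: dist_norm)
      then show ?thesis using that(1) y by (auto simp: D_def good_def)
    qed
    then have "y \<inter> (?D \<inter> {L. hit L K}) = {L\<in>y. hit K L}" by (auto simp: hit_commute[of K])
    then show "ennreal (real (card {L\<in>y. hit K L})) = (\<integral>\<^sup>+L. f (L, y - {L}) \<partial>count_space y)"
      using y unfolding f_def
      by (simp add: nn_integral_count_space_indicator_finite good_def ennreal_of_nat_eq_real_of_nat)
  qed
  also have "\<dots> = (\<integral>\<^sup>+y. \<integral>\<^sup>+L. f (L, y) * ennreal (l L y) \<partial>\<mu> \<partial>P_in)"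
    by (rule GNZ_D[OF order_refl f]) (simp add: f_def)
  also have "\<dots> \<le> (\<integral>\<^sup>+y. \<integral>\<^sup>+L. ennreal \<tau> * indicator {L. hit L K} L \<partial>\<mu> \<partial>P_in)"
    using l_le by (intro nn_integral_mono) (auto simp: f_def split: split_indicator intro: ennreal_leI)
  also have "\<dots> = ennreal \<tau> * emeasure \<mu> {L. hit L K}"
    by (simp add: nn_integral_cmult P_in.emeasure_space_1)
  also have "\<dots> \<le> ennreal (\<tau> * hit_bound)"
    using measure_\<mu>_hit_le[OF K(1)] \<tau>_pos
    by (simp add: \<mu>.emeasure_eq_measure ennreal_leI mult_left_mono flip: ennreal_mult)
  finally show ?thesis .
qed

text \<open>The coefficient of \<open>g' (F y)\<close> in the first order expansion of
  \<open>J g y\<close>; it plays the part of a variance that depends on the configuration.\<close>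

definition "V y = (\<integral>K. (w K)\<^sup>2 * l K y \<partial>\<mu>)"

lemma w2_l_integrable: "y \<in> space config_space \<Longrightarrow> integrable \<mu> (\<lambda>K. (w K)\<^sup>2 * l K y)"
proof -
  assume y: "y \<in> space config_space"
  have "\<bar>(w K)\<^sup>2 * l K y\<bar> \<le> b\<^sup>2 * \<tau>" for K
    using mult_mono[OF power_mono[OF w_le[of K] w_nonneg[of K], of 2] l_le[of K y]] l_nonneg[of K y]
    by (simp add: abs_mult)
  then show ?thesis using l_measurable_K[OF y] by (intro integrable_\<mu>_bounded[of _ "b\<^sup>2 * \<tau>"]) auto
qed

lemma V_measurable [measurable]: "V \<in> borel_measurable config_space"
proof -
  have "(\<lambda>p. (snd p, fst p)) \<in> measurable (config_space \<Otimes>\<^sub>M \<mu>) (borel \<Otimes>\<^sub>M config_space)" by measurable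
  from measurable_compose[OF this l_measurable_pair]
  have "(\<lambda>(x, K). (w K)\<^sup>2 * l K x) \<in> borel_measurable (config_space \<Otimes>\<^sub>M \<mu>)" by (simp add: case_prod_unfold)
  then show ?thesis unfolding V_def by (rule \<mu>.borel_measurable_lebesgue_integral)
qed

lemma V_eq_diff: "y \<in> space config_space \<Longrightarrow> \<tau> * S2 - V y = (\<integral>K. (w K)\<^sup>2 * (\<tau> - l K y) \<partial>\<mu>)"
  unfolding V_def S2_def using w2_l_integrable[of y] w2_integrable
  by (simp add: right_diff_distrib mult.commute[of _ \<tau>])

lemma V_le: "y \<in> space config_space \<Longrightarrow> V y \<le> \<tau> * S2"
proof -
  assume y: "y \<in> space config_space"
  have "0 \<le> (\<integral>K. (w K)\<^sup>2 * (\<tau> - l K y) \<partial>\<mu>)"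
    using l_le by (intro integral_nonneg_AE) auto
  then show ?thesis using V_eq_diff[OF y] by simp
qed

lemma V_nonneg: "0 \<le> V y"
  unfolding V_def using l_nonneg by (intro integral_nonneg_AE) auto

lemma V_integrable: "integrable P_in V"
  using V_le V_nonneg by (intro P_in.integrable_const_bound[of _ "\<tau> * S2"] AE_I2) (auto simp: space_P_in)

text \<open>The defect \<open>\<tau> - l K y\<close> is at most \<open>\<tau> * \<beta>\<close>
  times the number of particles hitting \<open>K\<close>, and the mean of that number is at most
  \<open>\<tau> * hit_bound\<close>. So \<open>V\<close> is close to the constant
  \<open>\<tau> * S2\<close> in mean when \<open>\<beta>\<close> is small.\<close>

lemma expectation_V:
  "(\<integral>y. \<tau> * S2 - V y \<partial>P_in) \<le> \<tau> * \<beta> * S2 * (\<tau> * hit_bound)"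
proof -
  let ?n = "\<lambda>K y. real (card {L\<in>y. hit K L})"
  interpret Pm: pair_sigma_finite P_in \<mu> ..
  have sw: "(\<lambda>p. (snd p, fst p)) \<in> measurable (P_in \<Otimes>\<^sub>M \<mu>) (borel \<Otimes>\<^sub>M config_space)" by measurable
  have m: "(\<lambda>(y, K). ennreal ((w K)\<^sup>2 * (\<tau> - l K y))) \<in> borel_measurable (P_in \<Otimes>\<^sub>M \<mu>)"
    using measurable_compose[OF sw l_measurable_pair] by (simp add: case_prod_unfold)
  have "(\<integral>\<^sup>+y. ennreal (\<tau> * S2 - V y) \<partial>P_in) = (\<integral>\<^sup>+y. \<integral>\<^sup>+K. ennreal ((w K)\<^sup>2 * (\<tau> - l K y)) \<partial>\<mu> \<partial>P_in)"
  proof (rule nn_integral_cong)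
    fix y assume "y \<in> space P_in"
    then have y: "y \<in> space config_space" by (simp add: space_P_in)
    have "integrable \<mu> (\<lambda>K. (w K)\<^sup>2 * (\<tau> - l K y))"
      using w2_l_integrable[OF y] w2_integrable by (simp add: right_diff_distrib)
    then show "ennreal (\<tau> * S2 - V y) = (\<integral>\<^sup>+K. ennreal ((w K)\<^sup>2 * (\<tau> - l K y)) \<partial>\<mu>)"
      unfolding V_eq_diff[OF y] using l_le by (intro nn_integral_eq_integral[symmetric]) auto
  qed
  also have "\<dots> = (\<integral>\<^sup>+K. \<integral>\<^sup>+y. ennreal ((w K)\<^sup>2 * (\<tau> - l K y)) \<partial>P_in \<partial>\<mu>)"
    by (rule Pm.Fubini'[OF m, symmetric])
  also have "\<dots> \<le> (\<integral>\<^sup>+K. ennreal ((w K)\<^sup>2 * (\<tau> * \<beta> * (\<tau> * hit_bound))) \<partial>\<mu>)"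
  proof (rule nn_integral_mono)
    fix K
    show "(\<integral>\<^sup>+y. ennreal ((w K)\<^sup>2 * (\<tau> - l K y)) \<partial>P_in) \<le> ennreal ((w K)\<^sup>2 * (\<tau> * \<beta> * (\<tau> * hit_bound)))"
    proof (cases "w K = 0")
      case False
      have le: "\<tau> - l K y \<le> \<tau> * \<beta> * ?n K y" for y
      proof -
        have "1 - exp (- \<beta> * ?n K y) \<le> \<beta> * ?n K y" using exp_ge_add_one_self[of "- \<beta> * ?n K y"] by simp
        then have "\<tau> * (1 - exp (- \<beta> * ?n K y)) \<le> \<tau> * (\<beta> * ?n K y)" using \<tau>_pos by (intro mult_left_mono) auto
        then show ?thesis by (simp add: l_def cond_intensity_def algebra_simps)
      qed
      have mn: "(\<lambda>y. ?n K y) \<in> borel_measurable P_in"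
        using measurable_hits[of "\<lambda>y. y" config_space "\<lambda>_. K"] by (simp add: hit_commute[of K])
      have "(\<integral>\<^sup>+y. ennreal ((w K)\<^sup>2 * (\<tau> - l K y)) \<partial>P_in) \<le> (\<integral>\<^sup>+y. ennreal ((w K)\<^sup>2 * \<tau> * \<beta>) * ennreal (?n K y) \<partial>P_in)"
      proof (rule nn_integral_mono)
        fix y
        have "(w K)\<^sup>2 * (\<tau> - l K y) \<le> (w K)\<^sup>2 * (\<tau> * \<beta> * ?n K y)" using le by (intro mult_left_mono) auto
        then show "ennreal ((w K)\<^sup>2 * (\<tau> - l K y)) \<le> ennreal ((w K)\<^sup>2 * \<tau> * \<beta>) * ennreal (?n K y)"
          using \<tau>_pos \<beta>_nonneg by (subst ennreal_mult[symmetric]) (auto intro!: ennreal_leI simp: mult_ac)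
      qed
      also have "\<dots> = ennreal ((w K)\<^sup>2 * \<tau> * \<beta>) * (\<integral>\<^sup>+y. ennreal (?n K y) \<partial>P_in)"
        by (intro nn_integral_cmult measurable_compose[OF mn measurable_ennreal])
      also have "\<dots> \<le> ennreal ((w K)\<^sup>2 * \<tau> * \<beta>) * ennreal (\<tau> * hit_bound)"
        using w_support[OF False] by (intro mult_left_mono expected_hits_le) auto
      also have "\<dots> = ennreal ((w K)\<^sup>2 * (\<tau> * \<beta> * (\<tau> * hit_bound)))"
        using \<tau>_pos \<beta>_nonneg hit_bound_nonneg by (subst ennreal_mult[symmetric]) (auto simp: mult_ac)
      finally show ?thesis .
    qed simp
  qed
  also have "\<dots> = ennreal (\<integral>K. (w K)\<^sup>2 * (\<tau> * \<beta> * (\<tau> * hit_bound)) \<partial>\<mu>)"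
    using w2_integrable \<tau>_pos \<beta>_nonneg hit_bound_nonneg by (intro nn_integral_eq_integral) auto
  also have "(\<integral>K. (w K)\<^sup>2 * (\<tau> * \<beta> * (\<tau> * hit_bound)) \<partial>\<mu>) = \<tau> * \<beta> * S2 * (\<tau> * hit_bound)"
    by (simp add: S2_def mult_ac)
  finally have le: "(\<integral>\<^sup>+y. ennreal (\<tau> * S2 - V y) \<partial>P_in) \<le> ennreal (\<tau> * \<beta> * S2 * (\<tau> * hit_bound))" .
  have "(\<integral>\<^sup>+y. ennreal (\<tau> * S2 - V y) \<partial>P_in) = ennreal (\<integral>y. \<tau> * S2 - V y \<partial>P_in)"
    using V_integrable V_le by (intro nn_integral_eq_integral) (auto simp: space_P_in)
  then show ?thesis
    using le \<tau>_pos \<beta>_nonneg hit_bound_nonneg S2_nonneg by (simp add: ennreal_le_iff)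
qed

text \<open>Inserting \<open>K\<close> shifts \<open>F\<close> by \<open>w K + r\<close> with
  \<open>r\<close> between 0 and \<open>r_max\<close>. The term \<open>g' (F y) * w K\<close>
  integrates to the main part; the errors are \<open>g' (F y) * r\<close> and the second order
  remainder.\<close>

lemma J_taylor_bound:
  assumes g: "\<And>x. \<bar>g x\<bar> \<le> B"
    and d: "\<And>x. (g has_real_derivative g' x) (at x)" "\<And>x. (g' has_real_derivative g'' x) (at x)"
    and u: "\<And>x. \<bar>g' x\<bar> \<le> u1" "\<And>x. \<bar>g'' x\<bar> \<le> u2" and y: "good y"
  shows "\<bar>J g y - g' (F y) * V y\<bar> \<le> \<tau> * S1 * (u1 * r_max + u2 * (b + r_max)\<^sup>2)"
proof -
  have ys: "y \<in> space config_space" using y by (simp add: good_def)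
  have gm: "g \<in> borel_measurable borel"
    using d(1) by (intro borel_measurable_continuous_onI continuous_at_imp_continuous_on) (auto intro: DERIV_isCont)
  have u0: "0 \<le> u1" "0 \<le> u2" using u[of 0] by linarith+
  let ?f = "\<lambda>K. g (F (insert K y)) - g (F y) - g' (F y) * w K"
  have i1: "integrable \<mu> (\<lambda>K. w K * l K y * (g (F (insert K y)) - g (F y)))" by (rule J_integrable_inner[OF gm g ys])
  have i2: "integrable \<mu> (\<lambda>K. g' (F y) * ((w K)\<^sup>2 * l K y))" using w2_l_integrable[OF ys] by simp
  have split: "w K * l K y * ?f K = w K * l K y * (g (F (insert K y)) - g (F y)) - g' (F y) * ((w K)\<^sup>2 * l K y)" for K
    by (simp add: algebra_simps power2_eq_square)
  have "J g y - g' (F y) * V y = (\<integral>K. w K * l K y * ?f K \<partial>\<mu>)"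
    unfolding J_def V_def split using i1 i2 by (subst Bochner_Integration.integral_diff) auto
  moreover have "\<bar>\<integral>K. w K * l K y * ?f K \<partial>\<mu>\<bar> \<le> \<tau> * S1 * (u1 * r_max + u2 * (b + r_max)\<^sup>2)"
  proof (rule weighted_bound[OF ys])
    show "integrable \<mu> (\<lambda>K. w K * l K y * ?f K)"
      unfolding split using i1 i2 by (rule Bochner_Integration.integrable_diff)
    have "AE K in \<mu>. K \<in> short_segments R \<and> K \<notin> y" using y by (simp add: good_def)
    then show "AE K in \<mu>. \<bar>?f K\<bar> \<le> u1 * r_max + u2 * (b + r_max)\<^sup>2"
    proof eventually_elim
      fix K assume K: "K \<in> short_segments R \<and> K \<notin> y"
      then obtain r where r: "F (insert K y) = F y + (w K + r)" "0 \<le> r" "r \<le> r_max"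
        using F_insert[of y K] y unfolding good_def by metis
      have "\<bar>g (F y + (w K + r)) - g (F y) - g' (F y) * (w K + r)\<bar> \<le> u2 * (w K + r)\<^sup>2"
        by (rule taylor2_bound[OF d u(2)])
      also have "\<dots> \<le> u2 * (b + r_max)\<^sup>2"
        using r w_nonneg[of K] w_le[of K] u0 by (intro mult_left_mono power_mono) auto
      finally have t: "\<bar>g (F y + (w K + r)) - g (F y) - g' (F y) * (w K + r)\<bar> \<le> u2 * (b + r_max)\<^sup>2" .
      have "\<bar>g' (F y) * r\<bar> \<le> u1 * r_max" using u(1)[of "F y"] r u0 by (simp add: abs_mult mult_mono)
      then show "\<bar>?f K\<bar> \<le> u1 * r_max + u2 * (b + r_max)\<^sup>2"
        using t unfolding r(1) by (simp add: distrib_left abs_le_iff)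
    qed
    show "0 \<le> u1 * r_max + u2 * (b + r_max)\<^sup>2" using u0 r_max_nonneg by simp
  qed
  ultimately show ?thesis by simp
qed

lemma stein_bound:
  assumes g: "\<And>x. \<bar>g x\<bar> \<le> B"
    and d: "\<And>x. (g has_real_derivative g' x) (at x)" "\<And>x. (g' has_real_derivative g'' x) (at x)"
    and u: "\<And>x. \<bar>g' x\<bar> \<le> u1" "\<And>x. \<bar>g'' x\<bar> \<le> u2"
  shows "\<bar>(\<integral>x. F x * g (F x) \<partial>P) - (\<integral>x. g' (F x) \<partial>P)\<bar>
    \<le> u1 * (\<bar>\<tau> * S2 - 1\<bar> + \<tau> * \<beta> * S2 * (\<tau> * hit_bound)) + \<tau> * S1 * (u1 * r_max + u2 * (b + r_max)\<^sup>2)"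
proof -
  have u0: "0 \<le> u1" using u(1)[of 0] by linarith
  have gm: "g \<in> borel_measurable borel"
    using d(1) by (intro borel_measurable_continuous_onI continuous_at_imp_continuous_on) (auto intro: DERIV_isCont)
  have g'm [measurable]: "g' \<in> borel_measurable borel"
    using d(2) by (intro borel_measurable_continuous_onI continuous_at_imp_continuous_on) (auto intro: DERIV_isCont)
  let ?c = "\<tau> * S1 * (u1 * r_max + u2 * (b + r_max)\<^sup>2)"
  have e1: "(\<integral>x. F x * g (F x) \<partial>P) = (\<integral>y. J g y \<partial>P_in)"
    using integral_P_F[of "\<lambda>x. x * g x"] gm stein_identity(3)[OF gm g] by simp
  have e2: "(\<integral>x. g' (F x) \<partial>P) = (\<integral>y. g' (F y) \<partial>P_in)" by (rule integral_P_F[OF g'm])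
  have iJ: "integrable P_in (J g)" by (rule stein_identity(2)[OF gm g])
  have ig: "integrable P_in (\<lambda>y. g' (F y))"
    using u(1) by (intro P_in.integrable_const_bound[of _ u1]) auto
  have "\<bar>(\<integral>y. J g y \<partial>P_in) - (\<integral>y. g' (F y) \<partial>P_in)\<bar> = \<bar>\<integral>y. J g y - g' (F y) \<partial>P_in\<bar>"
    using iJ ig by simp
  also have "\<dots> \<le> (\<integral>y. \<bar>J g y - g' (F y)\<bar> \<partial>P_in)" by (rule integral_abs_bound)
  \<comment> \<open>The distance of \<open>V y\<close> from 1 is split at
    \<open>\<tau> * S2\<close>, which dominates \<open>V y\<close>; the second part therefore needs
    no absolute value and its mean is already bounded.\<close>
  also have "\<dots> \<le> (\<integral>y. ?c + u1 * (\<bar>\<tau> * S2 - 1\<bar> + (\<tau> * S2 - V y)) \<partial>P_in)"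
  proof (rule integral_mono_AE)
    show "AE y in P_in. \<bar>J g y - g' (F y)\<bar> \<le> ?c + u1 * (\<bar>\<tau> * S2 - 1\<bar> + (\<tau> * S2 - V y))"
      using AE_good
    proof eventually_elim
      fix y assume y: "good y"
      have "\<bar>J g y - g' (F y) * V y\<bar> \<le> ?c" by (rule J_taylor_bound[OF g d u y])
      moreover have "\<bar>g' (F y) * V y - g' (F y)\<bar> \<le> u1 * (\<bar>\<tau> * S2 - 1\<bar> + (\<tau> * S2 - V y))"
      proof -
        have "\<bar>g' (F y) * V y - g' (F y)\<bar> = \<bar>g' (F y)\<bar> * \<bar>V y - 1\<bar>"
          by (simp add: abs_mult[symmetric] algebra_simps)
        also have "\<dots> \<le> u1 * (\<bar>\<tau> * S2 - 1\<bar> + (\<tau> * S2 - V y))"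
          using u(1)[of "F y"] V_le[of y] y u0 by (intro mult_mono) (auto simp: good_def)
        finally show ?thesis .
      qed
      ultimately show "\<bar>J g y - g' (F y)\<bar> \<le> ?c + u1 * (\<bar>\<tau> * S2 - 1\<bar> + (\<tau> * S2 - V y))" by linarith
    qed
  qed (use iJ ig V_integrable in auto)
  also have "\<dots> = ?c + u1 * (\<bar>\<tau> * S2 - 1\<bar> + (\<integral>y. \<tau> * S2 - V y \<partial>P_in))"
    using V_integrable P_in.prob_space by simp
  also have "\<dots> \<le> ?c + u1 * (\<bar>\<tau> * S2 - 1\<bar> + \<tau> * \<beta> * S2 * (\<tau> * hit_bound))"
    using expectation_V u0 by (intro add_left_mono mult_left_mono) auto
  finally show ?thesis unfolding e1 e2 by simp
qed

lemma second_moment_P: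
  "integrable P (\<lambda>x. (F x)\<^sup>2)" "(\<integral>x. (F x)\<^sup>2 \<partial>P) \<le> \<tau> * S1 * (b + r_max)"
proof -
  have "integrable P (\<lambda>x. (F (x \<inter> centred_in \<Delta>))\<^sup>2)"
    using second_moment(1) unfolding P_in_def by (rule integrable_distr[OF measurable_inside])
  moreover have "(\<lambda>x. (F x)\<^sup>2) \<in> borel_measurable P"
    using F_measurable by (simp add: measurable_cong_sets[OF sets_P refl])
  moreover have "AE x in P. (F x)\<^sup>2 = (F (x \<inter> centred_in \<Delta>))\<^sup>2" using AE_F_inside by eventually_elim simp
  ultimately show "integrable P (\<lambda>x. (F x)\<^sup>2)"
    by (subst integrable_cong_AE[where g="\<lambda>x. (F (x \<inter> centred_in \<Delta>))\<^sup>2"]) auto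
  show "(\<integral>x. (F x)\<^sup>2 \<partial>P) \<le> \<tau> * S1 * (b + r_max)"
    using integral_P_F[of "\<lambda>x. x\<^sup>2"] second_moment(2) by simp
qed

end

section \<open>Normal limits in the Wasserstein distance\<close>

lemma DERIV_quadratic_error:
  fixes f :: "real \<Rightarrow> real"
  assumes "\<And>h. \<bar>f (u + h) - f u - d * h\<bar> \<le> C * h\<^sup>2"
  shows "(f has_real_derivative d) (at u)"
  unfolding DERIV_def
proof (rule LIM_zero_cancel, rule tendsto_rabs_zero_cancel)
  have C: "0 \<le> C" using assms[of 1] by (simp add: order_trans[OF abs_ge_zero])
  have b: "\<bar>(f (u + h) - f u) / h - d\<bar> \<le> C * \<bar>h\<bar>" if "h \<noteq> 0" for h
  proof -
    have "\<bar>(f (u + h) - f u) / h - d\<bar> = \<bar>f (u + h) - f u - d * h\<bar> / \<bar>h\<bar>"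
      using that by (simp add: abs_divide[symmetric] diff_divide_distrib)
    also have "\<dots> \<le> (C * h\<^sup>2) / \<bar>h\<bar>" using assms by (intro divide_right_mono) auto
    also have "\<dots> = C * \<bar>h\<bar>" using that by (simp add: power2_eq_square abs_if)
    finally show ?thesis .
  qed
  have "((\<lambda>h. C * \<bar>h\<bar>) \<longlongrightarrow> C * \<bar>0\<bar>) (at 0)" by (intro tendsto_intros)
  then have lim0: "((\<lambda>h. C * \<bar>h\<bar>) \<longlongrightarrow> 0) (at 0)" by simp
  show "((\<lambda>h. \<bar>(f (u + h) - f u) / h - d\<bar>) \<longlongrightarrow> 0) (at 0)"
    by (rule tendsto_sandwich[OF _ _ tendsto_const lim0])
      (auto simp: eventually_at b intro!: exI[of _ 1])
qed

lemma (in prob_space) integrable_of_square: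
  fixes X :: "'a \<Rightarrow> real"
  assumes [measurable]: "X \<in> borel_measurable M" and "integrable M (\<lambda>x. (X x)\<^sup>2)"
  shows "integrable M X"
proof (rule Bochner_Integration.integrable_bound[of _ "\<lambda>x. 1 + (X x)\<^sup>2"])
  have "\<bar>t\<bar> \<le> 1 + t\<^sup>2" for t :: real
    using zero_le_power2[of "\<bar>t\<bar> - 1"] by (simp add: power2_eq_square algebra_simps abs_if split: if_splits)
  then show "AE x in M. norm (X x) \<le> norm (1 + (X x)\<^sup>2)" by simp
qed (use assms(2) in auto)

text \<open>Differentiation under the expectation: the pointwise Taylor remainder is at most
  \<open>(X x)\<^sup>2 * h\<^sup>2\<close>, so the second moment turns it into a quadratic
  error.\<close>

lemma (in prob_space) DERIV_expectation_trig:
  fixes X :: "'a \<Rightarrow> real" and g g' g'' :: "real \<Rightarrow> real"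
  assumes [measurable]: "X \<in> borel_measurable M" and X2: "integrable M (\<lambda>x. (X x)\<^sup>2)"
    and g: "\<And>t. (g has_real_derivative g' t) (at t)" "\<And>t. (g' has_real_derivative g'' t) (at t)"
      "\<And>t. \<bar>g t\<bar> \<le> 1" "\<And>t. \<bar>g' t\<bar> \<le> 1" "\<And>t. \<bar>g'' t\<bar> \<le> 1"
  shows "((\<lambda>u. \<integral>x. g (u * X x) \<partial>M) has_real_derivative (\<integral>x. X x * g' (u * X x) \<partial>M)) (at u)"
proof (rule DERIV_quadratic_error)
  fix h
  have gm: "g \<in> borel_measurable borel" "g' \<in> borel_measurable borel"
    using g(1,2) by (auto intro!: borel_measurable_continuous_onI continuous_at_imp_continuous_on intro: DERIV_isCont)
  have i1: "integrable M (\<lambda>x. g (v * X x))" for v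
    using g(3) gm by (intro integrable_const_bound[of _ 1]) auto
  have i2: "integrable M (\<lambda>x. X x * g' (u * X x))"
  proof (rule Bochner_Integration.integrable_bound[OF integrable_of_square[OF assms(1) X2]])
    show "AE x in M. norm (X x * g' (u * X x)) \<le> norm (X x)"
      using g(4) by (auto simp: abs_mult mult_left_le)
  qed (use gm in measurable)
  have pt: "\<bar>g ((u + h) * x) - g (u * x) - (x * g' (u * x)) * h\<bar> \<le> x\<^sup>2 * h\<^sup>2" for x
  proof -
    have "\<bar>g (u * x + h * x) - g (u * x) - g' (u * x) * (h * x)\<bar> \<le> 1 * (h * x)\<^sup>2"
      by (rule taylor2_bound[OF g(1,2,5)])
    then show ?thesis by (simp add: algebra_simps power_mult_distrib)
  qed
  have "\<bar>(\<integral>x. g ((u + h) * X x) \<partial>M) - (\<integral>x. g (u * X x) \<partial>M) - (\<integral>x. X x * g' (u * X x) \<partial>M) * h\<bar>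
      = \<bar>\<integral>x. g ((u + h) * X x) - g (u * X x) - (X x * g' (u * X x)) * h \<partial>M\<bar>"
    using i1 i2 by simp
  also have "\<dots> \<le> (\<integral>x. \<bar>g ((u + h) * X x) - g (u * X x) - (X x * g' (u * X x)) * h\<bar> \<partial>M)"
    by (rule integral_abs_bound)
  also have "\<dots> \<le> (\<integral>x. (X x)\<^sup>2 * h\<^sup>2 \<partial>M)"
    using i1 i2 X2 pt by (intro integral_mono) auto
  also have "\<dots> = (\<integral>x. (X x)\<^sup>2 \<partial>M) * h\<^sup>2" by simp
  finally show "\<bar>(\<integral>x. g ((u + h) * X x) \<partial>M) - (\<integral>x. g (u * X x) \<partial>M) - (\<integral>x. X x * g' (u * X x) \<partial>M) * h\<bar>
      \<le> (\<integral>x. (X x)\<^sup>2 \<partial>M) * h\<^sup>2" .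
qed

text \<open>Gronwall's argument for the equation \<open>f' = - u f\<close> solved by the characteristic function of the normal law.\<close>

lemma gaussian_ode_error:
  fixes f f' :: "real \<Rightarrow> real"
  assumes d: "\<And>u. (f has_real_derivative f' u) (at u)"
    and e: "\<And>u. \<bar>f' u + u * f u\<bar> \<le> \<delta> * (\<bar>u\<bar> + u\<^sup>2)" and \<delta>: "0 \<le> \<delta>"
  shows "\<bar>f u - f 0 * exp (- u\<^sup>2 / 2)\<bar> \<le> \<delta> * ((\<bar>u\<bar> + u\<^sup>2) * \<bar>u\<bar>)"
proof -
  \<comment> \<open>Integrating factor: the derivative of \<open>a\<close> is the defect
    \<open>f' v + v * f v\<close> times \<open>exp (v\<^sup>2 / 2)\<close>, and \<open>B\<close>
    bounds it between 0 and \<open>u\<close>.\<close>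
  define a where "a v = f v * exp (v\<^sup>2 / 2)" for v
  define B where "B = \<delta> * (\<bar>u\<bar> + u\<^sup>2) * exp (u\<^sup>2 / 2)"
  have da: "(a has_real_derivative (f' v + v * f v) * exp (v\<^sup>2 / 2)) (at v)" for v
    unfolding a_def by (auto intro!: derivative_eq_intros d simp: algebra_simps)
  have "\<bar>a u - a 0\<bar> \<le> B * \<bar>u - 0\<bar>"
  proof (rule field_differentiable_bound[of "closed_segment 0 u" a "\<lambda>v. (f' v + v * f v) * exp (v\<^sup>2 / 2)" B u 0, unfolded real_norm_def])
    fix v assume "v \<in> closed_segment 0 u"
    then have v: "\<bar>v\<bar> \<le> \<bar>u\<bar>" by (auto simp: closed_segment_eq_real_ivl split: if_splits)
    then have v2: "v\<^sup>2 \<le> u\<^sup>2" by (simp add: abs_le_square_iff)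
    show "(a has_real_derivative (f' v + v * f v) * exp (v\<^sup>2 / 2)) (at v within closed_segment 0 u)"
      using da by (rule has_field_derivative_at_within)
    have "\<bar>(f' v + v * f v) * exp (v\<^sup>2 / 2)\<bar> = \<bar>f' v + v * f v\<bar> * exp (v\<^sup>2 / 2)" by (simp add: abs_mult)
    also have "\<dots> \<le> (\<delta> * (\<bar>v\<bar> + v\<^sup>2)) * exp (v\<^sup>2 / 2)" using e by (intro mult_right_mono) auto
    also have "\<dots> \<le> B" unfolding B_def using v v2 \<delta> by (intro mult_mono add_mono mult_nonneg_nonneg) auto
    finally show "\<bar>(f' v + v * f v) * exp (v\<^sup>2 / 2)\<bar> \<le> B" .
  qed auto
  then have h1: "\<bar>a u - a 0\<bar> * exp (- u\<^sup>2 / 2) \<le> (B * \<bar>u\<bar>) * exp (- u\<^sup>2 / 2)" by (intro mult_right_mono) auto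
  have h2: "exp (u\<^sup>2 / 2) * exp (- u\<^sup>2 / 2) = 1" by (simp flip: exp_add)
  have "\<bar>a u - a 0\<bar> * exp (- u\<^sup>2 / 2) = \<bar>(a u - a 0) * exp (- u\<^sup>2 / 2)\<bar>" by (simp add: abs_mult)
  then have h3: "\<bar>a u - a 0\<bar> * exp (- u\<^sup>2 / 2) = \<bar>f u * (exp (u\<^sup>2 / 2) * exp (- u\<^sup>2 / 2)) - f 0 * exp (- u\<^sup>2 / 2)\<bar>"
    by (simp add: a_def left_diff_distrib mult.assoc)
  have h4: "(B * \<bar>u\<bar>) * exp (- u\<^sup>2 / 2) = \<delta> * ((\<bar>u\<bar> + u\<^sup>2) * \<bar>u\<bar>) * (exp (u\<^sup>2 / 2) * exp (- u\<^sup>2 / 2))"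
    by (simp add: B_def)
  show ?thesis using h1 unfolding h3 h4 h2 by simp
qed

text \<open>For coupled variables every 1-Lipschitz function contributes at most \<open>E n\<close>,
  the mean of \<open>\<bar>Yn n - Y\<bar>\<close>. This tends to 0: truncated at \<open>T\<close> it
  does so by dominated convergence, and bounded second moments make the cost of truncation at most
  \<open>2 * (C + C') / T\<close>.\<close>

lemma wasserstein_dist_tendsto_0:
  fixes M :: "nat \<Rightarrow> 'w measure" and X :: "nat \<Rightarrow> 'w \<Rightarrow> real" and N :: "'z measure" and Z :: "'z \<Rightarrow> real"
  assumes M: "\<And>n. prob_space (M n)" and X: "\<And>n. X n \<in> borel_measurable (M n)"
    and X2: "\<And>n. integrable (M n) (\<lambda>\<omega>. (X n \<omega>)\<^sup>2)" "\<And>n. (\<integral>\<omega>. (X n \<omega>)\<^sup>2 \<partial>M n) \<le> C"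
    and N: "prob_space N" and Z: "Z \<in> borel_measurable N" "integrable N (\<lambda>\<omega>. (Z \<omega>)\<^sup>2)"
    and conv: "weak_conv_m (\<lambda>n. distr (M n) borel (X n)) (distr N borel Z)"
  shows "(\<lambda>n. wasserstein_dist (M n) (X n) N Z) \<longlonglongrightarrow> 0"
proof -
  interpret N: prob_space N by fact
  define D where "D n = distr (M n) borel (X n)" for n
  have rdn: "real_distribution (D n)" for n
    unfolding D_def real_distribution_def real_distribution_axioms_def
    using prob_space.prob_space_distr[OF M X] by simp
  have rd: "real_distribution (distr N borel Z)"
    unfolding real_distribution_def real_distribution_axioms_def
    using N.prob_space_distr[OF Z(1)] by simp
  obtain \<Omega> :: "real measure" and Yn Y where
    \<Omega>: "prob_space \<Omega>" and Yn [measurable]: "\<And>n. Yn n \<in> borel_measurable \<Omega>"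
    and dYn: "\<And>n. distr \<Omega> borel (Yn n) = D n" and Y [measurable]: "Y \<in> borel_measurable \<Omega>"
    and dY: "distr \<Omega> borel Y = distr N borel Z" and lim: "\<And>x. x \<in> space \<Omega> \<Longrightarrow> (\<lambda>n. Yn n x) \<longlonglongrightarrow> Y x"
    using Skorohod[OF rdn rd conv[folded D_def]] by force
  interpret \<Omega>: prob_space \<Omega> by fact
  have tr: "(\<integral>x. f (Yn n x) \<partial>\<Omega>) = (\<integral>\<omega>. f (X n \<omega>) \<partial>M n)" "integrable \<Omega> (\<lambda>x. f (Yn n x)) = integrable (M n) (\<lambda>\<omega>. f (X n \<omega>))"
    if [measurable]: "f \<in> borel_measurable borel" for n and f :: "real \<Rightarrow> real"
    using integral_distr[OF Yn[of n] that] integral_distr[OF X[of n] that]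
      integrable_distr_eq[OF Yn[of n] that] integrable_distr_eq[OF X[of n] that] dYn[of n] by (simp_all add: D_def)
  have tr': "(\<integral>x. f (Y x) \<partial>\<Omega>) = (\<integral>\<omega>. f (Z \<omega>) \<partial>N)" "integrable \<Omega> (\<lambda>x. f (Y x)) = integrable N (\<lambda>\<omega>. f (Z \<omega>))"
    if [measurable]: "f \<in> borel_measurable borel" for f :: "real \<Rightarrow> real"
    using integral_distr[OF Y that] integral_distr[OF Z(1) that]
      integrable_distr_eq[OF Y that] integrable_distr_eq[OF Z(1) that] dY by simp_all
  have Yn2: "integrable \<Omega> (\<lambda>x. (Yn n x)\<^sup>2)" "(\<integral>x. (Yn n x)\<^sup>2 \<partial>\<Omega>) \<le> C" for n
    using tr[of "\<lambda>t. t\<^sup>2" n] X2 by simp_all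
  have Y2: "integrable \<Omega> (\<lambda>x. (Y x)\<^sup>2)"
    using tr'[of "\<lambda>t. t\<^sup>2"] Z by simp_all
  define C' where "C' = (\<integral>x. (Y x)\<^sup>2 \<partial>\<Omega>)"
  have iYn: "integrable \<Omega> (Yn n)" for n by (rule \<Omega>.integrable_of_square[OF Yn Yn2(1)])
  have iY: "integrable \<Omega> Y" by (rule \<Omega>.integrable_of_square[OF Y Y2])
  define E where "E n = (\<integral>x. \<bar>Yn n x - Y x\<bar> \<partial>\<Omega>)" for n
  have iE: "integrable \<Omega> (\<lambda>x. \<bar>Yn n x - Y x\<bar>)" for n using iYn iY by simp
  have E0: "0 \<le> E n" for n by (simp add: E_def)
  have cut: "E n \<le> (\<integral>x. min \<bar>Yn n x - Y x\<bar> T \<partial>\<Omega>) + 2 * (C + C') / T" if T: "T > 0" for n T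
  proof -
    have im: "integrable \<Omega> (\<lambda>x. min \<bar>Yn n x - Y x\<bar> T)"
      using T by (intro \<Omega>.integrable_const_bound[of _ T]) auto
    have isq: "integrable \<Omega> (\<lambda>x. 2 * ((Yn n x)\<^sup>2 + (Y x)\<^sup>2) / T)" using Yn2 Y2 by simp
    \<comment> \<open>Beyond \<open>T\<close> the distance is at most its square divided by
      \<open>T\<close>.\<close>
    have pt: "\<bar>p - q\<bar> \<le> min \<bar>p - q\<bar> T + 2 * (p\<^sup>2 + q\<^sup>2) / T" for p q :: real
    proof (cases "\<bar>p - q\<bar> \<le> T")
      case False
      have "\<bar>p - q\<bar> * T \<le> \<bar>p - q\<bar> * \<bar>p - q\<bar>" using False by (intro mult_left_mono) auto
      also have "\<dots> = (p - q)\<^sup>2" by (simp add: power2_eq_square)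
      also have "\<dots> \<le> 2 * (p\<^sup>2 + q\<^sup>2)" using zero_le_power2[of "p + q"] by (simp add: power2_eq_square algebra_simps)
      finally have "\<bar>p - q\<bar> \<le> 2 * (p\<^sup>2 + q\<^sup>2) / T" using T by (simp add: pos_le_divide_eq)
      then show ?thesis using T by simp
    qed (use T in simp)
    have "E n \<le> (\<integral>x. min \<bar>Yn n x - Y x\<bar> T + 2 * ((Yn n x)\<^sup>2 + (Y x)\<^sup>2) / T \<partial>\<Omega>)"
      unfolding E_def using iE im isq pt by (intro integral_mono) auto
    also have "\<dots> = (\<integral>x. min \<bar>Yn n x - Y x\<bar> T \<partial>\<Omega>) + 2 * ((\<integral>x. (Yn n x)\<^sup>2 \<partial>\<Omega>) + C') / T"
      using im isq Yn2 Y2 by (simp add: C'_def)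
    also have "\<dots> \<le> (\<integral>x. min \<bar>Yn n x - Y x\<bar> T \<partial>\<Omega>) + 2 * (C + C') / T"
      using Yn2(2)[of n] T by (intro add_left_mono divide_right_mono mult_left_mono) auto
    finally show ?thesis .
  qed
  have mlim: "(\<lambda>n. \<integral>x. min \<bar>Yn n x - Y x\<bar> T \<partial>\<Omega>) \<longlonglongrightarrow> 0" if T: "T > 0" for T
  proof -
    have "(\<lambda>n. \<integral>x. min \<bar>Yn n x - Y x\<bar> T \<partial>\<Omega>) \<longlonglongrightarrow> (\<integral>x. min \<bar>0\<bar> T \<partial>\<Omega>)"
    proof (rule integral_dominated_convergence[where w="\<lambda>_. T"])
      show "AE x in \<Omega>. (\<lambda>n. min \<bar>Yn n x - Y x\<bar> T) \<longlonglongrightarrow> min \<bar>0\<bar> T"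
        using lim by (intro AE_I2 tendsto_intros) (auto simp: LIM_zero)
    qed (use T in auto)
    then show ?thesis using T by simp
  qed
  have Elim: "E \<longlonglongrightarrow> 0"
  proof (rule LIMSEQ_I)
    fix e :: real assume e: "0 < e"
    have CC: "0 \<le> C + C'"
    proof -
      have "0 \<le> (\<integral>x. (Yn 0 x)\<^sup>2 \<partial>\<Omega>)" "0 \<le> C'"
        unfolding C'_def by (auto intro!: integral_nonneg_AE)
      then show ?thesis using Yn2(2)[of 0] by linarith
    qed
    \<comment> \<open>The first summand brings the truncation cost below \<open>e / 2\<close>; the 1
      keeps \<open>T\<close> positive when \<open>C + C'\<close> is 0.\<close>
    define T where "T = 4 * (C + C') / e + 1"
    have T: "T > 0" using CC e by (simp add: T_def add_nonneg_pos)
    have T2: "2 * (C + C') / T < e / 2 + e / 4"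
    proof -
      have "T * (e / 2) = 2 * (C + C') + e / 2" using e by (simp add: T_def field_simps)
      then have "2 * (C + C') \<le> (e / 2) * T" using e by (simp add: mult.commute)
      then have "2 * (C + C') / T \<le> e / 2" using T by (simp add: pos_divide_le_eq)
      also have "e / 2 < e / 2 + e / 4" using e by simp
      finally show ?thesis .
    qed
    obtain n0 where n0: "\<And>n. n \<ge> n0 \<Longrightarrow> norm ((\<integral>x. min \<bar>Yn n x - Y x\<bar> T \<partial>\<Omega>) - 0) < e / 4"
      using LIMSEQ_D[OF mlim[OF T], of "e / 4"] e by auto
    have "norm (E n - 0) < e" if "n \<ge> n0" for n
    proof -
      have "\<bar>E n\<bar> < e" if "E n \<le> x + s" "norm (x - 0) < e / 4" "s < e / 2 + e / 4" for x s :: real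
        using that E0[of n] by (simp add: abs_if split: if_splits)
      from this[OF cut[OF T, of n] n0[OF that] T2] show ?thesis by simp
    qed
    then show "\<exists>n0. \<forall>n\<ge>n0. norm (E n - 0) < e" by blast
  qed
  have le: "wasserstein_dist (M n) (X n) N Z \<le> ennreal (E n)" for n
    unfolding wasserstein_dist_def
  proof (rule SUP_least)
    fix h :: "real \<Rightarrow> real" assume "h \<in> {h. 1-lipschitz_on UNIV h}"
    then have L: "1-lipschitz_on UNIV h" by simp
    have hm: "h \<in> borel_measurable borel"
      using lipschitz_on_continuous_on[OF L] by (rule borel_measurable_continuous_onI)
    have lip: "\<bar>h s - h t\<bar> \<le> \<bar>s - t\<bar>" for s t using lipschitz_onD[OF L, of s t] by (simp add: dist_real_def)
    have ib: "integrable \<Omega> (\<lambda>x. h (V x))" if V: "integrable \<Omega> V" for V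
    proof (rule Bochner_Integration.integrable_bound[of _ "\<lambda>x. \<bar>h 0\<bar> + \<bar>V x\<bar>"])
      show "AE x in \<Omega>. norm (h (V x)) \<le> norm (\<bar>h 0\<bar> + \<bar>V x\<bar>)"
      proof (rule AE_I2)
        fix x show "norm (h (V x)) \<le> norm (\<bar>h 0\<bar> + \<bar>V x\<bar>)" using lip[of "V x" 0] by simp
      qed
    qed (use V hm in auto)
    have "\<bar>(\<integral>\<omega>. h (X n \<omega>) \<partial>M n) - (\<integral>\<omega>. h (Z \<omega>) \<partial>N)\<bar> = \<bar>\<integral>x. h (Yn n x) - h (Y x) \<partial>\<Omega>\<bar>"
      unfolding tr(1)[OF hm, of n, symmetric] tr'(1)[OF hm, symmetric]
      by (subst Bochner_Integration.integral_diff[OF ib[OF iYn[of n]] ib[OF iY]]) (rule refl)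
    also have "\<dots> \<le> (\<integral>x. \<bar>h (Yn n x) - h (Y x)\<bar> \<partial>\<Omega>)" by (rule integral_abs_bound)
    also have "\<dots> \<le> E n"
      unfolding E_def using ib[OF iYn[of n]] ib[OF iY] iE lip by (intro integral_mono) auto
    finally show "ennreal \<bar>(\<integral>\<omega>. h (X n \<omega>) \<partial>M n) - (\<integral>\<omega>. h (Z \<omega>) \<partial>N)\<bar> \<le> ennreal (E n)"
      by (rule ennreal_leI)
  qed
  have "(\<lambda>n. ennreal (E n)) \<longlonglongrightarrow> ennreal 0" using Elim by (rule tendsto_ennrealI)
  then have lim0: "(\<lambda>n. ennreal (E n)) \<longlonglongrightarrow> 0" by simp
  show ?thesis
    by (rule tendsto_sandwich[OF _ _ tendsto_const lim0]) (simp_all add: le)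
qed

lemma wasserstein_dist_normal_limit:
  fixes M :: "nat \<Rightarrow> 'w measure" and X :: "nat \<Rightarrow> 'w \<Rightarrow> real" and N :: "'z measure" and Z :: "'z \<Rightarrow> real"
  assumes M: "\<And>n. prob_space (M n)" and X: "\<And>n. X n \<in> borel_measurable (M n)"
    and X2: "\<And>n. integrable (M n) (\<lambda>\<omega>. (X n \<omega>)\<^sup>2)" "\<And>n. (\<integral>\<omega>. (X n \<omega>)\<^sup>2 \<partial>M n) \<le> C"
    and N: "prob_space N" and Z: "distributed N lborel Z std_normal_density"
    and s: "\<And>n u. \<bar>(\<integral>\<omega>. X n \<omega> * sin (u * X n \<omega>) \<partial>M n) - (\<integral>\<omega>. u * cos (u * X n \<omega>) \<partial>M n)\<bar> \<le> \<delta> n * (\<bar>u\<bar> + u\<^sup>2)"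
      "\<And>n u. \<bar>(\<integral>\<omega>. X n \<omega> * cos (u * X n \<omega>) \<partial>M n) - (\<integral>\<omega>. - (u * sin (u * X n \<omega>)) \<partial>M n)\<bar> \<le> \<delta> n * (\<bar>u\<bar> + u\<^sup>2)"
    and \<delta>: "\<delta> \<longlonglongrightarrow> 0" "\<And>n. 0 \<le> \<delta> n"
  shows "(\<lambda>n. wasserstein_dist (M n) (X n) N Z) \<longlonglongrightarrow> 0"
proof (rule wasserstein_dist_tendsto_0[OF M X X2 N])
  interpret N: prob_space N by fact
  show Zm: "Z \<in> borel_measurable N" using distributed_measurable[OF Z] by simp
  show "integrable N (\<lambda>\<omega>. (Z \<omega>)\<^sup>2)"
    using distributed_integrable[OF Z, of "\<lambda>x. x\<^sup>2"] std_normal_moment_even[of 1]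
    by (auto simp: has_bochner_integral_iff)
  have dZ: "distr N borel Z = std_normal_distribution"
    using distributed_distr_eq_density[OF Z] by (metis distr_cong sets_lborel)
  have rdn: "real_distribution (distr (M n) borel (X n))" for n
    unfolding real_distribution_def real_distribution_axioms_def
    using prob_space.prob_space_distr[OF M X] by simp
  show "weak_conv_m (\<lambda>n. distr (M n) borel (X n)) (distr N borel Z)"
    unfolding dZ
  proof (rule levy_continuity[OF rdn real_dist_normal_dist])
    fix u :: real
    \<comment> \<open>\<open>c\<close> and \<open>d\<close> are the real and imaginary parts of the
      characteristic function. The sine estimate controls the derivative of \<open>c\<close>, the
      cosine estimate that of \<open>d\<close>; the initial values 1 and 0 lead to the limits
      \<open>exp (- u\<^sup>2 / 2)\<close> and 0.\<close>
    define c where "c n v = (\<integral>\<omega>. cos (v * X n \<omega>) \<partial>M n)" for n v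
    define d where "d n v = (\<integral>\<omega>. sin (v * X n \<omega>) \<partial>M n)" for n v
    have c0: "c n 0 = 1" "d n 0 = 0" for n using prob_space.prob_space[OF M] by (simp_all add: c_def d_def)
    have dc: "(c n has_real_derivative (\<integral>\<omega>. X n \<omega> * (- sin (v * X n \<omega>)) \<partial>M n)) (at v)" for n v
      unfolding c_def by (rule prob_space.DERIV_expectation_trig[OF M X X2(1), where g''="\<lambda>t. - cos t"])
        (auto intro!: derivative_eq_intros)
    have dd: "(d n has_real_derivative (\<integral>\<omega>. X n \<omega> * cos (v * X n \<omega>) \<partial>M n)) (at v)" for n v
      unfolding d_def by (rule prob_space.DERIV_expectation_trig[OF M X X2(1), where g''="\<lambda>t. - sin t"])
        (auto intro!: derivative_eq_intros)
    have ec: "\<bar>c n u - c n 0 * exp (- u\<^sup>2 / 2)\<bar> \<le> \<delta> n * ((\<bar>u\<bar> + u\<^sup>2) * \<bar>u\<bar>)" for n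
    proof (rule gaussian_ode_error[OF dc _ \<delta>(2)])
      fix v show "\<bar>(\<integral>\<omega>. X n \<omega> * (- sin (v * X n \<omega>)) \<partial>M n) + v * c n v\<bar> \<le> \<delta> n * (\<bar>v\<bar> + v\<^sup>2)"
        using s(1)[where n=n and u=v] by (simp add: c_def abs_minus_commute)
    qed
    have ed: "\<bar>d n u - d n 0 * exp (- u\<^sup>2 / 2)\<bar> \<le> \<delta> n * ((\<bar>u\<bar> + u\<^sup>2) * \<bar>u\<bar>)" for n
    proof (rule gaussian_ode_error[OF dd _ \<delta>(2)])
      fix v show "\<bar>(\<integral>\<omega>. X n \<omega> * cos (v * X n \<omega>) \<partial>M n) + v * d n v\<bar> \<le> \<delta> n * (\<bar>v\<bar> + v\<^sup>2)"
        using s(2)[where n=n and u=v] by (simp add: d_def)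
    qed
    have z: "(\<lambda>n. \<delta> n * ((\<bar>u\<bar> + u\<^sup>2) * \<bar>u\<bar>)) \<longlonglongrightarrow> 0" using \<delta>(1) by (rule tendsto_mult_left_zero)
    have cl: "(\<lambda>n. c n u) \<longlonglongrightarrow> exp (- u\<^sup>2 / 2)"
      by (rule LIM_zero_cancel, rule tendsto_rabs_zero_cancel, rule tendsto_sandwich[OF _ _ tendsto_const z])
        (use ec in \<open>auto simp: c0\<close>)
    have dl: "(\<lambda>n. d n u) \<longlonglongrightarrow> 0"
      by (rule tendsto_rabs_zero_cancel, rule tendsto_sandwich[OF _ _ tendsto_const z])
        (use ed in \<open>auto simp: c0\<close>)
    have ch: "char (distr (M n) borel (X n)) u = Complex (c n u) (d n u)" for n
    proof -
      interpret Mn: prob_space "M n" by (rule M)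
      have "char (distr (M n) borel (X n)) u = (\<integral>\<omega>. iexp (u * X n \<omega>) \<partial>M n)"
        unfolding char_def using X by (subst integral_distr) auto
      moreover have i: "integrable (M n) (\<lambda>\<omega>. iexp (u * X n \<omega>))"
        using X by (intro Mn.integrable_const_bound[of _ 1]) auto
      moreover have "Re (\<integral>\<omega>. iexp (u * X n \<omega>) \<partial>M n) = c n u" "Im (\<integral>\<omega>. iexp (u * X n \<omega>) \<partial>M n) = d n u"
        using integral_Re[OF i] integral_Im[OF i] by (simp_all add: c_def d_def Re_exp Im_exp)
      ultimately show ?thesis by (simp add: complex_eq_iff)
    qed
    have "(\<lambda>n. Complex (c n u) (d n u)) \<longlonglongrightarrow> Complex (exp (- u\<^sup>2 / 2)) 0"
      by (rule tendsto_Complex[OF cl dl])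
    then show "(\<lambda>n. char (distr (M n) borel (X n)) u) \<longlonglongrightarrow> char std_normal_distribution u"
      by (simp add: ch char_std_normal_distribution complex_of_real_def)
  qed
qed

section \<open>Asymptotics of the innovations\<close>

text \<open>The summands of \<open>\<delta>\<close> are, in order, the deviation of
  \<open>\<tau> * S2\<close> from 1, the deviation of the random variance from
  \<open>\<tau> * S2\<close>, the change of the compensator under insertion, and the Taylor
  remainder. The factors 4 come from \<open>(1 + R / r)\<^sup>2 \<le> 4\<close>, valid for
  \<open>r \<ge> R\<close>. The weight \<open>\<eta>\<close> allows the plain and the length
  functional to be treated at once.\<close>

lemma innovation_estimates:
  fixes \<xi> :: "'w \<Rightarrow> particle set" and M :: "'w measure" and \<eta> \<phi> :: "particle \<Rightarrow> real"
    and Q :: "particle measure" and R :: real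
  defines "m \<equiv> short_segment_law.hit_bound R"
  assumes Q: "short_segment_law Q R" and \<tau>: "\<tau> > 0" and \<beta>: "\<beta> \<ge> 0"
    and M: "prob_space M" "\<xi> \<in> measurable M config_space" "DLR \<tau> \<beta> Q (distr M config_space \<xi>)"
    and W: "convex W" "W \<in> sets borel" "bounded W" "cball 0 r \<subseteq> W" "r > 0" "r \<ge> R"
    and \<eta>: "\<eta> \<in> borel_measurable borel" "\<And>K. 0 \<le> \<eta> K" "\<And>K. K \<in> short_segments R \<Longrightarrow> \<eta> K \<le> H"
      "\<And>K v. K \<in> segments \<Longrightarrow> \<eta> (translate v K) = \<eta> K"
      "(\<integral>\<^sup>+K. ennreal ((\<eta> K)\<^sup>2) \<partial>Q) = 1"
    and \<phi>: "\<phi> = (\<lambda>K. \<eta> K * hit_functional \<tau> W K)"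
    and b: "b = H / sqrt (\<tau> * measure lborel W)" and H: "H \<ge> 0"
    and t: "t = \<tau> * \<beta> * m"
    and \<delta>: "\<delta> = ((1 + R / r)\<^sup>2 - 1) + 4 * t + 4 * H\<^sup>2 * t + 4 * H\<^sup>2 * (b * (1 + t)\<^sup>2)"
  shows "(\<lambda>\<omega>. innovation \<tau> \<beta> Q \<phi> (\<xi> \<omega>)) \<in> borel_measurable M"
    and "integrable M (\<lambda>\<omega>. (innovation \<tau> \<beta> Q \<phi> (\<xi> \<omega>))\<^sup>2)"
    and "(\<integral>\<omega>. (innovation \<tau> \<beta> Q \<phi> (\<xi> \<omega>))\<^sup>2 \<partial>M) \<le> 4 * H\<^sup>2 * (1 + t)"
    and "\<bar>(\<integral>\<omega>. innovation \<tau> \<beta> Q \<phi> (\<xi> \<omega>) * sin (u * innovation \<tau> \<beta> Q \<phi> (\<xi> \<omega>)) \<partial>M) -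
        (\<integral>\<omega>. u * cos (u * innovation \<tau> \<beta> Q \<phi> (\<xi> \<omega>)) \<partial>M)\<bar> \<le> \<delta> * (\<bar>u\<bar> + u\<^sup>2)"
    and "\<bar>(\<integral>\<omega>. innovation \<tau> \<beta> Q \<phi> (\<xi> \<omega>) * cos (u * innovation \<tau> \<beta> Q \<phi> (\<xi> \<omega>)) \<partial>M) -
        (\<integral>\<omega>. - (u * sin (u * innovation \<tau> \<beta> Q \<phi> (\<xi> \<omega>))) \<partial>M)\<bar> \<le> \<delta> * (\<bar>u\<bar> + u\<^sup>2)"
proof -
  interpret Q: short_segment_law Q R by (rule Q)
  define P where "P = distr M config_space \<xi>"
  have P: "prob_space P" "sets P = sets config_space"
    unfolding P_def using prob_space.prob_space_distr[OF M(1,2)] by simp_all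
  have shortP: "AE x in P. x \<subseteq> short_segments R"
    by (rule AE_gibbs_short[OF Q \<tau> \<beta> P]) (use M(3) in \<open>simp add: P_def\<close>)
  obtain s where s: "W \<subseteq> cball 0 s" using W(3) unfolding bounded_iff by (auto simp: subset_eq)
  have "0 \<in> W" using W(4,5) by auto
  then have "0 \<in> cball (0::real^2) s" using s by blast
  then have s0: "0 \<le> s" by simp
  define \<rho> where "\<rho> = s + R"
  have \<rho>0: "0 \<le> \<rho>" using s0 Q.R_pos by (simp add: \<rho>_def)
  obtain \<pi> where "gibbs_window Q R \<tau> \<beta> (cball 0 (\<rho> + 4 * R)) P \<pi>"
    using DLR_gibbs_window[OF Q \<tau> \<beta> P, of "\<rho> + 4 * R"] M(3) \<rho>0 Q.R_pos by (auto simp: P_def)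
  then interpret G: gibbs_window Q R \<tau> \<beta> "cball 0 (\<rho> + 4 * R)" P \<pi> .
  let ?V = "measure lborel W"
  have emW: "emeasure lborel W = ennreal ?V"
    using emeasure_bounded_finite[OF W(3)] by (intro emeasure_eq_ennreal_measure) auto
  have V: "?V > 0"
  proof -
    have "0 < measure lborel (cball (0::real^2) r)" using content_cball_pos[OF W(5), of "0::real^2"] by simp
    also have "\<dots> \<le> ?V"
      using W(2,4) emeasure_bounded_finite[OF W(3)] by (intro measure_mono_fmeasurable) (auto simp: fmeasurable_def)
    finally show ?thesis .
  qed
  have int: "interior W \<noteq> {}"
  proof -
    have "ball 0 r \<subseteq> interior W" using W(4) ball_subset_cball by (intro interior_maximal) (auto simp: subset_eq)
    then show ?thesis using W(5) by auto
  qed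
  let ?H = "{K\<in>segments. pts K \<inter> W \<noteq> {}}"
  have Hm [measurable]: "?H \<in> sets borel" by (rule measurable_segments_meet_convex[OF W(1,2) int])
  have b0: "0 \<le> b" using H V \<tau> by (simp add: b)
  have \<phi>_eq: "\<phi> K = \<eta> K * of_bool (pts K \<inter> W \<noteq> {}) / sqrt (\<tau> * ?V)" for K
    by (simp add: \<phi> hit_functional_def)
  have \<phi>_meets: "pts K \<inter> W \<noteq> {}" if "\<phi> K \<noteq> 0" for K using that by (auto simp: \<phi>_eq)
  interpret I: gibbs_innovation Q R \<tau> \<beta> \<rho> P \<pi> \<phi> b
  proof unfold_locales
    show "0 \<le> \<rho>" "0 \<le> b" "AE x in P. x \<subseteq> short_segments R" by fact+
    have "(\<lambda>K. indicator segments K * \<phi> K) = (\<lambda>K. indicator ?H K * \<eta> K / sqrt (\<tau> * ?V))"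
      by (auto simp: \<phi>_eq fun_eq_iff split: split_indicator)
    then show "(\<lambda>K. indicator segments K * \<phi> K) \<in> borel_measurable borel"
      using \<eta>(1) by simp
    show "0 \<le> \<phi> K" for K using \<eta>(2) V \<tau> by (simp add: \<phi>_eq)
    show "finite {K \<in> x \<inter> segments. \<phi> K \<noteq> 0}" if x: "locally_finite x" for x
    proof (rule finite_subset)
      have ne: "cball (0::real^2) s \<noteq> {}" using s0 by simp
      show "{K \<in> x \<inter> segments. \<phi> K \<noteq> 0} \<subseteq> {K\<in>x. hit K (Particle (cball 0 s))}"
        using \<phi>_meets s by (fastforce simp: hit_def pts_Particle[OF compact_cball ne])
      show "finite {K\<in>x. hit K (Particle (cball 0 s))}" by (rule finite_hits[OF x])
    qed
    show "\<phi> K \<le> b" if "K \<in> short_segments R" for K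
      using \<eta>(3)[OF that] \<eta>(2) H V \<tau> by (simp add: \<phi>_eq b divide_right_mono)
    show "norm (circumcentre K) \<le> \<rho>" if K: "K \<in> short_segments R" "\<phi> K \<noteq> 0" for K
    proof -
      obtain w where w: "w \<in> pts K" "w \<in> W" using \<phi>_meets[OF K(2)] by blast
      have "dist (circumcentre K) w \<le> R" using segment_pts_subset_cball[OF K(1)] w(1) by auto
      moreover have "norm w \<le> s" using w(2) s by auto
      ultimately show ?thesis
        using norm_triangle_sub[of "circumcentre K" w] by (simp add: dist_norm \<rho>_def)
    qed
  qed
  have c4: "(1 + R / r)\<^sup>2 \<le> 4"
  proof -
    have "0 \<le> 1 + R / r" "1 + R / r \<le> 2" using W(5,6) Q.R_pos by (simp_all add: divide_le_eq_1)
    then have "(1 + R / r)\<^sup>2 \<le> 2\<^sup>2" by (intro power_mono) auto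
    then show ?thesis by simp
  qed
  have wK: "I.w K = indicator (short_segments R) K * (\<eta> K * indicator ?H K / sqrt (\<tau> * ?V))" for K
    by (auto simp: I.w_def \<phi>_eq short_segments_def split: split_indicator)
  \<comment> \<open>The window contains the centres of all segments where \<open>w\<close> is
    nonzero, so its restriction is invisible to functions of \<open>w\<close> that vanish at
    0.\<close>
  have full: "(\<integral>\<^sup>+K. ennreal (f (I.w K)) \<partial>G.\<mu>) = (\<integral>\<^sup>+K. ennreal (f (I.w K)) \<partial>Q.ref)"
    if f: "f \<in> borel_measurable borel" "f 0 = 0" for f :: "real \<Rightarrow> real"
  proof -
    have "(\<integral>\<^sup>+K. ennreal (f (I.w K)) \<partial>G.\<mu>) = (\<integral>\<^sup>+K. indicator (centred_in (cball 0 (\<rho> + 4 * R))) K * ennreal (f (I.w K)) \<partial>Q.ref)"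
      using measurable_compose[OF I.w_measurable f(1)] by (intro G.nn_integral_\<mu>) simp
    also have "\<dots> = (\<integral>\<^sup>+K. ennreal (f (I.w K)) \<partial>Q.ref)"
    proof (rule nn_integral_cong)
      fix K show "indicator (centred_in (cball 0 (\<rho> + 4 * R))) K * ennreal (f (I.w K)) = ennreal (f (I.w K))"
        using I.w_centred[of K] f(2) by (cases "I.w K = 0") auto
    qed
    finally show ?thesis .
  qed
  have S1: "I.S1 \<le> 4 * b * ?V"
  proof -
    have "ennreal I.S1 = (\<integral>\<^sup>+K. ennreal (I.w K) \<partial>G.\<mu>)"
      unfolding I.S1_def using I.w_integrable I.w_nonneg by (intro nn_integral_eq_integral[symmetric]) auto
    also have "\<dots> = (\<integral>\<^sup>+K. ennreal (I.w K) \<partial>Q.ref)" using full[of "\<lambda>x. x"] by simp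
    also have "\<dots> \<le> (\<integral>\<^sup>+K. ennreal b * (1 * indicator ?H K) \<partial>Q.ref)"
    proof (rule nn_integral_mono)
      fix K show "ennreal (I.w K) \<le> ennreal b * (1 * indicator ?H K)"
      proof (cases "K \<in> ?H")
        case True
        then show ?thesis using ennreal_leI[OF I.w_le[of K]] by simp
      qed (simp add: wK)
    qed
    also have "\<dots> = ennreal b * (\<integral>\<^sup>+K. 1 * indicator ?H K \<partial>Q.ref)" by (intro nn_integral_cmult) auto
    also have "\<dots> \<le> ennreal b * ((\<integral>\<^sup>+K. 1 \<partial>Q) * (ennreal ((1 + R / r)\<^sup>2) * emeasure lborel W))"
      by (intro mult_left_mono Q.nn_integral_ref_meet_bounds(2)[OF W(1,2,4,5)]) auto
    also have "\<dots> \<le> ennreal b * (1 * (ennreal 4 * ennreal ?V))"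
      unfolding emW using c4 Q.emeasure_space_1 by (intro mult_mono ennreal_leI) auto
    also have "\<dots> = ennreal (4 * b * ?V)" using b0 by (simp add: ennreal_mult mult_ac)
    finally show ?thesis using b0 by simp
  qed
  \<comment> \<open>The square of \<open>w\<close> carries the factor
    \<open>1 / (\<tau> * V)\<close>, with \<open>V\<close> the area of \<open>W\<close>; since
    \<open>(\<eta> K)\<^sup>2\<close> has integral 1, the bounds for segments meeting
    \<open>W\<close> become bounds for the variance.\<close>
  have S2: "1 \<le> \<tau> * I.S2" "\<tau> * I.S2 \<le> (1 + R / r)\<^sup>2"
  proof -
    define G where "G = (\<integral>\<^sup>+K. ennreal ((\<eta> K)\<^sup>2) * indicator ?H K \<partial>Q.ref)"
    have mh: "(\<lambda>K. ennreal ((\<eta> K)\<^sup>2)) \<in> borel_measurable borel" using \<eta>(1) by measurable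
    have inv: "ennreal ((\<eta> (translate v K))\<^sup>2) = ennreal ((\<eta> K)\<^sup>2)" if "K \<in> segments" for K v
      using \<eta>(4)[OF that] by simp
    have G: "ennreal ?V \<le> G" "G \<le> ennreal ((1 + R / r)\<^sup>2 * ?V)"
      using Q.nn_integral_ref_meet_bounds[OF W(1,2,4,5) mh inv] \<eta>(5)
      by (simp_all add: G_def emW ennreal_mult)
    have "ennreal I.S2 = (\<integral>\<^sup>+K. ennreal ((I.w K)\<^sup>2) \<partial>G.\<mu>)"
      unfolding I.S2_def using I.w2_integrable by (intro nn_integral_eq_integral[symmetric]) auto
    also have "\<dots> = (\<integral>\<^sup>+K. ennreal ((I.w K)\<^sup>2) \<partial>Q.ref)" using full[of "\<lambda>x. x\<^sup>2"] by simp
    also have "\<dots> = (\<integral>\<^sup>+K. ennreal (1 / (\<tau> * ?V)) * (ennreal ((\<eta> K)\<^sup>2) * indicator ?H K) \<partial>Q.ref)"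
    proof (rule nn_integral_cong_AE, use Q.AE_ref_short in eventually_elim)
      fix K assume "K \<in> short_segments R"
      then have "(I.w K)\<^sup>2 = 1 / (\<tau> * ?V) * ((\<eta> K)\<^sup>2 * indicator ?H K)"
        using V \<tau> by (simp add: wK power_divide power_mult_distrib split: split_indicator)
      then show "ennreal ((I.w K)\<^sup>2) = ennreal (1 / (\<tau> * ?V)) * (ennreal ((\<eta> K)\<^sup>2) * indicator ?H K)"
        using V \<tau> by (simp only:) (subst ennreal_mult, simp, simp, simp add: ennreal_mult ennreal_indicator)
    qed
    also have "\<dots> = ennreal (1 / (\<tau> * ?V)) * G"
      unfolding G_def using mh Hm
      by (intro nn_integral_cmult borel_measurable_times_ennreal borel_measurable_indicator) auto
    finally have e: "ennreal I.S2 = ennreal (1 / (\<tau> * ?V)) * G" .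
    have "ennreal (1 / (\<tau> * ?V) * ?V) = ennreal (1 / (\<tau> * ?V)) * ennreal ?V" using V \<tau> by (intro ennreal_mult) auto
    also have "\<dots> \<le> ennreal I.S2" unfolding e using G(1) by (rule mult_left_mono) simp
    finally have "1 / (\<tau> * ?V) * ?V \<le> I.S2"
      using I.S2_nonneg by (subst (asm) ennreal_le_iff) auto
    then have "1 / \<tau> \<le> I.S2" using V by simp
    then show "1 \<le> \<tau> * I.S2" using \<tau> by (simp add: pos_divide_le_eq mult.commute)
    have "ennreal I.S2 \<le> ennreal (1 / (\<tau> * ?V)) * ennreal ((1 + R / r)\<^sup>2 * ?V)" unfolding e using G(2) by (rule mult_left_mono) simp
    also have "\<dots> = ennreal (1 / (\<tau> * ?V) * ((1 + R / r)\<^sup>2 * ?V))" using V \<tau> by (intro ennreal_mult[symmetric]) auto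
    finally have "I.S2 \<le> 1 / (\<tau> * ?V) * ((1 + R / r)\<^sup>2 * ?V)"
      using V \<tau> by (subst (asm) ennreal_le_iff) auto
    then have "I.S2 \<le> (1 + R / r)\<^sup>2 / \<tau>" using V by simp
    then show "\<tau> * I.S2 \<le> (1 + R / r)\<^sup>2" using \<tau> by (simp add: pos_le_divide_eq mult.commute)
  qed
  have t0: "0 \<le> t" using \<tau> \<beta> Q.hit_bound_def by (simp add: t m_def)
  have rm: "I.r_max = b * t" by (simp add: I.r_max_def t m_def mult_ac)
  \<comment> \<open>Here the area cancels: \<open>S1\<close> is at most \<open>4 * b\<close> times
    the area, and \<open>b\<^sup>2\<close> times \<open>\<tau>\<close> times the area is
    \<open>H\<^sup>2\<close>.\<close>
  have Sb: "\<tau> * I.S1 * b \<le> 4 * H\<^sup>2"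
  proof -
    have "\<tau> * I.S1 * b \<le> \<tau> * (4 * b * ?V) * b" using S1 \<tau> b0 by (intro mult_right_mono mult_left_mono) auto
    also have "\<dots> = 4 * (b\<^sup>2 * (\<tau> * ?V))" by (simp add: power2_eq_square)
    also have "b\<^sup>2 * (\<tau> * ?V) = H\<^sup>2" using V \<tau> by (simp add: b power_divide)
    finally show ?thesis .
  qed
  have tS: "\<tau> * I.S1 * (b + I.r_max) \<le> 4 * H\<^sup>2 * (1 + t)"
  proof -
    have "\<tau> * I.S1 * (b + I.r_max) = (\<tau> * I.S1 * b) * (1 + t)" by (simp add: rm algebra_simps)
    also have "\<dots> \<le> 4 * H\<^sup>2 * (1 + t)" using Sb t0 by (intro mult_right_mono) auto
    finally show ?thesis .
  qed
  let ?X = "\<lambda>\<omega>. innovation \<tau> \<beta> Q \<phi> (\<xi> \<omega>)"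
  have X: "?X \<omega> = I.F (\<xi> \<omega>)" for \<omega> by (simp add: I.F_def)
  note M(2)[measurable]
  show Xm: "?X \<in> borel_measurable M" unfolding X by measurable
  have tr: "(\<integral>x. h (I.F x) \<partial>P) = (\<integral>\<omega>. h (?X \<omega>) \<partial>M)" if "h \<in> borel_measurable borel" for h :: "real \<Rightarrow> real"
    unfolding X P_def using that by (intro integral_distr) auto
  show "integrable M (\<lambda>\<omega>. (?X \<omega>)\<^sup>2)"
    unfolding X using I.second_moment_P(1) unfolding P_def by (rule integrable_distr[OF M(2)])
  show "(\<integral>\<omega>. (?X \<omega>)\<^sup>2 \<partial>M) \<le> 4 * H\<^sup>2 * (1 + t)"
    using I.second_moment_P(2) tS tr[of "\<lambda>x. x\<^sup>2"] by simp
  have err: "\<bar>u\<bar> * (\<bar>\<tau> * I.S2 - 1\<bar> + \<tau> * \<beta> * I.S2 * (\<tau> * Q.hit_bound)) +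
      \<tau> * I.S1 * (\<bar>u\<bar> * I.r_max + u\<^sup>2 * (b + I.r_max)\<^sup>2) \<le> \<delta> * (\<bar>u\<bar> + u\<^sup>2)" for u
  proof -
    have "\<tau> * \<beta> * I.S2 * (\<tau> * Q.hit_bound) = (\<tau> * I.S2) * t" by (simp add: t m_def mult_ac)
    also have "\<dots> \<le> 4 * t" using S2 c4 t0 by (intro mult_right_mono) auto
    finally have d1: "\<bar>\<tau> * I.S2 - 1\<bar> + \<tau> * \<beta> * I.S2 * (\<tau> * Q.hit_bound) \<le> ((1 + R / r)\<^sup>2 - 1) + 4 * t"
      using S2 by simp
    have "\<tau> * I.S1 * I.r_max = (\<tau> * I.S1 * b) * t" by (simp add: rm)
    also have "\<dots> \<le> 4 * H\<^sup>2 * t" using Sb t0 by (intro mult_right_mono) auto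
    finally have d2: "\<tau> * I.S1 * I.r_max \<le> 4 * H\<^sup>2 * t" .
    have "\<tau> * I.S1 * (b + I.r_max)\<^sup>2 = (\<tau> * I.S1 * b) * (b * (1 + t)\<^sup>2)"
      by (simp add: rm power2_eq_square algebra_simps)
    also have "\<dots> \<le> 4 * H\<^sup>2 * (b * (1 + t)\<^sup>2)" using Sb b0 by (intro mult_right_mono) auto
    finally have d3: "\<tau> * I.S1 * (b + I.r_max)\<^sup>2 \<le> 4 * H\<^sup>2 * (b * (1 + t)\<^sup>2)" .
    let ?a = "((1 + R / r)\<^sup>2 - 1) + 4 * t + 4 * H\<^sup>2 * t" and ?d = "4 * H\<^sup>2 * (b * (1 + t)\<^sup>2)"
    have ad: "0 \<le> ?a" "0 \<le> ?d" using S2 t0 b0 by simp_all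
    have "\<bar>u\<bar> * (\<bar>\<tau> * I.S2 - 1\<bar> + \<tau> * \<beta> * I.S2 * (\<tau> * Q.hit_bound)) +
        \<tau> * I.S1 * (\<bar>u\<bar> * I.r_max + u\<^sup>2 * (b + I.r_max)\<^sup>2)
      = \<bar>u\<bar> * ((\<bar>\<tau> * I.S2 - 1\<bar> + \<tau> * \<beta> * I.S2 * (\<tau> * Q.hit_bound)) + \<tau> * I.S1 * I.r_max) +
        u\<^sup>2 * (\<tau> * I.S1 * (b + I.r_max)\<^sup>2)" by (simp add: algebra_simps)
    also have "\<dots> \<le> \<bar>u\<bar> * ?a + u\<^sup>2 * ?d"
    proof (rule add_mono; rule mult_left_mono)
      show "(\<bar>\<tau> * I.S2 - 1\<bar> + \<tau> * \<beta> * I.S2 * (\<tau> * Q.hit_bound)) + \<tau> * I.S1 * I.r_max \<le> ?a"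
        using add_mono[OF d1 d2] .
    qed (use d3 in auto)
    \<comment> \<open>Both coefficients are enlarged to their sum, so that a single
      \<open>\<delta>\<close> serves both powers of \<open>u\<close>.\<close>
    also have "\<dots> \<le> \<bar>u\<bar> * (?a + ?d) + u\<^sup>2 * (?a + ?d)"
    proof (rule add_mono; rule mult_left_mono)
      show "?a \<le> ?a + ?d" "?d \<le> ?a + ?d" using ad by linarith+
    qed auto
    also have "\<dots> = \<delta> * (\<bar>u\<bar> + u\<^sup>2)" by (simp add: \<delta> algebra_simps)
    finally show ?thesis .
  qed
  have cos_le: "\<bar>u * cos (u * x)\<bar> \<le> \<bar>u\<bar>" "\<bar>- (u * sin (u * x))\<bar> \<le> \<bar>u\<bar>" for x
    using abs_cos_le_one[of "u * x"] abs_sin_le_one[of "u * x"] by (simp_all add: abs_mult mult_left_le)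
  have cos2_le: "\<bar>- (u\<^sup>2 * cos (u * x))\<bar> \<le> u\<^sup>2" "\<bar>- (u\<^sup>2 * sin (u * x))\<bar> \<le> u\<^sup>2" for x
    using abs_cos_le_one[of "u * x"] abs_sin_le_one[of "u * x"] by (simp_all add: abs_mult mult_left_le)
  have trs: "(\<integral>x. I.F x * sin (u * I.F x) \<partial>P) = (\<integral>\<omega>. ?X \<omega> * sin (u * ?X \<omega>) \<partial>M)"
    "(\<integral>x. u * cos (u * I.F x) \<partial>P) = (\<integral>\<omega>. u * cos (u * ?X \<omega>) \<partial>M)"
    "(\<integral>x. I.F x * cos (u * I.F x) \<partial>P) = (\<integral>\<omega>. ?X \<omega> * cos (u * ?X \<omega>) \<partial>M)"
    "(\<integral>x. - (u * sin (u * I.F x)) \<partial>P) = (\<integral>\<omega>. - (u * sin (u * ?X \<omega>)) \<partial>M)"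
    by (rule tr[of "\<lambda>x. x * sin (u * x)"] tr[of "\<lambda>x. u * cos (u * x)"]
        tr[of "\<lambda>x. x * cos (u * x)"] tr[of "\<lambda>x. - (u * sin (u * x))"]; measurable)+
  have ds: "((\<lambda>x. sin (u * x)) has_real_derivative u * cos (u * x)) (at x)"
    "((\<lambda>x. u * cos (u * x)) has_real_derivative - (u\<^sup>2 * sin (u * x))) (at x)"
    "((\<lambda>x. cos (u * x)) has_real_derivative - (u * sin (u * x))) (at x)"
    "((\<lambda>x. - (u * sin (u * x))) has_real_derivative - (u\<^sup>2 * cos (u * x))) (at x)" for x
    by (auto intro!: derivative_eq_intros simp: power2_eq_square)
  have "\<bar>(\<integral>x. I.F x * sin (u * I.F x) \<partial>P) - (\<integral>x. u * cos (u * I.F x) \<partial>P)\<bar>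
      \<le> \<bar>u\<bar> * (\<bar>\<tau> * I.S2 - 1\<bar> + \<tau> * \<beta> * I.S2 * (\<tau> * Q.hit_bound)) + \<tau> * I.S1 * (\<bar>u\<bar> * I.r_max + u\<^sup>2 * (b + I.r_max)\<^sup>2)"
    by (rule I.stein_bound[of "\<lambda>x. sin (u * x)" 1 "\<lambda>x. u * cos (u * x)" "\<lambda>x. - (u\<^sup>2 * sin (u * x))"])
      (rule ds cos_le cos2_le abs_sin_le_one abs_cos_le_one)+
  then show "\<bar>(\<integral>\<omega>. ?X \<omega> * sin (u * ?X \<omega>) \<partial>M) - (\<integral>\<omega>. u * cos (u * ?X \<omega>) \<partial>M)\<bar> \<le> \<delta> * (\<bar>u\<bar> + u\<^sup>2)"
    unfolding trs using err[of u] by (rule order_trans)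
  have "\<bar>(\<integral>x. I.F x * cos (u * I.F x) \<partial>P) - (\<integral>x. - (u * sin (u * I.F x)) \<partial>P)\<bar>
      \<le> \<bar>u\<bar> * (\<bar>\<tau> * I.S2 - 1\<bar> + \<tau> * \<beta> * I.S2 * (\<tau> * Q.hit_bound)) + \<tau> * I.S1 * (\<bar>u\<bar> * I.r_max + u\<^sup>2 * (b + I.r_max)\<^sup>2)"
    by (rule I.stein_bound[of "\<lambda>x. cos (u * x)" 1 "\<lambda>x. - (u * sin (u * x))" "\<lambda>x. - (u\<^sup>2 * cos (u * x))"])
      (rule ds cos_le cos2_le abs_sin_le_one abs_cos_le_one)+
  then show "\<bar>(\<integral>\<omega>. ?X \<omega> * cos (u * ?X \<omega>) \<partial>M) - (\<integral>\<omega>. - (u * sin (u * ?X \<omega>)) \<partial>M)\<bar> \<le> \<delta> * (\<bar>u\<bar> + u\<^sup>2)"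
    unfolding trs using err[of u] by (rule order_trans)
qed

text \<open>A square around the disc is the hull of finitely many points. Each of them eventually
  belongs to \<open>W n\<close>, because the sequence increases to the plane, and convexity adds the
  hull.\<close>

lemma convex_averaging_cball:
  assumes W: "convex_averaging W"
  shows "eventually (\<lambda>n. cball 0 r \<subseteq> W n) sequentially"
proof -
  \<comment> \<open>The half side \<open>max r 1\<close> keeps the square nondegenerate for every
    real \<open>r\<close>.\<close>
  have d: "(0::real) < max r 1" by simp
  obtain S :: "(real^2) set" where S: "finite S"
    "cbox (0 - (\<Sum>i\<in>Basis. max r 1 *\<^sub>R i)) (0 + (\<Sum>i\<in>Basis. max r 1 *\<^sub>R i)) = convex hull S"
    using cube_convex_hull[OF d, of "0::real^2"] by blast
  have "eventually (\<lambda>n. \<forall>x\<in>S. x \<in> W n) sequentially"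
  proof (rule eventually_ball_finite[OF S(1)], rule ballI)
    fix x :: "real^2"
    have "x \<in> (\<Union>n. W n)" using W by (simp add: convex_averaging_def)
    then obtain k where "x \<in> W k" by blast
    then show "eventually (\<lambda>n. x \<in> W n) sequentially"
      using W unfolding convex_averaging_def eventually_sequentially by (meson incseqD subsetD)
  qed
  then show ?thesis
  proof eventually_elim
    fix n assume "\<forall>x\<in>S. x \<in> W n"
    then have "convex hull S \<subseteq> W n" using W by (intro hull_minimal) (auto simp: convex_averaging_def)
    moreover have "cball 0 r \<subseteq> cbox (0 - (\<Sum>i\<in>Basis. max r 1 *\<^sub>R i)) (0 + (\<Sum>i\<in>Basis. max r 1 *\<^sub>R i :: real^2))"
    proof
      fix x :: "real^2" assume "x \<in> cball 0 r"
      then have "norm x \<le> max r 1" by simp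
      moreover have "\<bar>x \<bullet> i\<bar> \<le> norm x" if "i \<in> Basis" for i using that by (rule Basis_le_norm)
      ultimately have "\<bar>x \<bullet> i\<bar> \<le> max r 1" if "i \<in> Basis" for i using that by (meson order_trans)
      then show "x \<in> cbox (0 - (\<Sum>i\<in>Basis. max r 1 *\<^sub>R i)) (0 + (\<Sum>i\<in>Basis. max r 1 *\<^sub>R i))"
        by (simp add: mem_box abs_le_iff inner_sum_left_Basis minus_le_iff del: max.bounded_iff le_max_iff_disj)
    qed
    ultimately show "cball 0 r \<subseteq> W n" using S(2) by blast
  qed
qed

lemma convex_averaging_radii:
  assumes W: "convex_averaging W"
  obtains r :: "nat \<Rightarrow> real" where "filterlim r at_top sequentially"
    "eventually (\<lambda>n. cball 0 (r n) \<subseteq> W n) sequentially"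
proof
  \<comment> \<open>The cap \<open>k \<le> n\<close> bounds the candidates, so that a greatest one
    exists, and still lets the radii tend to infinity.\<close>
  define p where "p n k \<longleftrightarrow> k \<le> n \<and> cball 0 (real k) \<subseteq> W n" for n k
  define r where "r n = (GREATEST k. p n k)" for n
  have ev: "eventually (\<lambda>n. k \<le> r n \<and> p n (r n)) sequentially" for k
    using convex_averaging_cball[OF W, of "real k"] eventually_ge_at_top[of k]
  proof eventually_elim
    fix n assume "cball 0 (real k) \<subseteq> W n" "k \<le> n"
    then have pk: "p n k" by (simp add: p_def)
    have bd: "\<And>j. p n j \<Longrightarrow> j \<le> n" by (simp add: p_def)
    show "k \<le> r n \<and> p n (r n)"
      unfolding r_def using Greatest_le_nat[of "p n" k n] GreatestI_nat[of "p n" k n] pk bd by blast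
  qed
  show "filterlim (\<lambda>n. real (r n)) at_top sequentially"
    unfolding filterlim_at_top
  proof
    fix Z :: real
    obtain k :: nat where "Z \<le> real k" using real_arch_simple by blast
    then show "eventually (\<lambda>n. Z \<le> real (r n)) sequentially"
      using ev[of k] by (auto elim!: eventually_mono)
  qed
  show "eventually (\<lambda>n. cball 0 (real (r n)) \<subseteq> W n) sequentially"
    using ev[of 0] by (auto elim!: eventually_mono simp: p_def)
qed

text \<open>With discs of radius \<open>r n\<close> inside \<open>W n\<close>, every error term
  vanishes: \<open>R / r n\<close> since the radii grow, \<open>t n\<close> since
  \<open>\<tau> n\<close> is bounded and \<open>\<beta> n\<close> tends to 0, and \<open>b n\<close>
  since the area grows while \<open>\<tau> n\<close> stays above \<open>c1\<close>.\<close>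

lemma innovation_normal_limit:
  fixes M :: "nat \<Rightarrow> 'w measure" and \<xi> :: "nat \<Rightarrow> 'w \<Rightarrow> particle set" and N :: "'z measure" and Z :: "'z \<Rightarrow> real"
  assumes Q: "short_segment_law Q R" and \<tau>: "0 < c1" "\<And>n. c1 < \<tau> n" "\<And>n. \<tau> n < c2" and \<beta>: "\<And>n. \<beta> n \<ge> 0" "\<beta> \<longlonglongrightarrow> 0"
    and gibbs: "\<And>n. stationary_gibbs (\<tau> n) (\<beta> n) Q (M n) (\<xi> n)"
    and W: "convex_averaging W"
    and \<eta>: "\<eta> \<in> borel_measurable borel" "\<And>K. 0 \<le> \<eta> K" "\<And>K. K \<in> short_segments R \<Longrightarrow> \<eta> K \<le> H" "H \<ge> 0"
      "\<And>K v. K \<in> segments \<Longrightarrow> \<eta> (translate v K) = \<eta> K"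
      "(\<integral>\<^sup>+K. ennreal ((\<eta> K)\<^sup>2) \<partial>Q) = 1"
    and N: "prob_space N" and Z: "distributed N lborel Z std_normal_density"
  shows "(\<lambda>n. wasserstein_dist (M n)
      (\<lambda>\<omega>. innovation (\<tau> n) (\<beta> n) Q (\<lambda>K. \<eta> K * hit_functional (\<tau> n) (W n) K) (\<xi> n \<omega>)) N Z) \<longlonglongrightarrow> 0"
proof -
  interpret Q: short_segment_law Q R by (rule Q)
  define m where "m = short_segment_law.hit_bound R"
  have m0: "0 \<le> m" by (simp add: m_def Q.hit_bound_def)
  define k where "k = unit_ball_vol (real DIM(real^2))"
  have k: "0 < k" by (simp add: k_def unit_ball_vol_pos)
  obtain r where r: "filterlim r at_top sequentially" "eventually (\<lambda>n. cball 0 (r n) \<subseteq> W n) sequentially"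
    using convex_averaging_radii[OF W] .
  have "eventually (\<lambda>n. R \<le> r n) sequentially" using r(1) by (simp add: filterlim_at_top)
  then have "eventually (\<lambda>n. R \<le> r n \<and> cball 0 (r n) \<subseteq> W n) sequentially"
    using r(2) by eventually_elim simp
  then obtain n0 where n0: "\<And>n. n \<ge> n0 \<Longrightarrow> R \<le> r n \<and> cball 0 (r n) \<subseteq> W n"
    unfolding eventually_sequentially by blast
  define t where "t n = \<tau> n * \<beta> n * m" for n
  define b where "b n = H / sqrt (\<tau> n * measure lborel (W n))" for n
  define \<delta> where "\<delta> n = ((1 + R / r n)\<^sup>2 - 1) + 4 * t n + 4 * H\<^sup>2 * t n + 4 * H\<^sup>2 * (b n * (1 + t n)\<^sup>2)" for n
  have \<tau>0: "0 < \<tau> n" for n using \<tau>(1) \<tau>(2)[of n] by linarith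
  have t0: "0 \<le> t n" for n using \<tau>0[of n] \<beta>(1)[of n] m0 by (simp add: t_def)
  have tc: "t n \<le> c2 * \<beta> n * m" for n
    unfolding t_def using \<tau>(3)[of n] \<beta>(1)[of n] m0 by (intro mult_right_mono) auto
  have tlim: "t \<longlonglongrightarrow> 0"
  proof (rule tendsto_sandwich[OF _ _ tendsto_const])
    show "(\<lambda>n. c2 * \<beta> n * m) \<longlonglongrightarrow> 0"
      using tendsto_mult_right_zero[OF \<beta>(2), of c2] by (rule tendsto_mult_left_zero)
  qed (auto simp: t0 tc)
  have blim: "b \<longlonglongrightarrow> 0"
  proof (rule tendsto_sandwich[OF _ _ tendsto_const])
    have "filterlim (\<lambda>n. sqrt (c1 * k) * r n) at_top sequentially"
      using \<tau>(1) k by (intro filterlim_tendsto_pos_mult_at_top[OF tendsto_const _ r(1)]) simp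
    then show "(\<lambda>n. H / (sqrt (c1 * k) * r n)) \<longlonglongrightarrow> 0"
      by (intro tendsto_divide_0[OF tendsto_const] filterlim_at_top_imp_at_infinity)
    show "eventually (\<lambda>n. 0 \<le> b n) sequentially"
      using \<eta>(4) \<tau>0 by (intro always_eventually allI) (simp add: b_def less_imp_le)
    show "eventually (\<lambda>n. b n \<le> H / (sqrt (c1 * k) * r n)) sequentially"
      unfolding eventually_sequentially
    proof (intro exI[of _ n0] allI impI)
      fix n assume n: "n \<ge> n0"
      have rn: "0 < r n" using n0[OF n] Q.R_pos by linarith
      have bdd: "bounded (W n)" "W n \<in> sets borel" using W by (auto simp: convex_averaging_def)
      \<comment> \<open>The disc inside \<open>W n\<close> bounds its area from below,
        \<open>k\<close> being the area of the unit disc; this converts growing radii into a bound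
        for \<open>b n\<close>.\<close>
      have "k * (r n)\<^sup>2 = measure lborel (cball (0::real^2) (r n))"
        using content_cball[of "r n" "0::real^2"] rn by (simp add: k_def)
      also have "\<dots> \<le> measure lborel (W n)"
        using n0[OF n] bdd emeasure_bounded_finite[OF bdd(1)]
        by (intro measure_mono_fmeasurable) (auto simp: fmeasurable_def)
      finally have "c1 * (k * (r n)\<^sup>2) \<le> \<tau> n * measure lborel (W n)"
        using \<tau>(1) \<tau>(2)[of n] k by (intro mult_mono) auto
      then have "sqrt (c1 * (k * (r n)\<^sup>2)) \<le> sqrt (\<tau> n * measure lborel (W n))" by simp
      moreover have "sqrt (c1 * (k * (r n)\<^sup>2)) = sqrt (c1 * k) * r n"
        using rn by (simp add: real_sqrt_mult)
      ultimately have "sqrt (c1 * k) * r n \<le> sqrt (\<tau> n * measure lborel (W n))" by simp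
      moreover have "0 < sqrt (c1 * k) * r n" using \<tau>(1) k rn by simp
      ultimately show "b n \<le> H / (sqrt (c1 * k) * r n)"
        unfolding b_def using \<eta>(4) mult_pos_pos[of "sqrt (\<tau> n * measure lborel (W n))" "sqrt (c1 * k) * r n"]
        by (intro divide_left_mono) linarith+
    qed
  qed
  have \<delta>lim: "\<delta> \<longlonglongrightarrow> 0"
  proof -
    have "(\<lambda>n. R / r n) \<longlonglongrightarrow> 0"
      by (intro tendsto_divide_0[OF tendsto_const] filterlim_at_top_imp_at_infinity r)
    then have "(\<lambda>n. ((1 + R / r n)\<^sup>2 - 1) + 4 * t n + 4 * H\<^sup>2 * t n + 4 * H\<^sup>2 * (b n * (1 + t n)\<^sup>2))
        \<longlonglongrightarrow> ((1 + 0)\<^sup>2 - 1) + 4 * 0 + 4 * H\<^sup>2 * 0 + 4 * H\<^sup>2 * (0 * (1 + 0)\<^sup>2)"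
      by (intro tendsto_intros tlim blim)
    then show ?thesis by (simp add: \<delta>_def[abs_def])
  qed
  \<comment> \<open>The second moments must be bounded by one constant for all indices; a convergent
    sequence is bounded, which bounds \<open>t\<close>.\<close>
  obtain C where C: "\<And>n. \<bar>\<beta> n\<bar> \<le> C" using convergent_imp_Bseq[OF convergentI[OF \<beta>(2)]] by (auto simp: Bseq_def)
  have Wn: "convex (W n)" "W n \<in> sets borel" "bounded (W n)" for n using W by (auto simp: convex_averaging_def)
  have Mn: "prob_space (M n)" "\<xi> n \<in> measurable (M n) config_space" "DLR (\<tau> n) (\<beta> n) Q (distr (M n) config_space (\<xi> n))" for n
    using gibbs[of n] by (auto simp: stationary_gibbs_def)
  have rn: "0 < r n" if "n \<ge> n0" for n using n0[OF that] Q.R_pos by linarith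
  note est = innovation_estimates[OF Q \<tau>0 \<beta>(1) Mn Wn _ _ _ \<eta>(1,2,3,5,6) refl b_def \<eta>(4) t_def[unfolded m_def] \<delta>_def]
  let ?X = "\<lambda>n \<omega>. innovation (\<tau> n) (\<beta> n) Q (\<lambda>K. \<eta> K * hit_functional (\<tau> n) (W n) K) (\<xi> n \<omega>)"
  \<comment> \<open>The estimates need a disc of radius at least \<open>R\<close> inside
    \<open>W n\<close>, available from \<open>n0\<close> on only, so the sequence is shifted by
    \<open>n0\<close>.\<close>
  have "(\<lambda>n. wasserstein_dist (M (n + n0)) (?X (n + n0)) N Z) \<longlonglongrightarrow> 0"
  proof (rule wasserstein_dist_normal_limit[where \<delta>="\<lambda>n. \<delta> (n + n0)" and C="4 * H\<^sup>2 * (1 + c2 * C * m)"])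
    fix n u
    have n: "n + n0 \<ge> n0" by simp
    show "prob_space (M (n + n0))" by (rule Mn)
    show "?X (n + n0) \<in> borel_measurable (M (n + n0))"
      using n0[OF n] rn[OF n] by (intro est(1)) auto
    show "integrable (M (n + n0)) (\<lambda>\<omega>. (?X (n + n0) \<omega>)\<^sup>2)"
      using n0[OF n] rn[OF n] by (intro est(2)) auto
    have "t (n + n0) \<le> c2 * C * m"
    proof -
      have "0 < c2" using \<tau>(3)[of 0] \<tau>0[of 0] by linarith
      moreover have "\<beta> (n + n0) \<le> C" using C[of "n + n0"] by simp
      ultimately have "c2 * \<beta> (n + n0) * m \<le> c2 * C * m" using m0 by (intro mult_right_mono mult_left_mono) auto
      with tc[of "n + n0"] show ?thesis by simp
    qed
    then have "4 * H\<^sup>2 * (1 + t (n + n0)) \<le> 4 * H\<^sup>2 * (1 + c2 * C * m)" by (intro mult_left_mono) auto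
    moreover have "(\<integral>\<omega>. (?X (n + n0) \<omega>)\<^sup>2 \<partial>M (n + n0)) \<le> 4 * H\<^sup>2 * (1 + t (n + n0))"
      using n0[OF n] rn[OF n] by (intro est(3)) auto
    ultimately show "(\<integral>\<omega>. (?X (n + n0) \<omega>)\<^sup>2 \<partial>M (n + n0)) \<le> 4 * H\<^sup>2 * (1 + c2 * C * m)" by simp
    show "\<bar>(\<integral>\<omega>. ?X (n + n0) \<omega> * sin (u * ?X (n + n0) \<omega>) \<partial>M (n + n0)) - (\<integral>\<omega>. u * cos (u * ?X (n + n0) \<omega>) \<partial>M (n + n0))\<bar>
        \<le> \<delta> (n + n0) * (\<bar>u\<bar> + u\<^sup>2)"
      using n0[OF n] rn[OF n] by (intro est(4)) auto
    show "\<bar>(\<integral>\<omega>. ?X (n + n0) \<omega> * cos (u * ?X (n + n0) \<omega>) \<partial>M (n + n0)) - (\<integral>\<omega>. - (u * sin (u * ?X (n + n0) \<omega>)) \<partial>M (n + n0))\<bar>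
        \<le> \<delta> (n + n0) * (\<bar>u\<bar> + u\<^sup>2)"
      using n0[OF n] rn[OF n] by (intro est(5)) auto
    show "0 \<le> \<delta> (n + n0)"
    proof -
      have "0 \<le> R / r (n + n0)" using rn[OF n] Q.R_pos by simp
      then have "1\<^sup>2 \<le> (1 + R / r (n + n0))\<^sup>2" by (intro power_mono) auto
      moreover have "0 \<le> b (n + n0)" using \<eta>(4) \<tau>0 by (simp add: b_def less_imp_le)
      ultimately show ?thesis unfolding \<delta>_def using t0[of "n + n0"] by simp
    qed
  next
    show "(\<lambda>n. \<delta> (n + n0)) \<longlonglongrightarrow> 0" using \<delta>lim by (rule LIMSEQ_ignore_initial_segment)
  qed (rule N Z)+
  then show ?thesis by (rule LIMSEQ_offset)
qed

theorem theorem3p4: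
  fixes QL :: "real measure" and Q :: "particle measure" and R c1 c2 C :: real
    and \<tau> \<beta> :: "nat \<Rightarrow> real"
    and M :: "nat \<Rightarrow> 'w measure" and \<xi> :: "nat \<Rightarrow> 'w \<Rightarrow> particle set"
    and W :: "nat \<Rightarrow> (real^2) set"
    and N :: "'z measure" and Z :: "'z \<Rightarrow> real"
  assumes "R > 0"
    and "prob_space QL" "sets QL = sets borel" "measure QL {0<..2 * R} = 1"
    and "Q = isotropic_segment_law QL"
    and "\<And>n. \<tau> n > 0" "\<And>n. \<beta> n \<ge> 0"
    and "\<And>n. stationary_gibbs (\<tau> n) (\<beta> n) Q (M n) (\<xi> n)"
    and "\<beta> \<longlonglongrightarrow> 0"
    and "0 < c1" "\<And>n. c1 < \<tau> n" "\<And>n. \<tau> n < c2"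
    and "convex_averaging W"
    and "\<And>n. \<beta> n * measure lborel (W n) \<le> C"
    and "prob_space N" "distributed N lborel Z std_normal_density"
  shows "(\<lambda>n. wasserstein_dist (M n)
            (\<lambda>\<omega>. innovation (\<tau> n) (\<beta> n) Q (hit_functional (\<tau> n) (W n)) (\<xi> n \<omega>)) N Z)
          \<longlonglongrightarrow> 0
       \<and> (\<lambda>n. wasserstein_dist (M n)
            (\<lambda>\<omega>. innovation (\<tau> n) (\<beta> n) Q (length_functional QL (\<tau> n) (W n)) (\<xi> n \<omega>)) N Z)
          \<longlonglongrightarrow> 0"
proof
  note law = isotropic_short_segment_law[OF assms(1-4), folded assms(5)]
  interpret QL: prob_space QL by (rule assms(2))
  interpret Q: short_segment_law Q R by (rule law(1))
  note limit = innovation_normal_limit[OF law(1) assms(10-12,7,9,8,13) _ _ _ _ _ _ assms(15,16)]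
  \<comment> \<open>The plain hitting functional corresponds to the weight
    \<open>\<eta> = 1\<close>.\<close>
  have "(\<integral>\<^sup>+K. ennreal (1\<^sup>2) \<partial>Q) = 1" by (simp add: Q.emeasure_space_1)
  then have "(\<lambda>n. wasserstein_dist (M n)
      (\<lambda>\<omega>. innovation (\<tau> n) (\<beta> n) Q (\<lambda>K. 1 * hit_functional (\<tau> n) (W n) K) (\<xi> n \<omega>)) N Z) \<longlonglongrightarrow> 0"
    by (intro limit[where H=1]) auto
  then show "(\<lambda>n. wasserstein_dist (M n)
      (\<lambda>\<omega>. innovation (\<tau> n) (\<beta> n) Q (hit_functional (\<tau> n) (W n)) (\<xi> n \<omega>)) N Z) \<longlonglongrightarrow> 0" by simp
  define L where "L = (\<integral>r. r\<^sup>2 \<partial>QL)"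
  have r2: "integrable QL (\<lambda>r. r\<^sup>2)"
  proof (rule QL.integrable_const_bound)
    show "AE r in QL. norm (r\<^sup>2) \<le> (2 * R)\<^sup>2"
      using law(3)
    proof eventually_elim
      case (elim r)
      then have "r\<^sup>2 \<le> (2 * R)\<^sup>2" by (intro power_mono) auto
      then show ?case by simp
    qed
  qed (simp add: measurable_cong_sets[OF assms(3) refl])
  \<comment> \<open>Almost all lengths are positive, so their mean square cannot vanish, and
    division by \<open>sqrt L\<close> is genuine.\<close>
  have L: "0 < L"
  proof -
    have "L \<noteq> 0"
    proof
      assume "L = 0"
      then have "AE r in QL. r\<^sup>2 = 0"
        unfolding L_def using integral_nonneg_eq_0_iff_AE[OF r2] by simp
      with law(3) have "AE r in QL. False" by eventually_elim auto
      then show False using QL.AE_False by simp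
    qed
    moreover have "0 \<le> L" unfolding L_def by (intro integral_nonneg_AE) simp
    ultimately show ?thesis by simp
  qed
  have len: "length_functional QL (\<tau> n) (W n) = (\<lambda>K. seg_length K / sqrt L * hit_functional (\<tau> n) (W n) K)" for n
    by (simp add: length_functional_def L_def fun_eq_iff)
  show "(\<lambda>n. wasserstein_dist (M n)
      (\<lambda>\<omega>. innovation (\<tau> n) (\<beta> n) Q (length_functional QL (\<tau> n) (W n)) (\<xi> n \<omega>)) N Z) \<longlonglongrightarrow> 0"
    unfolding len
  proof (rule limit[where H="2 * R / sqrt L"])
    show "(\<lambda>K. seg_length K / sqrt L) \<in> borel_measurable borel" by measurable
    show "0 \<le> seg_length K / sqrt L" for K
      using L diameter_ge_0[OF compact_imp_bounded[OF compact_pts]] by (simp add: seg_length_def)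
    show "seg_length K / sqrt L \<le> 2 * R / sqrt L" if "K \<in> short_segments R" for K
      using that L by (simp add: short_segments_def divide_right_mono)
    show "0 \<le> 2 * R / sqrt L" using L assms(1) by simp
    show "seg_length (translate v K) / sqrt L = seg_length K / sqrt L" if "K \<in> segments" for K v
      using that by (simp add: seg_length_translate)
    \<comment> \<open>Dividing by the root of the mean squared length is precisely what gives the
      weight mean square 1, and thereby the limit variance 1.\<close>
    have "(\<integral>\<^sup>+K. ennreal ((seg_length K / sqrt L)\<^sup>2) \<partial>Q) = (\<integral>\<^sup>+r. ennreal ((r / sqrt L)\<^sup>2) \<partial>QL)"
      by (rule law(2)[of "\<lambda>r. ennreal ((r / sqrt L)\<^sup>2)"]) measurable
    also have "\<dots> = ennreal (\<integral>r. r\<^sup>2 / L \<partial>QL)"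
      using r2 L by (subst nn_integral_eq_integral[symmetric]) (auto simp: power_divide)
    also have "\<dots> = 1" using L by (simp add: L_def)
    finally show "(\<integral>\<^sup>+K. ennreal ((seg_length K / sqrt L)\<^sup>2) \<partial>Q) = 1" .
  qed
qed

end
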